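(* Let $\Phi$ be an irreducible root system of type $A_\ell$, $B_\ell$ or $C_\ell$ in $\mathbb{R}^\ell$, with a fixed positive system $\Phi^+$ and base $\Delta=\{\alpha_1,\dots,\alpha_\ell\}$, and let $\mathcal{I}\subseteq\Phi^+$ be an ideal. Then the toric arrangement $\mathscr{A}_{\mathcal{I}}$ (with respect to the root lattice) is inductive.
   Context: Order $\Phi^+$ by $\beta_1\ge\beta_2$ iff $\beta_1-\beta_2$ is a nonnegative integer combination of $\Delta$; an ideal is a subset $\mathcal{I}\subseteq\Phi^+$ with $\beta_1\ge\beta_2$, $\beta_1\in\mathcal{I}$, $\beta_2\in\Phi^+$ implying $\beta_2\in\mathcal{I}$. For $\beta=\sum_i s_i\alpha_i\in\mathcal{I}$ let $H_\beta=\{t\in(\mathbb{S}^1)^\ell : t_1^{s_1}\cdots t_\ell^{s_\ell}=1\}$; $\mathscr{A}_{\mathcal{I}}$ is the set of connected components of the $H_\beta$, $\beta\in\mathcal{I}$. More generally (abelian arrangements with $G=\mathbb{S}^1$): with $\Gamma\cong\mathbb{Z}^\ell$, $T=\operatorname{Hom}(\Gamma,\mathbb{S}^1)\cong(\mathbb{S}^1)^\ell$, and for $\alpha\in\Gamma\setminus\{0\}$, $c\in\mathbb{S}^1$, $H_{\alpha,c}=\{\varphi\in T:\varphi(\alpha)=c\}$, an arrangement is the set of connected components of $H_{\alpha,c}$ for $(\alpha,c)$ in a finite set; $\varnothing_\ell$ is the empty arrangement in $T$. Its poset of layers $L(\mathscr{A})$ consists of the connected components of nonempty intersections of subsets of $\mathscr{A}$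 (the empty intersection being $T$), ordered by reverse inclusion, with rank given by codimension. $\chi_{\mathscr{A}}(t)=\sum_{X\in L(\mathscr{A})}\mu(T,X)t^{\dim X}$. For $H\in\mathscr{A}$: deletion $\mathscr{A}'=\mathscr{A}\setminus\{H\}$ (in $T$), restriction $\mathscr{A}''=$ the set of connected components of nonempty $K\cap H$, $K\in\mathscr{A}'$, regarded as an arrangement in $H\cong(\mathbb{S}^1)^{\ell-1}$. The class of inductive arrangements is the smallest class such that $\varnothing_\ell$ is inductive for all $\ell\ge1$, and $\mathscr{A}$ is inductive whenever there exists $H\in\mathscr{A}$ with $\mathscr{A}''$, $\mathscr{A}'$ inductive and $\chi_{\mathscr{A}'}(t)=(t-d)\chi_{\mathscr{A}''}(t)$ for some $d\in\mathbb{Z}$.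
   Formalization: The empty arrangement is taken to be inductive also in the 0-dimensional torus (ℓ = 0), not only for ℓ ≥ 1; otherwise the claim fails already for A_1 with 𝓘 = {α_1}, whose restriction is the empty arrangement in a point. *)

theory Defs
  imports "HOL-Analysis.Analysis" "HOL-Computational_Algebra.Polynomial"
    "HOL-Combinatorics.Permutations"
begin

text \<open>Points of the torus (S^1)^l are modelled as functions nat => complex whose
values at indices i < l lie on the unit circle and which are 1 at indices >= l.
The type nat => complex carries the product topology (HOL-Analysis Function_Topology),
whose subspace topology on this set is the usual topology of (S^1)^l.
Elements of the lattice Gamma = Z^l are functions nat => int vanishing at indices >= l.\<close>

type_synonym pt = "nat \<Rightarrow> complex"
type_synonym lat = "nat \<Rightarrow> int"

definition torus :: "nat \<Rightarrow> pt set" where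
  "torus l = {t. (\<forall>i<l. cmod (t i) = 1) \<and> (\<forall>i\<ge>l. t i = 1)}"

definition in_lattice :: "nat \<Rightarrow> lat \<Rightarrow> bool" where
  "in_lattice l a \<longleftrightarrow> (\<forall>i\<ge>l. a i = 0)"

definition chr :: "nat \<Rightarrow> lat \<Rightarrow> pt \<Rightarrow> complex" where
  "chr l a t = (\<Prod>i<l. t i powi a i)"

definition hyp :: "nat \<Rightarrow> lat \<Rightarrow> complex \<Rightarrow> pt set" where
  "hyp l a c = {t \<in> torus l. chr l a t = c}"

text \<open>An arrangement is given by its ambient torus X (the whole torus, or a layer
regarded as a torus in its own right) and a finite set A of hypertori in X.
Layers: connected components of the nonempty intersections of subsets of A;
the empty intersection is the ambient X.\<close>
definition layers :: "pt set \<Rightarrow> pt set set \<Rightarrow> pt set set" where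
  "layers X A = (\<Union>B\<in>Pow A. components (X \<inter> \<Inter>B))"

definition int_indep :: "lat set \<Rightarrow> bool" where
  "int_indep F \<longleftrightarrow> (\<forall>c :: lat \<Rightarrow> int. (\<forall>i. (\<Sum>v\<in>F. c v * v i) = 0) \<longrightarrow> (\<forall>v\<in>F. c v = 0))"

definition lrank :: "lat set \<Rightarrow> nat" where
  "lrank S = Max {card F | F. F \<subseteq> S \<and> finite F \<and> int_indep F}"

text \<open>Dimension of a layer Y (a coset of a subtorus of (S^1)^l): l minus the rank of
the lattice of characters that are constant on Y.\<close>
definition tdim :: "nat \<Rightarrow> pt set \<Rightarrow> nat" where
  "tdim l Y = l - lrank {a. in_lattice l a \<and> (\<forall>s\<in>Y. \<forall>t\<in>Y. chr l a s = chr l a t)}"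

function mob :: "pt set set \<Rightarrow> pt set \<Rightarrow> pt set \<Rightarrow> int" where
  "mob L amb X =
     (if \<not> finite L then 0
      else if X = amb then 1
      else - (\<Sum>Y\<in>{Y\<in>L. X \<subset> Y \<and> Y \<subseteq> amb}. mob L amb Y))"
  by auto
termination
proof (relation "Wellfounded.measure (\<lambda>(L, amb, X). card {Z\<in>L. X \<subset> Z})", goal_cases)
  case 1 show ?case by simp
next
  case (2 L amb X Y)
  then have "{Z\<in>L. Y \<subset> Z} \<subset> {Z\<in>L. X \<subset> Z}" by auto
  then show ?case using 2 by (simp add: psubset_card_mono)
qed

declare mob.simps [simp del]

definition chi :: "nat \<Rightarrow> pt set \<Rightarrow> pt set set \<Rightarrow> int poly" where
  "chi l X A = (\<Sum>Y\<in>layers X A. monom (mob (layers X A) X Y) (tdim l Y))"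

definition restr :: "pt set set \<Rightarrow> pt set \<Rightarrow> pt set set" where
  "restr A H = (\<Union>K\<in>A - {H}. components (K \<inter> H))"

inductive inductive_arr :: "nat \<Rightarrow> pt set \<Rightarrow> pt set set \<Rightarrow> bool" for l where
  empty: "inductive_arr l X {}"
| step: "\<lbrakk> H \<in> A; inductive_arr l X (A - {H}); inductive_arr l H (restr A H);
           chi l X (A - {H}) = [:- of_int d, 1:] * chi l H (restr A H) \<rbrakk>
         \<Longrightarrow> inductive_arr l X A"

text \<open>Simple roots are indexed 0..l-1 (alpha_{i+1} has index i). seg i j = alpha_{i+1}+...+alpha_j.\<close>
definition seg :: "nat \<Rightarrow> nat \<Rightarrow> lat" where
  "seg i j = (\<lambda>k. if i \<le> k \<and> k < j then 1 else 0)"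

datatype rtype = TA | TB | TC

text \<open>Positive roots (Bourbaki numbering; in B_l alpha_l is short, in C_l alpha_l is long).\<close>
fun pos_roots :: "rtype \<Rightarrow> nat \<Rightarrow> lat set" where
  "pos_roots TA l = {seg i j | i j. i < j \<and> j \<le> l}"
| "pos_roots TB l = {seg i j | i j. i < j \<and> j \<le> l}
                    \<union> {(\<lambda>k. seg i j k + 2 * seg j l k) | i j. i < j \<and> j < l}"
| "pos_roots TC l = {seg i j | i j. i < j \<and> j < l}
                    \<union> {(\<lambda>k. 2 * seg i (l - 1) k + seg (l - 1) l k) | i. i < l}
                    \<union> {(\<lambda>k. seg i j k + 2 * seg j (l - 1) k + seg (l - 1) l k) | i j. i < j \<and> j < l}"

text \<open>Positive roots when the simple roots are labelled via a permutation s of 0..l-1.\<close>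
definition pos_roots_lab :: "rtype \<Rightarrow> nat \<Rightarrow> (nat \<Rightarrow> nat) \<Rightarrow> lat set" where
  "pos_roots_lab T l s = (\<lambda>b. b \<circ> s) ` pos_roots T l"

definition root_le :: "lat \<Rightarrow> lat \<Rightarrow> bool" where
  "root_le b2 b1 \<longleftrightarrow> (\<forall>i. b2 i \<le> b1 i)"

definition is_ideal :: "lat set \<Rightarrow> lat set \<Rightarrow> bool" where
  "is_ideal P I \<longleftrightarrow> I \<subseteq> P \<and> (\<forall>b1\<in>I. \<forall>b2\<in>P. root_le b2 b1 \<longrightarrow> b2 \<in> I)"

definition toric_arr :: "nat \<Rightarrow> lat set \<Rightarrow> pt set set" where
  "toric_arr l I = (\<Union>b\<in>I. components (hyp l b 1))"

end

theory Submission
  imports Defs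
begin

text \<open>A torsion coset of dimension \<open>d\<close> contains \<open>(k!) ^ d\<close> points whose coordinates are \<open>k!\<close>-th roots of
unity, for all large \<open>k\<close>. By Moebius inversion the characteristic polynomial counts such points in the
complement, hence obeys deletion-restriction.

In coordinates \<open>\<epsilon>\<^sub>i\<close>, numbered from the end of the Dynkin diagram, the last coordinate can be split off
whenever its hypertori are graphs over the remaining torus that meet only over hypertori already present;
the number of graphs is then the new exponent. Roots \<open>\<epsilon>\<^sub>i - \<epsilon>\<^sub>j\<close> alone always split off this way, and
ideals of type A are ideals of type B. The only obstruction in type B is that \<open>x\<close> and \<open>1/x\<close> also meet at
\<open>x = -1\<close>. One then adds the hypertori \<open>x\<^sub>n x\<^sub>k = 1\<close> one by one; restricting to such a hypertorus removes
\<open>x\<^sub>n\<close> and adds the hypertorus \<open>x\<^sub>k = -1\<close>, which stays in the class of shifted graphs with some hypertori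
\<open>x\<^sub>i = -1\<close>. In type C the obstruction disappears, and restricting to the hypertorus of \<open>2 \<epsilon>\<^sub>n\<close> gives the
full arrangement \<open>x\<^sub>i = \<plusminus>1\<close>, \<open>x\<^sub>i = x\<^sub>j\<^bsup>\<plusminus>1\<^esup>\<close>.\<close>

section \<open>Monomial functions on tori\<close>

definition torsion :: "complex \<Rightarrow> bool" where
  "torsion c \<longleftrightarrow> (\<exists>N>0. c ^ N = 1)"

lemma torsion_1 [simp]: "torsion 1" and torsion_minus_1 [simp]: "torsion (-1)"
  by (auto simp: torsion_def intro: exI[of _ 1] exI[of _ 2])

lemma torsion_norm: "torsion c \<Longrightarrow> cmod c = 1"
  by (auto simp: torsion_def dest: power_eq_1_iff)

lemma torsion_nonzero: "torsion c \<Longrightarrow> c \<noteq> 0"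
  using torsion_norm by fastforce

lemma torsion_mult:
  assumes "torsion c" "torsion d"
  shows "torsion (c * d)"
proof -
  obtain M N where MN: "M > 0" "c ^ M = 1" "N > 0" "d ^ N = 1"
    using assms by (auto simp: torsion_def)
  have "(c * d) ^ (M * N) = (c ^ M) ^ N * (d ^ N) ^ M"
    by (simp add: power_mult_distrib mult.commute[of M N] flip: power_mult)
  then show ?thesis using MN by (auto simp: torsion_def intro!: exI[of _ "M * N"])
qed

lemma torsion_inverse: "torsion c \<Longrightarrow> torsion (inverse c)"
  by (auto simp: torsion_def power_inverse)

lemma torsion_power: "torsion c \<Longrightarrow> torsion (c ^ k)"
  by (induction k) (auto intro: torsion_mult)

lemma torsion_powi: "torsion c \<Longrightarrow> torsion (c powi k)"
  by (auto simp: power_int_def intro: torsion_power torsion_inverse)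

lemma torsion_powi_root:
  assumes "torsion (z powi k)" "k \<noteq> 0"
  shows "torsion z"
proof -
  have "torsion (z ^ nat \<bar>k\<bar>)"
    using assms torsion_inverse[of "z powi k"] by (cases "k \<ge> 0") (auto simp: power_int_def power_inverse)
  then obtain N where "N > 0" "z ^ (nat \<bar>k\<bar> * N) = 1" by (auto simp: torsion_def power_mult)
  then show ?thesis using assms(2) by (auto simp: torsion_def intro!: exI[of _ "nat \<bar>k\<bar> * N"])
qed

lemma torus_norm: "t \<in> torus n \<Longrightarrow> cmod (t i) = 1"
  by (cases "i < n") (auto simp: torus_def)

lemma torus_nonzero: "t \<in> torus n \<Longrightarrow> t i \<noteq> 0"
  using torus_norm[of t n i] by auto

lemma torus_outside: "t \<in> torus n \<Longrightarrow> i \<ge> n \<Longrightarrow> t i = 1"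
  by (auto simp: torus_def)

lemma one_in_torus [simp]: "(\<lambda>_. 1) \<in> torus n"
  by (auto simp: torus_def)

lemma torus_upd: "t \<in> torus n \<Longrightarrow> i < n \<Longrightarrow> cmod z = 1 \<Longrightarrow> t(i := z) \<in> torus n"
  by (auto simp: torus_def)

lemma torus_mono: "m \<le> n \<Longrightarrow> torus m \<subseteq> torus n"
  by (auto simp: torus_def) (metis norm_one not_less)

lemma chr_add: "t \<in> torus n \<Longrightarrow> chr n (\<lambda>i. a i + b i) t = chr n a t * chr n b t"
  by (simp add: chr_def power_int_add torus_nonzero prod.distrib)

lemma prod_power_int: "(\<Prod>i\<in>A. f i :: 'a :: field) powi k = (\<Prod>i\<in>A. f i powi k)"
  by (induction A rule: infinite_finite_induct) (auto simp: power_int_mult_distrib)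

lemma chr_scale: "chr n (\<lambda>i. k * a i) t = chr n a t powi k"
  by (simp add: chr_def prod_power_int power_int_mult mult.commute[of k])

lemma chr_zero: "chr n (\<lambda>i. 0) t = 1"
  by (simp add: chr_def)

lemma chr_unit: "i < n \<Longrightarrow> chr n (\<lambda>j. if j = i then k else 0) t = t i powi k"
  by (simp add: chr_def if_distrib[of "\<lambda>k. _ powi k"] cong: if_cong)

lemma chr_norm: "t \<in> torus n \<Longrightarrow> cmod (chr n a t) = 1"
  by (simp add: chr_def norm_power_int torus_norm flip: prod_norm)

text \<open>The coefficient is required to be a root of unity, so that torsion points map to torsion points.\<close>

definition monomial :: "nat \<Rightarrow> (pt \<Rightarrow> complex) \<Rightarrow> bool" where
  "monomial n f \<longleftrightarrow> (\<exists>c a. torsion c \<and> in_lattice n a \<and> (\<forall>t\<in>torus n. f t = c * chr n a t))"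

lemma monomialE:
  assumes "monomial n f"
  obtains c a where "torsion c" "in_lattice n a" "\<And>t. t \<in> torus n \<Longrightarrow> f t = c * chr n a t"
  using assms unfolding monomial_def by blast

lemma monomial_cong: "monomial n f \<Longrightarrow> (\<And>t. t \<in> torus n \<Longrightarrow> f t = g t) \<Longrightarrow> monomial n g"
  unfolding monomial_def by metis

lemma monomial_const: "torsion c \<Longrightarrow> monomial n (\<lambda>_. c)"
  unfolding monomial_def by (intro exI[of _ c] exI[of _ "\<lambda>_. 0"]) (auto simp: chr_zero in_lattice_def)

lemma monomial_mult:
  assumes "monomial n f" "monomial n g"
  shows "monomial n (\<lambda>t. f t * g t)"
proof -
  obtain c a where f: "torsion c" "in_lattice n a" "\<And>t. t \<in> torus n \<Longrightarrow> f t = c * chr n a t"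
    using monomialE[OF assms(1)] by blast
  obtain d b where g: "torsion d" "in_lattice n b" "\<And>t. t \<in> torus n \<Longrightarrow> g t = d * chr n b t"
    using monomialE[OF assms(2)] by blast
  show ?thesis unfolding monomial_def
    by (intro exI[of _ "c * d"] exI[of _ "\<lambda>i. a i + b i"])
      (use f g in \<open>auto simp: chr_add in_lattice_def intro: torsion_mult\<close>)
qed

lemma monomial_powi:
  assumes "monomial n f"
  shows "monomial n (\<lambda>t. f t powi k)"
proof -
  obtain c a where f: "torsion c" "in_lattice n a" "\<And>t. t \<in> torus n \<Longrightarrow> f t = c * chr n a t"
    using monomialE[OF assms] by blast
  show ?thesis unfolding monomial_def
    by (intro exI[of _ "c powi k"] exI[of _ "\<lambda>i. k * a i"])
      (use f in \<open>auto simp: chr_scale in_lattice_def power_int_mult_distrib intro: torsion_powi\<close>)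
qed

lemma monomial_inverse: "monomial n f \<Longrightarrow> monomial n (\<lambda>t. inverse (f t))"
  using monomial_powi[of n f "-1"] by simp

lemma monomial_divide: "monomial n f \<Longrightarrow> monomial n g \<Longrightarrow> monomial n (\<lambda>t. f t / g t)"
  by (simp add: divide_inverse monomial_mult monomial_inverse)

lemma monomial_coord: "monomial n (\<lambda>t. t i)"
proof (cases "i < n")
  case True
  show ?thesis unfolding monomial_def
    by (intro exI[of _ 1] exI[of _ "\<lambda>j. if j = i then 1 else 0"])
      (use True in \<open>auto simp: chr_unit in_lattice_def\<close>)
next
  case False
  show ?thesis by (rule monomial_cong[OF monomial_const[OF torsion_1]])
    (use False in \<open>auto simp: torus_outside\<close>)
qed

lemma monomial_prod: "(\<And>i. i \<in> A \<Longrightarrow> monomial n (f i)) \<Longrightarrow> monomial n (\<lambda>t. \<Prod>i\<in>A. f i t)"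
  by (induction A rule: infinite_finite_induct) (auto intro: monomial_mult monomial_const)

lemmas monomial_intros = monomial_const[OF torsion_1] monomial_const[OF torsion_minus_1] monomial_coord
  monomial_mult monomial_powi monomial_inverse monomial_divide monomial_prod

lemma monomial_norm: "monomial n f \<Longrightarrow> t \<in> torus n \<Longrightarrow> cmod (f t) = 1"
  by (auto elim!: monomialE simp: norm_mult chr_norm torsion_norm)

lemma monomial_nonzero: "monomial n f \<Longrightarrow> t \<in> torus n \<Longrightarrow> f t \<noteq> 0"
  using monomial_norm by fastforce

lemma monomial_continuous:
  assumes "monomial n f"
  shows "continuous_on (torus n) f"
proof -
  obtain c a where f: "\<And>t. t \<in> torus n \<Longrightarrow> f t = c * chr n a t"
    using monomialE[OF assms] by blast
  have "continuous_on (torus n) (\<lambda>t. c * chr n a t)"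
    unfolding chr_def
    by (intro continuous_intros continuous_on_prod continuous_on_power_int
        continuous_on_subset[OF continuous_on_product_coordinates]) (auto simp: torus_nonzero)
  then show ?thesis by (simp add: f cong: continuous_on_cong)
qed

definition monomial_map :: "nat \<Rightarrow> nat \<Rightarrow> (pt \<Rightarrow> pt) \<Rightarrow> bool" where
  "monomial_map m n g \<longleftrightarrow> g ` torus m \<subseteq> torus n \<and> (\<forall>i. monomial m (\<lambda>t. g t i))"

lemma monomial_mapI:
  assumes "\<And>i. i < n \<Longrightarrow> monomial m (\<lambda>t. g t i)" "\<And>t i. t \<in> torus m \<Longrightarrow> i \<ge> n \<Longrightarrow> g t i = 1"
  shows "monomial_map m n g"
proof -
  have "monomial m (\<lambda>t. g t i)" for i
    by (cases "i < n") (use assms in \<open>auto intro: monomial_cong[OF monomial_const[OF torsion_1]]\<close>)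
  then show ?thesis
    using assms(2) monomial_norm[of m "\<lambda>t. g t _"] by (auto simp: monomial_map_def torus_def[of n])
qed

lemma monomial_map_in: "monomial_map m n g \<Longrightarrow> t \<in> torus m \<Longrightarrow> g t \<in> torus n"
  by (auto simp: monomial_map_def)

lemma monomial_map_coord: "monomial_map m n g \<Longrightarrow> monomial m (\<lambda>t. g t i)"
  by (auto simp: monomial_map_def)

lemma monomial_map_id: "monomial_map n n (\<lambda>t. t)"
  by (auto simp: monomial_map_def monomial_coord)

lemma monomial_comp:
  assumes "monomial_map m n g" "monomial n f"
  shows "monomial m (\<lambda>t. f (g t))"
proof -
  obtain c a where f: "torsion c" "\<And>t. t \<in> torus n \<Longrightarrow> f t = c * chr n a t"
    using monomialE[OF assms(2)] by blast
  have "monomial m (\<lambda>t. c * (\<Prod>i<n. g t i powi a i))"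
    by (intro monomial_intros monomial_const monomial_map_coord[OF assms(1)] f(1))
  then show ?thesis
    by (rule monomial_cong) (use f assms in \<open>auto simp: chr_def monomial_map_in\<close>)
qed

lemma monomial_map_comp: "monomial_map l m g \<Longrightarrow> monomial_map m n f \<Longrightarrow> monomial_map l n (f \<circ> g)"
  using monomial_comp[of l m g "\<lambda>t. f t _"] by (fastforce simp: monomial_map_def image_subset_iff)

lemma monomial_map_mono: "monomial_map m n g \<Longrightarrow> n \<le> k \<Longrightarrow> monomial_map m k g"
  using torus_mono by (fastforce simp: monomial_map_def)

lemma monomial_map_subset: "m \<le> n \<Longrightarrow> monomial_map m n (\<lambda>t. t)"
  using monomial_map_mono[OF monomial_map_id] .

lemma monomial_map_continuous: "monomial_map m n g \<Longrightarrow> continuous_on (torus m) g"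
  by (intro continuous_on_coordinatewise_then_product monomial_continuous monomial_map_coord)

definition truncate :: "nat \<Rightarrow> pt \<Rightarrow> pt" where
  "truncate n t = (\<lambda>i. if i < n then t i else 1)"

lemma truncate_below [simp]: "i < n \<Longrightarrow> truncate n t i = t i"
  by (simp add: truncate_def)

lemma truncate_outside [simp]: "i \<ge> n \<Longrightarrow> truncate n t i = 1"
  by (simp add: truncate_def)

lemma truncate_truncate [simp]: "truncate n (truncate n t) = truncate n t"
  by (auto simp: truncate_def)

lemma truncate_upd [simp]: "i \<ge> n \<Longrightarrow> truncate n (t(i := z)) = truncate n t"
  by (auto simp: truncate_def)

lemma truncate_torus [simp]: "t \<in> torus n \<Longrightarrow> truncate n t = t"
  by (auto simp: truncate_def torus_outside)

lemma truncate_in_torus: "t \<in> torus m \<Longrightarrow> truncate n t \<in> torus n"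
  using torus_norm by (auto simp: truncate_def torus_def[of n])

lemma monomial_map_truncate: "monomial_map m n (truncate n)"
  by (rule monomial_mapI) (auto simp: truncate_def monomial_coord)

section \<open>Monomial automorphisms\<close>

definition monomial_aut :: "nat \<Rightarrow> (pt \<Rightarrow> pt) \<Rightarrow> bool" where
  "monomial_aut n g \<longleftrightarrow> monomial_map n n g \<and>
    (\<exists>g'. monomial_map n n g' \<and> (\<forall>t\<in>torus n. g' (g t) = t \<and> g (g' t) = t))"

lemma monomial_autI:
  assumes "monomial_map n n g" "monomial_map n n g'"
    "\<And>t. t \<in> torus n \<Longrightarrow> g' (g t) = t" "\<And>t. t \<in> torus n \<Longrightarrow> g (g' t) = t"
  shows "monomial_aut n g"
  using assms unfolding monomial_aut_def by blast

lemma monomial_aut_inverseE: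
  assumes "monomial_aut n g"
  obtains g' where "monomial_aut n g'"
    "\<And>t. t \<in> torus n \<Longrightarrow> g' (g t) = t" "\<And>t. t \<in> torus n \<Longrightarrow> g (g' t) = t"
  using assms unfolding monomial_aut_def by blast

lemma monomial_aut_map: "monomial_aut n g \<Longrightarrow> monomial_map n n g"
  by (simp add: monomial_aut_def)

lemmas monomial_aut_in = monomial_map_in[OF monomial_aut_map]

lemma bij_betw_monomial_aut: "monomial_aut n g \<Longrightarrow> bij_betw g (torus n) (torus n)"
  unfolding monomial_aut_def monomial_map_def bij_betw_def inj_on_def
    by (metis image_subset_iff subsetI subset_antisym image_eqI)

lemmas monomial_aut_inj = bij_betw_imp_inj_on[OF bij_betw_monomial_aut]
  and monomial_aut_image = bij_betw_imp_surj_on[OF bij_betw_monomial_aut]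

lemma monomial_aut_id: "monomial_aut n (\<lambda>t. t)"
  by (rule monomial_autI[OF monomial_map_id monomial_map_id]) auto

lemma monomial_aut_comp:
  assumes "monomial_aut n f" "monomial_aut n g"
  shows "monomial_aut n (f \<circ> g)"
proof -
  obtain f' where f': "monomial_aut n f'"
    "\<And>t. t \<in> torus n \<Longrightarrow> f' (f t) = t" "\<And>t. t \<in> torus n \<Longrightarrow> f (f' t) = t"
    using monomial_aut_inverseE[OF assms(1)] by blast
  obtain g' where g': "monomial_aut n g'"
    "\<And>t. t \<in> torus n \<Longrightarrow> g' (g t) = t" "\<And>t. t \<in> torus n \<Longrightarrow> g (g' t) = t"
    using monomial_aut_inverseE[OF assms(2)] by blast
  show ?thesis
  proof (rule monomial_autI)
    show "monomial_map n n (f \<circ> g)" "monomial_map n n (g' \<circ> f')"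
      by (intro monomial_map_comp[of n n] monomial_aut_map assms f'(1) g'(1))+
  qed (simp_all add: f' g' monomial_aut_in[OF f'(1)] monomial_aut_in[OF assms(2)])
qed

lemma monomial_aut_permute:
  assumes "s permutes {..<n}"
  shows "monomial_aut n (\<lambda>t. t \<circ> s)"
proof (rule monomial_autI)
  have "monomial_map n n (\<lambda>t. t \<circ> r)" if "r permutes {..<n}" for r
    using permutes_not_in[OF that] by (intro monomial_mapI) (auto simp: monomial_coord torus_outside)
  then show "monomial_map n n (\<lambda>t. t \<circ> s)" "monomial_map n n (\<lambda>t. t \<circ> inv s)"
    using assms permutes_inv by auto
qed (auto simp: fun_eq_iff permutes_inverses[OF assms])

lemma monomial_map_upd:
  assumes "i < n" "monomial n f"
  shows "monomial_map n n (\<lambda>t. t(i := f t))"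
proof (rule monomial_mapI)
  show "monomial n (\<lambda>t. (t(i := f t)) j)" for j
    using assms(2) by (cases "j = i") (simp_all add: monomial_coord)
qed (use assms(1) in \<open>auto simp: torus_outside\<close>)

lemma monomial_aut_shear:
  assumes "i < n" "monomial n f" "\<And>t z. f (t(i := z)) = f t"
  shows "monomial_aut n (\<lambda>t. t(i := t i * f t))"
proof (rule monomial_autI)
  show "monomial_map n n (\<lambda>t. t(i := t i * f t))" "monomial_map n n (\<lambda>t. t(i := t i / f t))"
    using assms(1,2) by (intro monomial_map_upd monomial_intros; simp)+
qed (use assms(3) monomial_nonzero[OF assms(2)] in auto)

definition extend :: "nat \<Rightarrow> (pt \<Rightarrow> pt) \<Rightarrow> pt \<Rightarrow> pt" where
  "extend m g t = (\<lambda>i. if i < m then g (truncate m t) i else t i)"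

lemma truncate_extend: "t \<in> torus n \<Longrightarrow> monomial_aut m g \<Longrightarrow> truncate m (extend m g t) = g (truncate m t)"
  using torus_outside[OF monomial_aut_in[OF _ truncate_in_torus], of m g t n]
  by (auto simp: truncate_def extend_def fun_eq_iff)

lemma extend_torus: "monomial_aut m g \<Longrightarrow> t \<in> torus m \<Longrightarrow> extend m g t = g t"
  using torus_outside[OF monomial_aut_in, of m g t] by (auto simp: extend_def fun_eq_iff torus_outside)

lemma monomial_aut_extend:
  assumes "monomial_aut m g" "m \<le> n"
  shows "monomial_aut n (extend m g)"
proof -
  obtain g' where g': "monomial_aut m g'"
    "\<And>t. t \<in> torus m \<Longrightarrow> g' (g t) = t" "\<And>t. t \<in> torus m \<Longrightarrow> g (g' t) = t"
    using monomial_aut_inverseE[OF assms(1)] by blast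
  have ext: "monomial_map n n (extend m h)" if "monomial_aut m h" for h
  proof (rule monomial_mapI)
    show "monomial n (\<lambda>t. extend m h t i)" for i
      using monomial_comp[OF monomial_map_truncate monomial_map_coord[OF monomial_aut_map[OF that]]]
      by (cases "i < m") (auto simp: extend_def monomial_coord)
  qed (use assms(2) in \<open>auto simp: extend_def torus_outside\<close>)
  have cancel: "extend m h' (extend m h t) = t"
    if "monomial_aut m h" "\<And>t. t \<in> torus m \<Longrightarrow> h' (h t) = t" "t \<in> torus n" for h h' t
    unfolding extend_def[of m h'] truncate_extend[OF that(3,1)] that(2)[OF truncate_in_torus[OF that(3)]]
    by (auto simp: extend_def)
  show ?thesis
    by (rule monomial_autI[OF ext[OF assms(1)] ext[OF g'(1)]])
      (use assms g' cancel[of g g'] cancel[of g' g] in auto)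
qed

lemma chr_shear:
  assumes "t \<in> torus n" "p < n" "r < n" "p \<noteq> r"
  shows "chr n a (t(r := t r * t p powi e)) = chr n (a(p := a p + e * a r)) t"
proof -
  have "chr n a (t(r := t r * t p powi e)) = (\<Prod>i<n. t i powi a i * (if i = r then t p powi (e * a r) else 1))"
    unfolding chr_def by (rule prod.cong) (auto simp: power_int_mult_distrib power_int_mult)
  also have "\<dots> = (\<Prod>i<n. t i powi a i * (if i = p then t p powi (e * a r) else 1))"
    using assms(2,3) by (simp add: prod.distrib)
  also have "\<dots> = chr n (a(p := a p + e * a r)) t"
    unfolding chr_def by (rule prod.cong) (auto simp: power_int_add torus_nonzero[OF assms(1)])
  finally show ?thesis .
qed

text \<open>Euclid's algorithm on the exponents, each step being a shear.\<close>

lemma chr_normal_form: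
  assumes "in_lattice n a" "a i0 \<noteq> 0"
  shows "\<exists>g k i. monomial_aut n g \<and> i < n \<and> k \<noteq> 0 \<and> (\<forall>t\<in>torus n. chr n a (g t) = t i powi k)"
  using assms
proof (induction "\<Sum>i<n. nat \<bar>a i\<bar>" arbitrary: a i0 rule: less_induct)
  case less
  have supp: "i < n" if "a i \<noteq> 0" for i using less.prems(1) that by (metis in_lattice_def not_less)
  show ?case
  proof (cases "\<exists>j. j \<noteq> i0 \<and> a j \<noteq> 0")
    case False
    then have "a = (\<lambda>j. if j = i0 then a i0 else 0)" by (auto simp: fun_eq_iff)
    then have "chr n a = chr n (\<lambda>j. if j = i0 then a i0 else 0)" by (rule arg_cong)
    then have "chr n a t = t i0 powi a i0" for t
      by (simp only: chr_unit[OF supp[OF less.prems(2)]])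
    then show ?thesis using supp less.prems(2) monomial_aut_id by blast
  next
    case True
    then obtain j where j: "j \<noteq> i0" "a j \<noteq> 0" by blast
    obtain p r where pr: "p \<noteq> r" "a p \<noteq> 0" "a r \<noteq> 0" "\<bar>a r\<bar> \<le> \<bar>a p\<bar>"
      using that[of j i0] that[of i0 j] j less.prems(2) by linarith
    define e where "e = - sgn (a p) * sgn (a r)"
    define b where "b = a(p := a p + e * a r)"
    define h where "h t = t(r := t r * t p powi e)" for t :: pt
    have smaller: "\<bar>b p\<bar> < \<bar>a p\<bar>" using pr by (auto simp: b_def e_def sgn_if split: if_splits)
    have chr_h: "chr n a (h t) = chr n b t" if "t \<in> torus n" for t
      unfolding h_def b_def using chr_shear[OF that] supp pr by blast
    have "(\<Sum>i<n. nat \<bar>b i\<bar>) < (\<Sum>i<n. nat \<bar>a i\<bar>)"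
    proof (rule sum_strict_mono_ex1)
      show "\<forall>i\<in>{..<n}. nat \<bar>b i\<bar> \<le> nat \<bar>a i\<bar>" using smaller by (auto simp: b_def)
      show "\<exists>i\<in>{..<n}. nat \<bar>b i\<bar> < nat \<bar>a i\<bar>" using smaller supp[OF pr(2)] by (intro bexI[of _ p]) auto
    qed auto
    moreover have "in_lattice n b" "b r \<noteq> 0"
      using less.prems(1) supp[OF pr(2)] pr by (auto simp: in_lattice_def b_def)
    ultimately obtain g k i where g: "monomial_aut n g" "i < n" "k \<noteq> 0" "\<forall>t\<in>torus n. chr n b (g t) = t i powi k"
      using less.hyps[of b r] by blast
    have "monomial_aut n h" unfolding h_def
      by (rule monomial_aut_shear) (use supp[OF pr(3)] pr(1) in \<open>simp_all add: monomial_powi monomial_coord\<close>)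
    from monomial_aut_comp[OF this g(1)] show ?thesis
      using g chr_h[OF monomial_aut_in[OF g(1)]] by (intro exI[of _ "h \<circ> g"] exI[of _ k] exI[of _ i]) simp
  qed
qed

section \<open>Torsion cosets\<close>

text \<open>Every torsion translate of a subtorus is the image of a coordinate subtorus under a monomial automorphism.\<close>

definition torsion_coset :: "nat \<Rightarrow> pt set \<Rightarrow> bool" where
  "torsion_coset l Y \<longleftrightarrow> (\<exists>d\<le>l. \<exists>g. monomial_aut l g \<and> Y = g ` torus d)"

lemma torsion_cosetE:
  assumes "torsion_coset l Y"
  obtains d g where "d \<le> l" "monomial_aut l g" "Y = g ` torus d"
  using assms unfolding torsion_coset_def by blast

lemma torsion_coset_torus: "d \<le> l \<Longrightarrow> torsion_coset l (torus d)"
  unfolding torsion_coset_def using monomial_aut_id by (intro exI[of _ d] conjI exI[of _ "\<lambda>t. t"]) auto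

lemma torsion_coset_nonempty: "torsion_coset l Y \<Longrightarrow> Y \<noteq> {}"
  by (elim torsion_cosetE) (metis image_is_empty empty_iff one_in_torus)

lemma torsion_coset_subset:
  assumes "torsion_coset l Y"
  shows "Y \<subseteq> torus l"
proof -
  obtain d g where "d \<le> l" "monomial_aut l g" "Y = g ` torus d" using torsion_cosetE[OF assms] by blast
  then show ?thesis using image_mono[OF torus_mono, of d l g] monomial_aut_image[of l g] by simp
qed

lemma torsion_coset_image:
  assumes "monomial_aut l g" "torsion_coset n Y" "n \<le> l"
  shows "torsion_coset l (g ` Y)"
proof -
  obtain d h where h: "d \<le> n" "monomial_aut n h" "Y = h ` torus d" using torsion_cosetE[OF assms(2)] by blast
  have "extend n h t = h t" if "t \<in> torus d" for t
    using extend_torus[OF h(2)] torus_mono[OF h(1)] that by blast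
  then have "g ` Y = (g \<circ> extend n h) ` torus d" unfolding h(3) by (simp add: image_image)
  moreover have "monomial_aut l (g \<circ> extend n h)"
    by (intro monomial_aut_comp monomial_aut_extend assms(1,3) h(2))
  ultimately show ?thesis unfolding torsion_coset_def using h(1) assms(3) by (blast intro: order_trans)
qed

lemma torus_iff_Suc: "t \<in> torus n \<longleftrightarrow> t \<in> torus (Suc n) \<and> t n = 1"
  by (auto simp: torus_def less_Suc_eq) (metis Suc_leI le_neq_implies_less)

lemma torsion_coset_coord:
  assumes "i < n" "torsion z"
  shows "torsion_coset n {x \<in> torus n. x i = z}"
proof -
  obtain m where n: "n = Suc m" using assms(1) by (cases n) auto
  define s where "s = Transposition.transpose i m"
  define g where "g t = (t \<circ> s)(i := t m * z)" for t :: pt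
  have s: "s permutes {..<n}" unfolding s_def by (rule permutes_swap_id) (use assms(1) n in auto)
  have ss [simp]: "s (s j) = j" "s i = m" "s m = i" for j by (simp_all add: s_def)
  have "monomial_aut n ((\<lambda>t. t(i := t i * z)) \<circ> (\<lambda>t. t \<circ> s))"
    by (rule monomial_aut_comp[OF monomial_aut_shear[OF assms(1) monomial_const[OF assms(2)]]
      monomial_aut_permute[OF s]]) simp
  then have g: "monomial_aut n g" by (simp add: o_def g_def [abs_def])
  have "g ` torus m = {x \<in> torus n. x i = z}"
  proof safe
    fix u assume u: "u \<in> torus m"
    then show "g u \<in> torus n" using monomial_aut_in[OF g] torus_mono[of m n] n by auto
    show "g u i = z" using u by (simp add: g_def torus_outside)
  next
    fix x assume x: "x \<in> torus n" "z = x i"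
    have "(x(i := 1)) \<circ> s \<in> torus n"
      using monomial_aut_in[OF monomial_aut_permute[OF s] torus_upd[OF x(1) assms(1)]] by simp
    then have "(x(i := 1)) \<circ> s \<in> torus m" by (simp add: torus_iff_Suc[of _ m] flip: n)
    moreover have "g ((x(i := 1)) \<circ> s) = x" using x by (auto simp: g_def fun_eq_iff)
    ultimately show "x \<in> g ` torus m" by (metis image_eqI)
  qed
  then show ?thesis unfolding torsion_coset_def using g n by (metis lessI less_imp_le)
qed

definition locus :: "nat \<Rightarrow> (pt \<Rightarrow> complex) set \<Rightarrow> pt set" where
  "locus n F = {t \<in> torus n. \<forall>f\<in>F. f t = 1}"

lemma torsion_coset_locus:
  assumes "torsion_coset l Y"
  obtains F where "finite F" "\<And>f. f \<in> F \<Longrightarrow> monomial l f" "Y = locus l F"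
proof -
  obtain d g where g: "d \<le> l" "monomial_aut l g" "Y = g ` torus d" using torsion_cosetE[OF assms] by blast
  obtain g' where g': "monomial_aut l g'"
    "\<And>t. t \<in> torus l \<Longrightarrow> g' (g t) = t" "\<And>t. t \<in> torus l \<Longrightarrow> g (g' t) = t"
    using monomial_aut_inverseE[OF g(2)] by blast
  let ?F = "(\<lambda>i t. g' t i) ` {d..<l}"
  have sub: "torus d \<subseteq> torus l" using g(1) by (rule torus_mono)
  have "Y = locus l ?F"
  proof
    show "Y \<subseteq> locus l ?F"
      using sub g'(2) monomial_aut_in[OF g(2)] by (auto simp: g(3) locus_def torus_outside)
    show "locus l ?F \<subseteq> Y"
    proof
      fix t assume t: "t \<in> locus l ?F"
      then have "g' t \<in> torus d"
        using monomial_aut_in[OF g'(1), of t] by (auto simp: locus_def torus_def[of d] torus_norm torus_outside)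
      then show "t \<in> Y" unfolding g(3) using g'(3)[of t] t
        by (auto simp: locus_def intro: image_eqI[of _ _ "g' t"])
    qed
  qed
  then show thesis
    using monomial_map_coord[OF monomial_aut_map[OF g'(1)]] by (intro that[of ?F]) auto
qed

lemma closed_torus: "closed (torus n)"
proof -
  have "torus n = (\<Inter>i\<in>{..<n}. {t. cmod (t i) = 1}) \<inter> (\<Inter>i\<in>{n..}. {t. t i = 1})"
    by (auto simp: torus_def)
  moreover have "closed {t::pt. cmod (t i) = 1}" "closed {t::pt. t i = 1}" for i
    by (intro closed_Collect_eq continuous_intros continuous_on_product_coordinates)+
  ultimately show ?thesis by (auto intro!: closed_Int closed_INT)
qed

lemma closed_locus:
  assumes "\<And>f. f \<in> F \<Longrightarrow> monomial n f"
  shows "closed (locus n F)"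
proof -
  have "closed (torus n \<inter> (\<Inter>f\<in>F. {t \<in> torus n. f t = 1}))"
    by (intro closed_Int closed_torus closed_INT ballI
        continuous_closed_preimage_constant[OF monomial_continuous[OF assms] closed_torus])
  moreover have "locus n F = torus n \<inter> (\<Inter>f\<in>F. {t \<in> torus n. f t = 1})" by (auto simp: locus_def)
  ultimately show ?thesis by simp
qed

lemma connected_torus: "connected (torus n)"
proof -
  have "path_component (torus n) (\<lambda>_. 1) t" if t: "t \<in> torus n" for t
  proof -
    define g where "g = (\<lambda>s::real. \<lambda>i. cis (s * Arg (t i)))"
    have "path g" unfolding path_def g_def
      by (intro continuous_on_coordinatewise_then_product continuous_intros)
    moreover have "path_image g \<subseteq> torus n" using t by (auto simp: path_image_def torus_def g_def)
    moreover have "pathstart g = (\<lambda>_. 1)" by (simp add: pathstart_def g_def)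
    moreover have "pathfinish g = t"
      using torus_norm[OF t] torus_nonzero[OF t] by (simp add: pathfinish_def g_def cis_Arg sgn_div_norm)
    ultimately show ?thesis unfolding path_component_def by blast
  qed
  then have "path_connected (torus n)"
    unfolding path_connected_component by (meson path_component_sym path_component_trans)
  then show ?thesis by (rule path_connected_imp_connected)
qed

lemma connected_torsion_coset:
  assumes "torsion_coset l Y"
  shows "connected Y"
proof -
  obtain d g where "d \<le> l" "monomial_aut l g" "Y = g ` torus d" using torsion_cosetE[OF assms] by blast
  then show ?thesis
    using continuous_on_subset[OF monomial_map_continuous[OF monomial_aut_map] torus_mono]
    by (auto intro: connected_continuous_image connected_torus)
qed

lemma closed_torsion_coset: "torsion_coset l Y \<Longrightarrow> closed Y"
  by (metis torsion_coset_locus closed_locus)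

lemma components_disjoint_Union:
  assumes "finite F" "disjoint F" "\<And>C. C \<in> F \<Longrightarrow> closed C \<and> connected C \<and> C \<noteq> {}"
  shows "components (\<Union>F) = F"
proof
  show sub: "F \<subseteq> components (\<Union>F)"
  proof
    fix C assume C: "C \<in> F"
    have "D \<subseteq> C" if D: "C \<subseteq> D" "D \<subseteq> \<Union>F" "connected D" for D
    proof -
      have "closed C" "closed (\<Union>(F - {C}))" using assms C by auto
      moreover have "C \<inter> \<Union>(F - {C}) = {}" using assms(2) C by (auto simp: disjoint_def)
      ultimately have "C \<inter> D = {} \<or> \<Union>(F - {C}) \<inter> D = {}"
        using D by (intro connected_closedD) auto
      then show ?thesis using assms(3)[OF C] D by blast
    qed
    then show "C \<in> components (\<Union>F)" unfolding in_components_maximal using assms(3)[OF C] C by blast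
  qed
  show "components (\<Union>F) \<subseteq> F"
  proof
    fix D assume D: "D \<in> components (\<Union>F)"
    then obtain x C where "x \<in> D" "x \<in> C" "C \<in> F"
      using in_components_nonempty in_components_subset by blast
    then show "D \<in> F" using components_nonoverlap[OF D, of C] sub by blast
  qed
qed

definition torsion_union :: "nat \<Rightarrow> pt set \<Rightarrow> bool" where
  "torsion_union l S \<longleftrightarrow> finite (components S) \<and> (\<forall>C\<in>components S. torsion_coset l C)"

lemma components_Union_torsion_cosets:
  "finite F \<Longrightarrow> disjoint F \<Longrightarrow> (\<And>C. C \<in> F \<Longrightarrow> torsion_coset l C) \<Longrightarrow> components (\<Union>F) = F"
  by (rule components_disjoint_Union)
    (auto intro: closed_torsion_coset connected_torsion_coset dest: torsion_coset_nonempty)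

lemma components_torsion_coset: "torsion_coset l Y \<Longrightarrow> components Y = {Y}"
  using components_Union_torsion_cosets[of "{Y}" l] by (simp add: disjoint_def)

lemma torsion_union_empty: "torsion_union l {}"
  by (simp add: torsion_union_def)

lemma torsion_union_coset: "torsion_coset l Y \<Longrightarrow> torsion_union l Y"
  by (simp add: torsion_union_def components_torsion_coset)

lemma torsion_union_subset: "torsion_union l S \<Longrightarrow> S \<subseteq> torus l"
  unfolding torsion_union_def using Union_components[of S] torsion_coset_subset by blast

lemma torsion_unionI:
  assumes "finite F" "disjoint F" "\<And>C. C \<in> F \<Longrightarrow> torsion_coset l C"
  shows "torsion_union l (\<Union>F)"
  unfolding torsion_union_def using components_Union_torsion_cosets[OF assms] assms by simp

lemma disjoint_components: "disjoint (components S)"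
  by (intro disjointI) (metis components_nonoverlap)

lemma torsion_union_UN:
  assumes "finite J" "disjoint_family_on G J" "\<And>j. j \<in> J \<Longrightarrow> torsion_union l (G j)"
  shows "torsion_union l (\<Union>j\<in>J. G j)"
proof -
  have "disjoint (\<Union>j\<in>J. components (G j))"
    by (rule disjoint_UN[OF _ disjoint_family_on_bisimulation[OF assms(2)]])
      (simp_all add: disjoint_components)
  then have "torsion_union l (\<Union>(\<Union>j\<in>J. components (G j)))"
    using assms(1,3) by (intro torsion_unionI) (auto simp: torsion_union_def)
  moreover have "\<Union>(\<Union>j\<in>J. components (G j)) = (\<Union>j\<in>J. \<Union>(components (G j)))" by blast
  ultimately show ?thesis by simp
qed

lemma components_image:
  assumes "monomial_aut l g" "torsion_union n S" "n \<le> l"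
  shows "components (g ` S) = (`) g ` components S"
proof -
  have "S \<subseteq> torus l" using torsion_union_subset[OF assms(2)] torus_mono[OF assms(3)] by blast
  then have "inj_on g (\<Union>(components S))" using monomial_aut_inj[OF assms(1)] by (simp add: inj_on_subset)
  then have "disjoint ((`) g ` components S)" by (rule disjoint_image[OF _ disjoint_components])
  then have "components (\<Union>((`) g ` components S)) = (`) g ` components S"
    using assms by (intro components_Union_torsion_cosets[of _ l])
      (auto simp: torsion_union_def intro: torsion_coset_image)
  then show ?thesis by (simp flip: image_Union)
qed

lemma torsion_union_image:
  assumes "monomial_aut l g" "torsion_union n S" "n \<le> l"
  shows "torsion_union l (g ` S)"
  using assms(2) components_image[OF assms] torsion_coset_image[OF assms(1) _ assms(3)]
    by (auto simp: torsion_union_def)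

lemma finite_powi_roots:
  assumes "k \<noteq> 0"
  shows "finite {z::complex. z powi k = c}"
proof (rule finite_subset)
  show "{z. z powi k = c} \<subseteq> {z. z ^ nat \<bar>k\<bar> = c} \<union> {z. z ^ nat \<bar>k\<bar> = inverse c}"
    by (cases "k \<ge> 0") (auto simp: power_int_def power_inverse)
  show "finite ({z. z ^ nat \<bar>k\<bar> = c} \<union> {z. z ^ nat \<bar>k\<bar> = inverse c})"
    using assms by (simp add: finite_nth_roots)
qed

lemma torsion_union_hypersurface:
  assumes "monomial n f"
  shows "torsion_union n {t \<in> torus n. f t = 1}"
proof -
  obtain c a where f: "torsion c" "in_lattice n a" "\<And>t. t \<in> torus n \<Longrightarrow> f t = c * chr n a t"
    using monomialE[OF assms] by blast
  have f_eq_1: "f t = 1 \<longleftrightarrow> chr n a t = inverse c" if "t \<in> torus n" for t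
    using f(3)[OF that] torsion_nonzero[OF f(1)] by (auto simp: field_simps)
  show ?thesis
  proof (cases "\<exists>i. a i \<noteq> 0")
    case False
    then have "a = (\<lambda>_. 0)" by auto
    then have "{t \<in> torus n. f t = 1} = (if c = 1 then torus n else {})" using f by (auto simp: chr_zero)
    then show ?thesis using torsion_union_empty torsion_union_coset[OF torsion_coset_torus] by simp
  next
    case True
    then obtain g k i where g: "monomial_aut n g" "i < n" "k \<noteq> 0" "\<And>t. t \<in> torus n \<Longrightarrow> chr n a (g t) = t i powi k"
      using chr_normal_form[OF f(2)] by blast
    let ?Z = "{z. z powi k = inverse c}"
    have "torsion_union n (\<Union>z\<in>?Z. {t \<in> torus n. t i = z})"
    proof (rule torsion_union_UN[OF finite_powi_roots[OF g(3)]])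
      fix z assume "z \<in> ?Z"
      then have "torsion z" using torsion_powi_root[of z k] torsion_inverse[OF f(1)] g(3) by simp
      then show "torsion_union n {t \<in> torus n. t i = z}" by (intro torsion_union_coset torsion_coset_coord g(2))
    qed (auto simp: disjoint_family_on_def)
    then have "torsion_union n (g ` (\<Union>z\<in>?Z. {t \<in> torus n. t i = z}))"
      by (rule torsion_union_image[OF g(1)]) simp
    moreover have "{t \<in> torus n. f t = 1} = g ` {t \<in> torus n. f (g t) = 1}"
      using monomial_aut_image[OF g(1)] by auto
    moreover have "{t \<in> torus n. f (g t) = 1} = (\<Union>z\<in>?Z. {t \<in> torus n. t i = z})"
      using f_eq_1[OF monomial_aut_in[OF g(1)]] g(4) by auto
    ultimately show ?thesis by simp
  qed
qed

lemma torsion_union_locus: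
  assumes "finite F" "\<And>f. f \<in> F \<Longrightarrow> monomial n f"
  shows "torsion_union n (locus n F)"
  using assms
proof (induction F rule: finite_induct)
  case empty
  then show ?case by (simp add: locus_def torsion_union_coset torsion_coset_torus)
next
  case (insert f F)
  then have IH: "torsion_union n (locus n F)" by simp
  have "torsion_union n (\<Union>C\<in>components (locus n F). {t \<in> C. f t = 1})"
  proof (rule torsion_union_UN)
    show "disjoint_family_on (\<lambda>C. {t \<in> C. f t = 1}) (components (locus n F))"
      using disjoint_components[of "locus n F"] by (auto simp: disjoint_family_on_def disjoint_def)
    fix C assume "C \<in> components (locus n F)"
    then have "torsion_coset n C" using IH by (simp add: torsion_union_def)
    then obtain d g where C: "d \<le> n" "monomial_aut n g" "C = g ` torus d" by (rule torsion_cosetE)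
    have "monomial d (\<lambda>t. f (g t))"
      using monomial_comp[OF monomial_map_comp[OF monomial_map_subset[OF C(1)] monomial_aut_map[OF C(2)]], of f]
        insert.prems by simp
    from torsion_union_image[OF C(2) torsion_union_hypersurface[OF this] C(1)]
    show "torsion_union n {t \<in> C. f t = 1}" unfolding C(3) by (rule back_subst) auto
  qed (use IH in \<open>simp add: torsion_union_def\<close>)
  moreover have "(\<Union>C\<in>components (locus n F). {t \<in> C. f t = 1}) = {t \<in> \<Union>(components (locus n F)). f t = 1}"
    by blast
  ultimately show ?case by (simp add: locus_def conj_commute conj_left_commute)
qed

lemma torsion_union_preimage:
  assumes "monomial_map n l h" "torsion_coset l K"
  shows "torsion_union n {u \<in> torus n. h u \<in> K}"
proof -
  obtain F where F: "finite F" "\<And>f. f \<in> F \<Longrightarrow> monomial l f" "K = locus l F"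
    using torsion_coset_locus[OF assms(2)] by blast
  have "torsion_union n (locus n ((\<lambda>f u. f (h u)) ` F))"
    using F monomial_comp[OF assms(1)] by (intro torsion_union_locus) auto
  moreover have "locus n ((\<lambda>f u. f (h u)) ` F) = {u \<in> torus n. h u \<in> K}"
    unfolding F(3) using monomial_map_in[OF assms(1)] by (auto simp: locus_def)
  ultimately show ?thesis by simp
qed

lemma torsion_union_Inter:
  assumes "finite B" "B \<noteq> {}" "\<And>K. K \<in> B \<Longrightarrow> torsion_coset l K"
  shows "torsion_union l (\<Inter>B)"
proof -
  have "\<forall>K\<in>B. \<exists>F. finite F \<and> (\<forall>f\<in>F. monomial l f) \<and> K = locus l F"
    using assms(3) by (metis torsion_coset_locus)
  then obtain F where F: "\<And>K. K \<in> B \<Longrightarrow> finite (F K) \<and> (\<forall>f\<in>F K. monomial l f) \<and> K = locus l (F K)" by metis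
  then have "torsion_union l (locus l (\<Union>K\<in>B. F K))"
    using assms(1) by (intro torsion_union_locus) auto
  moreover have "\<Inter>B = (\<Inter>K\<in>B. locus l (F K))" using F by auto
  then have "\<Inter>B = locus l (\<Union>K\<in>B. F K)" using assms(2) by (auto simp: locus_def)
  ultimately show ?thesis by simp
qed

lemma components_Int_image_torus:
  assumes "monomial_aut l h" "n \<le> l" "torsion_coset l K"
  shows "components (K \<inter> h ` torus n) = (`) h ` components {u \<in> torus n. h u \<in> K}"
proof -
  have "torsion_union n {u \<in> torus n. h u \<in> K}"
    using torsion_union_preimage[OF monomial_map_comp[OF monomial_map_subset[OF assms(2)]
      monomial_aut_map[OF assms(1)]] assms(3)]
    by simp
  moreover have "K \<inter> h ` torus n = h ` {u \<in> torus n. h u \<in> K}" by auto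
  ultimately show ?thesis using components_image[OF assms(1) _ assms(2)] by simp
qed

section \<open>Dimension of torsion cosets\<close>

lemma exists_linear_relation:
  fixes v :: "'a \<Rightarrow> 'b \<Rightarrow> 'c :: idom"
  assumes "finite C" "finite F" "card C < card F"
  shows "\<exists>c. (\<exists>f\<in>F. c f \<noteq> 0) \<and> (\<forall>i\<in>C. (\<Sum>f\<in>F. c f * v f i) = 0)"
  using assms
proof (induction C arbitrary: F v rule: finite_induct)
  case empty
  then have "F \<noteq> {}" by auto
  then show ?case by (intro exI[of _ "\<lambda>_. 1"]) auto
next
  case (insert x C)
  show ?case
  proof (cases "\<forall>f\<in>F. v f x = 0")
    case True
    then show ?thesis using insert.IH[OF insert.prems(1), of v] insert by auto
  next
    case False
    then obtain p where p: "p \<in> F" "v p x \<noteq> 0" by auto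
    define w where "w f i = v p x * v f i - v f x * v p i" for f i
    have "card C < card (F - {p})" using insert p by simp
    then obtain c where c: "\<exists>f\<in>F - {p}. c f \<noteq> 0" "\<forall>i\<in>C. (\<Sum>f\<in>F - {p}. c f * w f i) = 0"
      using insert.IH[of "F - {p}" w] insert.prems by auto
    define c' where "c' f = (if f = p then - (\<Sum>f\<in>F - {p}. c f * v f x) else v p x * c f)" for f
    have relation: "(\<Sum>f\<in>F. c' f * v f i) = (\<Sum>f\<in>F - {p}. c f * w f i)" for i
    proof -
      have "(\<Sum>f\<in>F. c' f * v f i) = c' p * v p i + (\<Sum>f\<in>F - {p}. v p x * c f * v f i)"
        using insert.prems p by (simp add: sum.remove c'_def)
      then show ?thesis
        by (simp add: c'_def w_def sum_distrib_left sum_subtractf algebra_simps)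
    qed
    have "(\<Sum>f\<in>F. c' f * v f x) = 0" unfolding relation by (simp add: w_def mult.commute)
    moreover have "\<exists>f\<in>F. c' f \<noteq> 0" using c(1) p by (auto simp: c'_def)
    ultimately show ?thesis using c(2) relation by (intro exI[of _ c']) auto
  qed
qed

lemma lrank_eqI:
  assumes "F \<subseteq> S" "finite F" "int_indep F" "card F = r"
    and "\<And>F. F \<subseteq> S \<Longrightarrow> finite F \<Longrightarrow> int_indep F \<Longrightarrow> card F \<le> r"
  shows "lrank S = r"
  unfolding lrank_def
proof (rule Max_eqI)
  show "finite {card F |F. F \<subseteq> S \<and> finite F \<and> int_indep F}"
    by (rule finite_subset[of _ "{..r}"]) (auto intro: assms(5))
qed (use assms in auto)

lemma lrank_supported_on:
  assumes "finite C"
  shows "lrank {b. \<forall>i. i \<notin> C \<longrightarrow> b i = 0} = card C" (is "lrank ?S = _")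
proof (rule lrank_eqI)
  define e where "e i = (\<lambda>j. if j = i then 1 else 0 :: int)" for i :: nat
  have inj: "inj_on e C" by (auto simp: inj_on_def e_def fun_eq_iff split: if_splits)
  show "e ` C \<subseteq> ?S" by (auto simp: e_def)
  show "card (e ` C) = card C" by (rule card_image[OF inj])
  have "(\<Sum>v\<in>e ` C. c v * v i) = c (e i)" if "i \<in> C" for c i
  proof -
    have "(\<Sum>v\<in>e ` C. c v * v i) = (\<Sum>j\<in>C. if j = i then c (e i) else 0)"
      unfolding sum.reindex[OF inj] by (rule sum.cong) (auto simp: e_def)
    then show ?thesis using assms that by simp
  qed
  then show "int_indep (e ` C)" by (simp add: int_indep_def) metis
next
  fix F assume F: "F \<subseteq> ?S" "finite F" "int_indep F"
  show "card F \<le> card C"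
  proof (rule ccontr)
    assume "\<not> card F \<le> card C"
    then obtain c where c: "\<exists>v\<in>F. c v \<noteq> 0" "\<forall>i\<in>C. (\<Sum>v\<in>F. c v * v i) = 0"
      using exists_linear_relation[of C F "\<lambda>v. v"] assms F(2) by auto
    have "(\<Sum>v\<in>F. c v * v i) = 0" if "i \<notin> C" for i using F(1) that by (intro sum.neutral) auto
    then show False using F(3) c by (auto simp: int_indep_def)
  qed
qed (use assms in simp)

lemma int_indep_image:
  assumes inj: "inj_on L F"
    and relation: "\<And>c. (\<forall>i. (\<Sum>v\<in>F. c v * L v i) = 0) \<longleftrightarrow> (\<forall>i. (\<Sum>v\<in>F. c v * v i) = 0)"
  shows "int_indep (L ` F) \<longleftrightarrow> int_indep F"
proof -
  have "int_indep (L ` F) \<longleftrightarrow> (\<forall>c. (\<forall>i. (\<Sum>v\<in>F. c (L v) * v i) = 0) \<longrightarrow> (\<forall>v\<in>F. c (L v) = 0))"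
    unfolding int_indep_def sum.reindex[OF inj] o_def using relation[of "\<lambda>v. _ (L v)"] by simp
  also have "\<dots> \<longleftrightarrow> int_indep F"
  proof
    assume image: "\<forall>c. (\<forall>i. (\<Sum>v\<in>F. c (L v) * v i) = 0) \<longrightarrow> (\<forall>v\<in>F. c (L v) = 0)"
    show "int_indep F"
      unfolding int_indep_def
    proof (intro allI impI)
      fix c assume "\<forall>i. (\<Sum>v\<in>F. c v * v i) = 0"
      then show "\<forall>v\<in>F. c v = 0"
        using image[rule_format, of "\<lambda>w. c (the_inv_into F L w)"] by (simp add: the_inv_into_f_f[OF inj])
    qed
  next
    assume "int_indep F"
    then show "\<forall>c. (\<forall>i. (\<Sum>v\<in>F. c (L v) * v i) = 0) \<longrightarrow> (\<forall>v\<in>F. c (L v) = 0)"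
      unfolding int_indep_def by (intro allI) (erule allE[of _ "\<lambda>v. _ (L v)"])
  qed
  finally show ?thesis .
qed

lemma lrank_image:
  assumes inj: "inj_on L S"
    and relation: "\<And>F c. F \<subseteq> S \<Longrightarrow> finite F \<Longrightarrow>
      (\<forall>i. (\<Sum>v\<in>F. c v * L v i) = 0) \<longleftrightarrow> (\<forall>i. (\<Sum>v\<in>F. c v * v i) = 0)"
  shows "lrank (L ` S) = lrank S"
proof -
  have image: "int_indep (L ` F) \<longleftrightarrow> int_indep F" "card (L ` F) = card F" if "F \<subseteq> S" "finite F" for F
    using int_indep_image[OF inj_on_subset[OF inj] relation] card_image[OF inj_on_subset[OF inj]] that by blast+
  have "(\<exists>F. r = card F \<and> F \<subseteq> L ` S \<and> finite F \<and> int_indep F)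
      \<longleftrightarrow> (\<exists>F. r = card F \<and> F \<subseteq> S \<and> finite F \<and> int_indep F)" for r
    using image by (metis finite_imageI finite_subset_image image_mono)
  then show ?thesis by (simp only: lrank_def)
qed

lemma chr_constant_on_torus:
  assumes "d \<le> n"
  shows "(\<forall>t\<in>torus d. chr n a t = 1) \<longleftrightarrow> (\<forall>i<d. a i = 0)"
proof
  assume const: "\<forall>t\<in>torus d. chr n a t = 1"
  show "\<forall>i<d. a i = 0"
  proof (intro allI impI, rule ccontr)
    fix i assume i: "i < d" "a i \<noteq> 0"
    define w where "w = cis (pi / of_int (a i))"
    have "(\<lambda>_. 1)(i := w) \<in> torus d" using i by (intro torus_upd) (auto simp: w_def)
    moreover have "chr n a ((\<lambda>_. 1)(i := w)) = (\<Prod>j<n. if j = i then w powi a i else 1)"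
      unfolding chr_def by (rule prod.cong) auto
    then have "chr n a ((\<lambda>_. 1)(i := w)) = -1" using i assms by (simp add: w_def cis_power_int)
    ultimately show False using const by force
  qed
next
  assume "\<forall>i<d. a i = 0"
  then show "\<forall>t\<in>torus d. chr n a t = 1"
    by (auto simp: chr_def torus_outside intro!: prod.neutral)
      (metis not_less power_int_0_right power_int_1_left torus_outside)
qed

lemma chr_eqD:
  assumes "in_lattice n a" "in_lattice n b" "\<And>t. t \<in> torus n \<Longrightarrow> c * chr n a t = d * chr n b t" "c \<noteq> 0"
  shows "a = b"
proof -
  have "c = d" using assms(3)[of "\<lambda>_. 1"] by (simp add: chr_def)
  then have "chr n (\<lambda>i. a i + (-1) * b i) t = 1" if "t \<in> torus n" for t
    using assms(3)[OF that] assms(4) chr_norm[OF that, of b] unfolding chr_add[OF that] chr_scale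
    by (auto simp: field_simps)
  then have "a i = b i" if "i < n" for i
    using chr_constant_on_torus[of n n "\<lambda>i. a i + (-1) * b i"] that by simp
  then show ?thesis using assms(1,2) by (metis ext in_lattice_def not_less)
qed

text \<open>The exponent vector of the monomial function \<open>chr n a \<circ> g\<close>.\<close>

definition pullback :: "nat \<Rightarrow> (pt \<Rightarrow> pt) \<Rightarrow> lat \<Rightarrow> lat" where
  "pullback n g a = (SOME b. in_lattice n b \<and> (\<exists>c. torsion c \<and> (\<forall>t\<in>torus n. chr n a (g t) = c * chr n b t)))"

lemma pullback_eqI:
  assumes "in_lattice n b" "torsion c" "\<And>t. t \<in> torus n \<Longrightarrow> chr n a (g t) = c * chr n b t"
  shows "pullback n g a = b"
  unfolding pullback_def
proof (rule some_equality)
  fix b' assume "in_lattice n b' \<and> (\<exists>c. torsion c \<and> (\<forall>t\<in>torus n. chr n a (g t) = c * chr n b' t))"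
  then obtain c' where b': "in_lattice n b'" "torsion c'" "\<And>t. t \<in> torus n \<Longrightarrow> chr n a (g t) = c' * chr n b' t"
    by blast
  show "b' = b"
    by (rule chr_eqD[of n _ _ c' c]) (use assms b' torsion_nonzero in simp_all)
qed (use assms in blast)

lemma chr_pullbackE:
  assumes "monomial_map n n g" "in_lattice n a"
  obtains c where "torsion c" "in_lattice n (pullback n g a)"
    "\<And>t. t \<in> torus n \<Longrightarrow> chr n a (g t) = c * chr n (pullback n g a) t"
proof -
  have "monomial n (chr n a)" unfolding monomial_def using assms(2) by (intro exI[of _ 1] exI[of _ a]) simp
  from monomial_comp[OF assms(1) this] obtain c b
    where b: "torsion c" "in_lattice n b" "\<And>t. t \<in> torus n \<Longrightarrow> chr n a (g t) = c * chr n b t"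
    by (rule monomialE) blast
  moreover have "pullback n g a = b" by (rule pullback_eqI[OF b(2,1,3)])
  ultimately show thesis using that by simp
qed

lemma in_lattice_pullback: "monomial_map n n g \<Longrightarrow> in_lattice n a \<Longrightarrow> in_lattice n (pullback n g a)"
  using chr_pullbackE .

lemma pullback_inverse:
  assumes "monomial_map n n g" "monomial_map n n h" "\<And>t. t \<in> torus n \<Longrightarrow> g (h t) = t" "in_lattice n a"
  shows "pullback n h (pullback n g a) = a"
proof -
  obtain c where c: "torsion c" "\<And>t. t \<in> torus n \<Longrightarrow> chr n a (g t) = c * chr n (pullback n g a) t"
    using chr_pullbackE[OF assms(1,4)] by blast
  show ?thesis
  proof (rule pullback_eqI[OF assms(4) torsion_inverse[OF c(1)]])
    show "chr n (pullback n g a) (h t) = inverse c * chr n a t" if "t \<in> torus n" for t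
      using c(2)[OF monomial_map_in[OF assms(2) that]] assms(3)[OF that] torsion_nonzero[OF c(1)]
      by (simp add: field_simps)
  qed
qed

lemma chr_sum: "t \<in> torus n \<Longrightarrow> chr n (\<lambda>j. \<Sum>i\<in>A. f i j) t = (\<Prod>i\<in>A. chr n (f i) t)"
  by (induction A rule: infinite_finite_induct) (auto simp: chr_zero chr_add)

lemma torsion_prod: "(\<And>i. i \<in> A \<Longrightarrow> torsion (f i)) \<Longrightarrow> torsion (\<Prod>i\<in>A. f i)"
  by (induction A rule: infinite_finite_induct) (auto intro: torsion_mult)

lemma pullback_sum:
  assumes "monomial_map n n g" "\<And>v. v \<in> F \<Longrightarrow> in_lattice n v"
  shows "pullback n g (\<lambda>i. \<Sum>v\<in>F. c v * v i) = (\<lambda>i. \<Sum>v\<in>F. c v * pullback n g v i)"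
proof -
  have "\<forall>v\<in>F. \<exists>z. torsion z \<and> (\<forall>t\<in>torus n. chr n v (g t) = z * chr n (pullback n g v) t)"
    using chr_pullbackE[OF assms(1) assms(2)] by (metis (no_types))
  from bchoice[OF this] obtain z where z: "\<And>v. v \<in> F \<Longrightarrow> torsion (z v)"
    "\<And>v t. v \<in> F \<Longrightarrow> t \<in> torus n \<Longrightarrow> chr n v (g t) = z v * chr n (pullback n g v) t" by blast
  show ?thesis
  proof (rule pullback_eqI)
    show "in_lattice n (\<lambda>i. \<Sum>v\<in>F. c v * pullback n g v i)"
      using in_lattice_pullback[OF assms(1,2)] by (auto simp: in_lattice_def intro!: sum.neutral)
    show "torsion (\<Prod>v\<in>F. z v powi c v)" by (intro torsion_prod torsion_powi z(1))
    fix t assume t: "t \<in> torus n"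
    have "chr n (\<lambda>i. \<Sum>v\<in>F. c v * v i) (g t) = (\<Prod>v\<in>F. chr n v (g t) powi c v)"
      by (simp add: chr_sum[OF monomial_map_in[OF assms(1) t]] chr_scale)
    also have "\<dots> = (\<Prod>v\<in>F. z v powi c v * chr n (pullback n g v) t powi c v)"
      by (rule prod.cong) (auto simp: power_int_mult_distrib z(2)[OF _ t])
    finally show "chr n (\<lambda>i. \<Sum>v\<in>F. c v * v i) (g t)
        = (\<Prod>v\<in>F. z v powi c v) * chr n (\<lambda>i. \<Sum>v\<in>F. c v * pullback n g v i) t"
      by (simp add: prod.distrib chr_sum[OF t] chr_scale)
  qed
qed

lemma constant_on_image_torus:
  assumes "monomial_map n n g" "d \<le> n" "in_lattice n a"
  shows "(\<forall>s\<in>g ` torus d. \<forall>t\<in>g ` torus d. chr n a s = chr n a t) \<longleftrightarrow> (\<forall>i<d. pullback n g a i = 0)"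
proof -
  obtain c where c: "torsion c" "\<And>t. t \<in> torus n \<Longrightarrow> chr n a (g t) = c * chr n (pullback n g a) t"
    using chr_pullbackE[OF assms(1,3)] by blast
  have sub: "t \<in> torus n" if "t \<in> torus d" for t using torus_mono[OF assms(2)] that by blast
  have one: "chr n b (\<lambda>_. 1) = 1" for b by (simp add: chr_def)
  have "(\<forall>s\<in>g ` torus d. \<forall>t\<in>g ` torus d. chr n a s = chr n a t)
      \<longleftrightarrow> (\<forall>s\<in>torus d. \<forall>t\<in>torus d. chr n (pullback n g a) s = chr n (pullback n g a) t)"
    using torsion_nonzero[OF c(1)] by (simp add: c(2) sub)
  also have "\<dots> \<longleftrightarrow> (\<forall>t\<in>torus d. chr n (pullback n g a) t = 1)"
    using one_in_torus[of d] one[of "pullback n g a"] by metis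
  finally show ?thesis unfolding chr_constant_on_torus[OF assms(2)] .
qed

lemma pullback_eq_zero_iff:
  assumes "monomial_map n n g" "monomial_map n n h" "\<And>t. t \<in> torus n \<Longrightarrow> g (h t) = t" "in_lattice n a"
  shows "pullback n g a = (\<lambda>_. 0) \<longleftrightarrow> a = (\<lambda>_. 0)"
  using pullback_inverse[OF assms] pullback_sum[OF assms(1), of "{}"] pullback_sum[OF assms(2), of "{}"] by auto

text \<open>The characters that are constant on \<open>g ` torus d\<close> correspond to the lattice vectors supported on the
coordinates from \<open>d\<close> on.\<close>

lemma tdim_image_torus:
  assumes "monomial_aut n g" "d \<le> n"
  shows "tdim n (g ` torus d) = d"
proof -
  obtain h where h: "monomial_aut n h" "\<And>t. t \<in> torus n \<Longrightarrow> h (g t) = t" "\<And>t. t \<in> torus n \<Longrightarrow> g (h t) = t"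
    using monomial_aut_inverseE[OF assms(1)] by blast
  note map = monomial_aut_map[OF assms(1)] monomial_aut_map[OF h(1)]
  let ?L = "pullback n g"
  define S where "S = {a. in_lattice n a \<and> (\<forall>s\<in>g ` torus d. \<forall>t\<in>g ` torus d. chr n a s = chr n a t)}"
  have S: "a \<in> S \<longleftrightarrow> in_lattice n a \<and> (\<forall>i<d. ?L a i = 0)" for a
    unfolding S_def using constant_on_image_torus[OF map(1) assms(2)] by blast
  have "lrank (?L ` S) = lrank S"
  proof (rule lrank_image)
    show "inj_on ?L S" by (rule inj_on_inverseI[of _ "pullback n h"])
      (simp add: pullback_inverse[OF map h(3)] S)
    fix F c assume "F \<subseteq> S" "finite F"
    then have lattice: "\<And>v. v \<in> F \<Longrightarrow> in_lattice n v" by (auto simp: S)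
    then have "in_lattice n (\<lambda>i. \<Sum>v\<in>F. c v * v i)" by (auto simp: in_lattice_def intro!: sum.neutral)
    from pullback_eq_zero_iff[OF map h(3) this] pullback_sum[OF map(1) lattice, of F c]
    show "(\<forall>i. (\<Sum>v\<in>F. c v * ?L v i) = 0) \<longleftrightarrow> (\<forall>i. (\<Sum>v\<in>F. c v * v i) = 0)"
      by (simp add: fun_eq_iff)
  qed
  moreover have "?L ` S = {b. \<forall>i. i \<notin> {d..<n} \<longrightarrow> b i = 0}"
  proof
    show "?L ` S \<subseteq> {b. \<forall>i. i \<notin> {d..<n} \<longrightarrow> b i = 0}"
      using in_lattice_pullback[OF map(1)] by (auto simp: S in_lattice_def)
    show "{b. \<forall>i. i \<notin> {d..<n} \<longrightarrow> b i = 0} \<subseteq> ?L ` S"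
    proof
      fix b :: lat assume b: "b \<in> {b. \<forall>i. i \<notin> {d..<n} \<longrightarrow> b i = 0}"
      then have "in_lattice n b" by (simp add: in_lattice_def)
      then have "b = ?L (pullback n h b)" "in_lattice n (pullback n h b)"
        using pullback_inverse[OF map(2,1) h(2)] in_lattice_pullback[OF map(2)] by simp_all
      then show "b \<in> ?L ` S" using b by (intro image_eqI[of _ _ "pullback n h b"]) (auto simp: S)
    qed
  qed
  ultimately have "lrank S = n - d" using lrank_supported_on[of "{d..<n}"] by simp
  then show ?thesis using assms(2) by (simp add: tdim_def S_def)
qed

section \<open>Characteristic polynomials count torsion points\<close>

text \<open>Every root of unity is a \<open>k!\<close>-th root of unity for all large \<open>k\<close>.\<close>

definition torsion_pts :: "nat \<Rightarrow> pt set" where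
  "torsion_pts k = {t. \<forall>i. t i ^ fact k = 1}"

lemma eventually_torsion:
  assumes "torsion c"
  shows "\<forall>\<^sub>F k in sequentially. c ^ fact k = 1"
proof -
  obtain N where N: "N > 0" "c ^ N = 1" using assms by (auto simp: torsion_def)
  have "c ^ fact k = 1" if "k \<ge> N" for k
    using dvd_fact[of N k] N that by (metis One_nat_def Suc_leI dvd_def power_mult power_one)
  then show ?thesis by (rule eventually_sequentiallyI)
qed

lemma eventually_monomial_torsion:
  assumes "monomial n f"
  shows "\<forall>\<^sub>F k in sequentially. \<forall>t\<in>torus n \<inter> torsion_pts k. f t ^ fact k = 1"
proof -
  obtain c a where f: "torsion c" "\<And>t. t \<in> torus n \<Longrightarrow> f t = c * chr n a t"
    using monomialE[OF assms] by blast
  have "(z powi m) ^ fact k = 1" if "z ^ fact k = 1" for z :: complex and m k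
    using that by (metis mult.commute power_int_1_left power_int_mult power_int_of_nat)
  then have "chr n a t ^ fact k = 1" if "t \<in> torsion_pts k" for t k
    using that by (simp add: chr_def torsion_pts_def prod_power_distrib)
  then show ?thesis
    using eventually_torsion[OF f(1)] by (auto elim!: eventually_mono simp: f(2) power_mult_distrib)
qed

lemma eventually_monomial_map_torsion_pts:
  assumes "monomial_map m n g"
  shows "\<forall>\<^sub>F k in sequentially. g ` (torus m \<inter> torsion_pts k) \<subseteq> torsion_pts k"
proof -
  have "\<forall>\<^sub>F k in sequentially. \<forall>i\<in>{..<n}. \<forall>t\<in>torus m \<inter> torsion_pts k. g t i ^ fact k = 1"
    by (intro eventually_ball_finite ballI eventually_monomial_torsion monomial_map_coord[OF assms]) simp
  then show ?thesis
  proof (rule eventually_mono)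
    fix k assume coords: "\<forall>i\<in>{..<n}. \<forall>t\<in>torus m \<inter> torsion_pts k. g t i ^ fact k = 1"
    have "g t i ^ fact k = 1" if "t \<in> torus m \<inter> torsion_pts k" for t i
      using coords that torus_outside[OF monomial_map_in[OF assms], of t i] by (cases "i < n") auto
    then show "g ` (torus m \<inter> torsion_pts k) \<subseteq> torsion_pts k" by (auto simp: torsion_pts_def)
  qed
qed

lemma eventually_card_image_torsion_pts:
  assumes "monomial_aut n g"
  shows "\<forall>\<^sub>F k in sequentially. \<forall>S\<subseteq>torus n. card (g ` S \<inter> torsion_pts k) = card (S \<inter> torsion_pts k)"
proof -
  obtain h where h: "monomial_aut n h" "\<And>t. t \<in> torus n \<Longrightarrow> h (g t) = t" "\<And>t. t \<in> torus n \<Longrightarrow> g (h t) = t"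
    using monomial_aut_inverseE[OF assms] by blast
  from eventually_monomial_map_torsion_pts[OF monomial_aut_map[OF assms]]
    eventually_monomial_map_torsion_pts[OF monomial_aut_map[OF h(1)]]
  show ?thesis
  proof eventually_elim
    case (elim k)
    have "g t \<in> torsion_pts k \<longleftrightarrow> t \<in> torsion_pts k" if "t \<in> torus n" for t
      using elim h(2)[OF that] monomial_aut_in[OF assms that] that by force
    then have "g ` S \<inter> torsion_pts k = g ` (S \<inter> torsion_pts k)" if "S \<subseteq> torus n" for S
      using that by blast
    moreover have "inj_on g (S \<inter> torsion_pts k)" if "S \<subseteq> torus n" for S
      using that by (intro inj_on_subset[OF monomial_aut_inj[OF assms]]) auto
    ultimately show ?case by (simp add: card_image)
  qed
qed

definition cyl :: "nat \<Rightarrow> pt set \<Rightarrow> pt set" where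
  "cyl n S = {x \<in> torus (Suc n). truncate n x \<in> S}"

lemma cyl_torus: "cyl n (torus n) = torus (Suc n)"
  using truncate_in_torus by (auto simp: cyl_def)

lemma torus_upd_Suc: "t \<in> torus n \<Longrightarrow> cmod z = 1 \<Longrightarrow> t(n := z) \<in> torus (Suc n)"
  using torus_mono[of n "Suc n"] by (intro torus_upd) auto

lemma card_cyl_torsion_pts:
  assumes "S \<subseteq> torus n"
  shows "card (cyl n S \<inter> torsion_pts k) = card (S \<inter> torsion_pts k) * fact k"
    and "finite (S \<inter> torsion_pts k) \<Longrightarrow> finite (cyl n S \<inter> torsion_pts k)"
proof -
  let ?R = "{z::complex. z ^ fact k = 1}"
  have norm: "cmod z = 1" if "z \<in> ?R" for z using power_eq_1_iff[of z "fact k"] that by simp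
  have bij: "bij_betw (\<lambda>(t, z). t(n := z)) ((S \<inter> torsion_pts k) \<times> ?R) (cyl n S \<inter> torsion_pts k)"
  proof (rule bij_betw_byWitness[where f' = "\<lambda>x. (truncate n x, x n)"])
    show "\<forall>p\<in>(S \<inter> torsion_pts k) \<times> ?R. (\<lambda>x. (truncate n x, x n)) ((\<lambda>(t, z). t(n := z)) p) = p"
      using assms by (auto simp: subset_iff)
    show "\<forall>x\<in>cyl n S \<inter> torsion_pts k. (\<lambda>(t, z). t(n := z)) (truncate n x, x n) = x"
      by (auto simp: cyl_def fun_eq_iff truncate_def torus_outside)
    show "(\<lambda>(t, z). t(n := z)) ` ((S \<inter> torsion_pts k) \<times> ?R) \<subseteq> cyl n S \<inter> torsion_pts k"
      using assms norm by (auto simp: subset_iff cyl_def torsion_pts_def intro!: torus_upd_Suc)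
    show "(\<lambda>x. (truncate n x, x n)) ` (cyl n S \<inter> torsion_pts k) \<subseteq> (S \<inter> torsion_pts k) \<times> ?R"
      by (auto simp: cyl_def torsion_pts_def truncate_def)
  qed
  have R: "card ?R = fact k" "finite ?R" by (simp_all add: card_roots_unity_eq finite_nth_roots)
  show "card (cyl n S \<inter> torsion_pts k) = card (S \<inter> torsion_pts k) * fact k"
    using bij_betw_same_card[OF bij] R(1) by (simp add: card_cartesian_product)
  show "finite (cyl n S \<inter> torsion_pts k)" if "finite (S \<inter> torsion_pts k)"
    using bij_betw_finite[OF bij] R(2) that by simp
qed

lemma card_torus_torsion_pts:
  "finite (torus n \<inter> torsion_pts k)" "card (torus n \<inter> torsion_pts k) = fact k ^ n"
proof (induction n)
  case 0
  have "torus 0 \<inter> torsion_pts k = {\<lambda>_. 1}" by (auto simp: torus_def torsion_pts_def)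
  then show "finite (torus 0 \<inter> torsion_pts k)" "card (torus 0 \<inter> torsion_pts k) = fact k ^ 0" by simp_all
next
  case (Suc n)
  then show "finite (torus (Suc n) \<inter> torsion_pts k)" "card (torus (Suc n) \<inter> torsion_pts k) = fact k ^ Suc n"
    using card_cyl_torsion_pts[OF order_refl, of n k] by (simp_all add: cyl_torus)
qed

lemma finite_torsion_coset_Int_torsion_pts: "torsion_coset l Y \<Longrightarrow> finite (Y \<inter> torsion_pts k)"
  by (rule finite_subset[OF Int_mono[OF torsion_coset_subset order_refl] card_torus_torsion_pts(1)])

lemma eventually_card_torsion_coset:
  assumes "torsion_coset l Y"
  shows "\<forall>\<^sub>F k in sequentially. card (Y \<inter> torsion_pts k) = fact k ^ tdim l Y"
proof -
  obtain d g where g: "d \<le> l" "monomial_aut l g" "Y = g ` torus d" using torsion_cosetE[OF assms] by blast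
  show ?thesis
    using eventually_card_image_torsion_pts[OF g(2)] torus_mono[OF g(1)]
    by (auto elim!: eventually_mono simp: g(3) card_torus_torsion_pts tdim_image_torus[OF g(2,1)])
qed

lemma poly_eqI_fact:
  fixes p q :: "'a :: linordered_idom poly"
  assumes "\<forall>\<^sub>F k in sequentially. poly p (fact k) = poly q (fact k)"
  shows "p = q"
proof -
  obtain K where K: "\<And>k. k \<ge> K \<Longrightarrow> poly p (fact k) = poly q (fact k)"
    using assms unfolding eventually_sequentially by blast
  have "inj_on (fact :: nat \<Rightarrow> 'a) {Suc K..}"
    by (rule strict_mono_on_imp_inj_on) (auto intro!: strict_mono_onI fact_less_mono)
  then have "infinite (fact ` {Suc K..} :: 'a set)" using finite_imageD infinite_Ici by blast
  moreover have "fact ` {Suc K..} \<subseteq> {x. poly (p - q) x = 0}" using K by auto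
  ultimately have "infinite {x. poly (p - q) x = 0}" using finite_subset by blast
  then show ?thesis using poly_roots_finite[of "p - q"] by auto
qed

definition toral_arrangement :: "nat \<Rightarrow> pt set \<Rightarrow> pt set set \<Rightarrow> bool" where
  "toral_arrangement l X A \<longleftrightarrow> torsion_coset l X \<and> finite A \<and> (\<forall>K\<in>A. torsion_coset l K \<and> K \<subseteq> X)"

lemma layers_toral_arrangement:
  assumes "toral_arrangement l X A"
  shows "finite (layers X A)" "X \<in> layers X A"
    and "Y \<in> layers X A \<Longrightarrow> torsion_coset l Y" "Y \<in> layers X A \<Longrightarrow> Y \<subseteq> X"
proof -
  have "torsion_union l (\<Inter>(insert X B))" if "B \<in> Pow A" for B
    using assms that finite_subset by (intro torsion_union_Inter) (auto simp: toral_arrangement_def)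
  then have "torsion_union l (X \<inter> \<Inter>B)" if "B \<in> Pow A" for B using that by simp
  then show "finite (layers X A)" "Y \<in> layers X A \<Longrightarrow> torsion_coset l Y"
    using assms unfolding layers_def torsion_union_def toral_arrangement_def by auto
  have "components (X \<inter> \<Inter>{}) = {X}" using assms components_torsion_coset[of l X]
    by (simp add: toral_arrangement_def)
  then show "X \<in> layers X A" unfolding layers_def by blast
  show "Y \<in> layers X A \<Longrightarrow> Y \<subseteq> X" unfolding layers_def using in_components_subset by blast
qed

lemma smallest_layer_through_point:
  assumes "toral_arrangement l X A" "p \<in> X"
  obtains Z where "Z \<in> layers X A" "\<And>Y. Y \<in> layers X A \<Longrightarrow> p \<in> Y \<longleftrightarrow> Z \<subseteq> Y"
    "Z = X \<longleftrightarrow> p \<notin> \<Union>(A - {X})"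
proof
  define B where "B = {K\<in>A. p \<in> K}"
  define Z where "Z = connected_component_set (X \<inter> \<Inter>B) p"
  have p: "p \<in> X \<inter> \<Inter>B" using assms(2) by (auto simp: B_def)
  then have Z: "Z \<in> components (X \<inter> \<Inter>B)" "p \<in> Z" unfolding Z_def by (auto intro: componentsI)
  then show "Z \<in> layers X A" unfolding layers_def by (intro UN_I[of B]) (auto simp: B_def)
  show "p \<in> Y \<longleftrightarrow> Z \<subseteq> Y" if Y: "Y \<in> layers X A" for Y
  proof
    assume "p \<in> Y"
    obtain C where C: "C \<subseteq> A" "Y \<in> components (X \<inter> \<Inter>C)" using Y unfolding layers_def by blast
    have "C \<subseteq> B" using in_components_subset[OF C(2)] \<open>p \<in> Y\<close> C(1) by (auto simp: B_def)
    then have "connected Z" "Z \<subseteq> X \<inter> \<Inter>C" using in_components_connected[OF Z(1)] in_components_subset[OF Z(1)]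
      by auto
    then show "Z \<subseteq> Y" using components_maximal[OF C(2)] \<open>p \<in> Y\<close> Z(2) by blast
  qed (use Z(2) in blast)
  have X: "torsion_coset l X" "\<And>K. K \<in> A \<Longrightarrow> K \<subseteq> X" using assms(1) by (auto simp: toral_arrangement_def)
  show "Z = X \<longleftrightarrow> p \<notin> \<Union>(A - {X})"
  proof
    assume "Z = X"
    then have "X \<subseteq> K" if "K \<in> B" for K using in_components_subset[OF Z(1)] that by auto
    then show "p \<notin> \<Union>(A - {X})" using X(2) by (auto simp: B_def)
  next
    assume "p \<notin> \<Union>(A - {X})"
    then have "X \<inter> \<Inter>B = X" by (auto simp: B_def)
    then show "Z = X" using Z(1) components_torsion_coset[OF X(1)] by simp
  qed
qed

lemma sum_mob_interval:
  assumes "finite L" "Z \<in> L" "X \<in> L" "\<And>Y. Y \<in> L \<Longrightarrow> Y \<subseteq> X"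
  shows "(\<Sum>Y | Y \<in> L \<and> Z \<subseteq> Y. mob L X Y) = (if Z = X then 1 else 0)"
proof (cases "Z = X")
  case True
  then have "{Y. Y \<in> L \<and> Z \<subseteq> Y} = {X}" using assms by auto
  then show ?thesis using True assms(1) by (simp add: mob.simps[of L X X])
next
  case False
  have "{Y. Y \<in> L \<and> Z \<subseteq> Y} = insert Z {Y\<in>L. Z \<subset> Y \<and> Y \<subseteq> X}" using assms by auto
  then show ?thesis using False assms(1) by (simp add: mob.simps[of L X Z])
qed

lemma sum_mob_through_point:
  assumes "toral_arrangement l X A" "p \<in> X"
  shows "(\<Sum>Y | Y \<in> layers X A \<and> p \<in> Y. mob (layers X A) X Y) = (if p \<in> \<Union>(A - {X}) then 0 else 1)"
proof -
  note L = layers_toral_arrangement[OF assms(1)]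
  obtain Z where Z: "Z \<in> layers X A" "\<And>Y. Y \<in> layers X A \<Longrightarrow> p \<in> Y \<longleftrightarrow> Z \<subseteq> Y" "Z = X \<longleftrightarrow> p \<notin> \<Union>(A - {X})"
    using smallest_layer_through_point[OF assms] by blast
  have "{Y. Y \<in> layers X A \<and> p \<in> Y} = {Y. Y \<in> layers X A \<and> Z \<subseteq> Y}" using Z(2) by auto
  then show ?thesis using sum_mob_interval[OF L(1) Z(1) L(2,4)] Z(3) by simp
qed

lemma eventually_poly_chi:
  assumes "toral_arrangement l X A"
  shows "\<forall>\<^sub>F k in sequentially. poly (chi l X A) (fact k) = int (card ((X - \<Union>(A - {X})) \<inter> torsion_pts k))"
proof -
  let ?L = "layers X A"
  note L = layers_toral_arrangement[OF assms]
  have "\<forall>\<^sub>F k in sequentially. \<forall>Y\<in>?L. card (Y \<inter> torsion_pts k) = fact k ^ tdim l Y"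
    by (intro eventually_ball_finite ballI eventually_card_torsion_coset L)
  then show ?thesis
  proof (rule eventually_mono)
    fix k assume card: "\<forall>Y\<in>?L. card (Y \<inter> torsion_pts k) = fact k ^ tdim l Y"
    let ?P = "X \<inter> torsion_pts k"
    have fin: "finite ?P"
      using assms finite_torsion_coset_Int_torsion_pts[of l X k] by (simp add: toral_arrangement_def)
    have "poly (chi l X A) (fact k) = (\<Sum>Y\<in>?L. mob ?L X Y * int (card (Y \<inter> torsion_pts k)))"
      unfolding chi_def poly_sum poly_monom using card by simp
    also have "\<dots> = (\<Sum>Y\<in>?L. \<Sum>p\<in>?P. if p \<in> Y then mob ?L X Y else 0)"
    proof (rule sum.cong[OF refl])
      fix Y assume "Y \<in> ?L"
      then have "Y \<inter> torsion_pts k = {p \<in> ?P. p \<in> Y}" using L(4) by blast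
      then show "mob ?L X Y * int (card (Y \<inter> torsion_pts k)) = (\<Sum>p\<in>?P. if p \<in> Y then mob ?L X Y else 0)"
        using fin by (simp add: mult.commute flip: sum.inter_filter)
    qed
    also have "\<dots> = (\<Sum>p\<in>?P. \<Sum>Y | Y \<in> ?L \<and> p \<in> Y. mob ?L X Y)"
      unfolding sum.inter_filter[OF L(1)] by (rule sum.swap)
    also have "\<dots> = (\<Sum>p\<in>?P. if p \<notin> \<Union>(A - {X}) then 1 else 0)"
      by (rule sum.cong[OF refl]) (simp add: sum_mob_through_point[OF assms])
    also have "\<dots> = int (card {p \<in> ?P. p \<notin> \<Union>(A - {X})})"
      using fin by (simp flip: sum.inter_filter)
    also have "{p \<in> ?P. p \<notin> \<Union>(A - {X})} = (X - \<Union>(A - {X})) \<inter> torsion_pts k" by auto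
    finally show "poly (chi l X A) (fact k) = int (card ((X - \<Union>(A - {X})) \<inter> torsion_pts k))" .
  qed
qed

lemma chi_eqI:
  assumes "toral_arrangement l X A"
    "\<forall>\<^sub>F k in sequentially. int (card ((X - \<Union>(A - {X})) \<inter> torsion_pts k)) = poly p (fact k)"
  shows "chi l X A = p"
  by (rule poly_eqI_fact, rule eventually_elim2[OF eventually_poly_chi[OF assms(1)] assms(2)]) simp

lemma toral_arrangement_mono: "toral_arrangement l X A \<Longrightarrow> B \<subseteq> A \<Longrightarrow> toral_arrangement l X B"
  by (auto simp: toral_arrangement_def intro: finite_subset)

lemma toral_arrangement_restr:
  assumes "toral_arrangement l X A" "H \<in> A"
  shows "toral_arrangement l H (restr A H)"
proof -
  have "torsion_union l (K \<inter> H)" if "K \<in> A" for K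
    using torsion_union_Inter[of "{K, H}" l] assms that by (auto simp: toral_arrangement_def)
  then show ?thesis
    using assms in_components_subset unfolding toral_arrangement_def restr_def torsion_union_def by fastforce
qed

lemma Union_restr: "\<Union>(restr A H) = \<Union>(A - {H}) \<inter> H"
proof -
  have "\<Union>(restr A H) = (\<Union>K\<in>A - {H}. \<Union>(components (K \<inter> H)))" unfolding restr_def by blast
  then show ?thesis by auto
qed

lemma of_nat_card_Diff:
  "finite A \<Longrightarrow> B \<subseteq> A \<Longrightarrow> (of_nat (card (A - B)) :: 'a :: ring_1) = of_nat (card A) - of_nat (card B)"
  by (simp add: card_Diff_subset card_mono finite_subset of_nat_diff)

theorem chi_deletion_restriction:
  assumes toral: "toral_arrangement l X A" and H: "H \<in> A" and proper: "X \<notin> A"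
    and incomparable: "\<And>K. K \<in> A - {H} \<Longrightarrow> \<not> H \<subseteq> K"
  shows "chi l X A = chi l X (A - {H}) - chi l H (restr A H)"
proof (rule chi_eqI[OF toral])
  have HX: "H \<subseteq> X" using toral H by (auto simp: toral_arrangement_def)
  have "H \<notin> restr A H" using incomparable in_components_subset unfolding restr_def by blast
  then have complement_H: "H - \<Union>(restr A H - {H}) = H - \<Union>(A - {H})" using Union_restr[of A H] by auto
  from eventually_poly_chi[OF toral_arrangement_mono[OF toral Diff_subset, of "{H}"]]
    eventually_poly_chi[OF toral_arrangement_restr[OF toral H]]
  show "\<forall>\<^sub>F k in sequentially. int (card ((X - \<Union>(A - {X})) \<inter> torsion_pts k))
      = poly (chi l X (A - {H}) - chi l H (restr A H)) (fact k)"
  proof eventually_elim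
    case (elim k)
    let ?P = "(X - \<Union>(A - {H})) \<inter> torsion_pts k" and ?Q = "(H - \<Union>(A - {H})) \<inter> torsion_pts k"
    have "finite (X \<inter> torsion_pts k)"
      using toral finite_torsion_coset_Int_torsion_pts[of l X k] by (simp add: toral_arrangement_def)
    then have "finite ?P" by (rule rev_finite_subset) blast
    moreover have "?Q \<subseteq> ?P" using HX by blast
    ultimately have "int (card (?P - ?Q)) = int (card ?P) - int (card ?Q)"
      by (rule of_nat_card_Diff)
    moreover have "(X - \<Union>(A - {X})) \<inter> torsion_pts k = ?P - ?Q" using proper H by auto
    ultimately show ?case using elim proper complement_H by simp
  qed
qed

section \<open>Transport of inductive arrangements\<close>

text \<open>The two instances are the image under a monomial automorphism, where \<open>\<pi>\<close> is its inverse, and the product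
with a circle, where \<open>\<pi>\<close> is the projection.\<close>

locale arrangement_transport =
  fixes n l e :: nat and T :: "pt set" and \<pi> :: "pt \<Rightarrow> pt"
  assumes onto: "\<pi> ` T = torus n"
    and coset: "torsion_coset n C \<Longrightarrow> torsion_coset l {x \<in> T. \<pi> x \<in> C}"
    and card: "\<forall>\<^sub>F k in sequentially. \<forall>S\<subseteq>torus n.
      card ({x \<in> T. \<pi> x \<in> S} \<inter> torsion_pts k) = card (S \<inter> torsion_pts k) * fact k ^ e"
begin

definition transport :: "pt set \<Rightarrow> pt set" where
  "transport S = {x \<in> T. \<pi> x \<in> S}"

lemma transport_subset_iff: "S \<subseteq> torus n \<Longrightarrow> transport S \<subseteq> transport S' \<longleftrightarrow> S \<subseteq> S'"
  by (auto simp: transport_def simp flip: onto)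

lemma inj_on_transport: "inj_on transport (Pow (torus n))"
  by (rule inj_onI) (metis PowD order_refl subset_antisym transport_subset_iff)

lemma transport_Int: "transport (S \<inter> S') = transport S \<inter> transport S'"
  by (auto simp: transport_def)

lemma transport_Diff: "transport (S - S') = transport S - transport S'"
  by (auto simp: transport_def)

lemma transport_Union: "transport (\<Union>F) = \<Union>(transport ` F)"
  by (auto simp: transport_def)

lemma components_transport:
  assumes "torsion_union n S"
  shows "components (transport S) = transport ` components S"
proof -
  have "disjoint (transport ` components S)"
    using components_nonoverlap[of _ S] by (intro disjointI) (auto simp: transport_def)
  then have "components (\<Union>(transport ` components S)) = transport ` components S"
    using assms coset by (intro components_Union_torsion_cosets[of _ l])
      (auto simp: torsion_union_def transport_def)
  then show ?thesis by (simp flip: transport_Union)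
qed

lemma transport_mem_iff:
  assumes "toral_arrangement n X A" "Y \<subseteq> torus n"
  shows "transport Y \<in> transport ` A \<longleftrightarrow> Y \<in> A"
proof (rule inj_on_image_mem_iff[OF inj_on_transport])
  show "A \<subseteq> Pow (torus n)" using assms(1) torsion_coset_subset by (auto simp: toral_arrangement_def)
qed (use assms(2) in simp)

lemma image_transport_Diff:
  assumes "toral_arrangement n X A" "Y \<subseteq> torus n"
  shows "transport ` A - {transport Y} = transport ` (A - {Y})"
proof -
  have "inj_on transport (insert Y A)"
    using assms torsion_coset_subset
      by (intro inj_on_subset[OF inj_on_transport]) (auto simp: toral_arrangement_def)
  then show ?thesis by (auto simp: inj_on_def)
qed

lemma toral_arrangement_transport:
  assumes "toral_arrangement n X A"
  shows "toral_arrangement l (transport X) (transport ` A)"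
  using assms coset unfolding toral_arrangement_def transport_def by auto

lemma chi_transport:
  assumes "toral_arrangement n X A"
  shows "chi l (transport X) (transport ` A) = monom 1 e * chi n X A"
proof (rule chi_eqI[OF toral_arrangement_transport[OF assms]])
  have X: "X \<subseteq> torus n" using assms torsion_coset_subset by (auto simp: toral_arrangement_def)
  let ?C = "X - \<Union>(A - {X})"
  have "transport X - \<Union>(transport ` A - {transport X}) = transport ?C"
    unfolding image_transport_Diff[OF assms X] by (simp add: transport_Diff transport_Union)
  moreover have "\<forall>\<^sub>F k in sequentially. card (transport ?C \<inter> torsion_pts k)
      = card (?C \<inter> torsion_pts k) * fact k ^ e"
    using card unfolding transport_def[symmetric] by (rule eventually_mono) (use X in blast)
  ultimately show "\<forall>\<^sub>F k in sequentially.
      int (card ((transport X - \<Union>(transport ` A - {transport X})) \<inter> torsion_pts k)) = poly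
        (monom 1 e * chi n X A) (fact k)"
    using eventually_poly_chi[OF assms] by (auto elim: eventually_elim2 simp: poly_monom)
qed

lemma restr_transport:
  assumes "toral_arrangement n X A" "H \<in> A"
  shows "restr (transport ` A) (transport H) = transport ` restr A H"
proof -
  have coset: "torsion_coset n K" if "K \<in> A" for K using assms(1) that by (simp add: toral_arrangement_def)
  have "components (transport K \<inter> transport H) = transport ` components (K \<inter> H)" if "K \<in> A" for K
    unfolding transport_Int[symmetric]
    using torsion_union_Inter[of "{K, H}" n] coset that assms(2) by (intro components_transport) auto
  moreover have "transport ` A - {transport H} = transport ` (A - {H})"
    using image_transport_Diff[OF assms(1) torsion_coset_subset[OF coset[OF assms(2)]]] .
  ultimately show ?thesis unfolding restr_def by (simp add: image_UN)
qed

theorem inductive_arr_transport: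
  "inductive_arr n X A \<Longrightarrow> toral_arrangement n X A \<Longrightarrow> inductive_arr l (transport X) (transport ` A)"
proof (induction rule: inductive_arr.induct)
  case (empty X)
  show ?case by (simp add: inductive_arr.empty)
next
  case (step H A X d)
  note deletion = toral_arrangement_mono[OF step.prems Diff_subset, of "{H}"]
  note restriction = toral_arrangement_restr[OF step.prems step.hyps(1)]
  have H: "H \<subseteq> torus n" using step.prems step.hyps(1) torsion_coset_subset by (auto simp: toral_arrangement_def)
  show ?case
  proof (rule inductive_arr.step[where d = d])
    show "transport H \<in> transport ` A" using step.hyps(1) by (rule imageI)
    show "inductive_arr l (transport X) (transport ` A - {transport H})"
      unfolding image_transport_Diff[OF step.prems H] by (rule step.IH(1)[OF deletion])
    show "inductive_arr l (transport H) (restr (transport ` A) (transport H))"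
      unfolding restr_transport[OF step.prems step.hyps(1)] by (rule step.IH(2)[OF restriction])
    show "chi l (transport X) (transport ` A - {transport H})
        = [:- of_int d, 1:] * chi l (transport H) (restr (transport ` A) (transport H))"
      unfolding image_transport_Diff[OF step.prems H] restr_transport[OF step.prems step.hyps(1)]
        chi_transport[OF deletion] chi_transport[OF restriction] step.hyps(4) by (simp only: mult.left_commute)
  qed
qed

end

lemma arrangement_transport_image:
  assumes "monomial_aut l g" "n \<le> l"
  obtains \<pi> where "arrangement_transport n l 0 (g ` torus n) \<pi>"
    "\<And>S. S \<subseteq> torus n \<Longrightarrow> arrangement_transport.transport (g ` torus n) \<pi> S = g ` S"
proof -
  obtain \<pi> where \<pi>: "monomial_aut l \<pi>"
    "\<And>t. t \<in> torus l \<Longrightarrow> \<pi> (g t) = t" "\<And>t. t \<in> torus l \<Longrightarrow> g (\<pi> t) = t"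
    using monomial_aut_inverseE[OF assms(1)] by blast
  have sub: "t \<in> torus l" if "t \<in> torus n" for t using that torus_mono[OF assms(2)] by blast
  have image: "{x \<in> g ` torus n. \<pi> x \<in> S} = g ` S" if "S \<subseteq> torus n" for S
    using that \<pi>(2)[OF sub] by auto
  have "arrangement_transport n l 0 (g ` torus n) \<pi>"
  proof
    show "\<pi> ` g ` torus n = torus n" using \<pi>(2)[OF sub] by (auto simp: image_image)
    show "torsion_coset l {x \<in> g ` torus n. \<pi> x \<in> C}" if "torsion_coset n C" for C
      unfolding image[OF torsion_coset_subset[OF that]] by (rule torsion_coset_image[OF assms(1) that assms(2)])
    show "\<forall>\<^sub>F k in sequentially. \<forall>S\<subseteq>torus n.
        card ({x \<in> g ` torus n. \<pi> x \<in> S} \<inter> torsion_pts k) = card (S \<inter> torsion_pts k) * fact k ^ 0"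
      using eventually_card_image_torsion_pts[OF assms(1)]
      by (rule eventually_mono)
        (use torus_mono[OF assms(2)] in \<open>simp add: image order_trans[of _ "torus n" "torus l"]\<close>)
  qed
  then show thesis using image by (intro that[of \<pi>]) (simp_all add: arrangement_transport.transport_def)
qed

lemma extend_image_cyl:
  assumes "monomial_aut n g" "S \<subseteq> torus n"
  shows "extend n g ` cyl n S = cyl n (g ` S)"
proof
  have aut: "monomial_aut (Suc n) (extend n g)" using monomial_aut_extend[OF assms(1)] by simp
  show "extend n g ` cyl n S \<subseteq> cyl n (g ` S)"
    using monomial_aut_in[OF aut] by (auto simp: cyl_def truncate_extend[OF _ assms(1)])
  show "cyl n (g ` S) \<subseteq> extend n g ` cyl n S"
  proof
    fix x assume x: "x \<in> cyl n (g ` S)"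
    then obtain t where t: "x \<in> torus (Suc n)" "t \<in> S" "truncate n x = g t" by (auto simp: cyl_def)
    then have t_torus: "t \<in> torus n" using assms(2) by blast
    define y where "y = t(n := x n)"
    have y: "truncate n y = t" using t_torus by (simp add: y_def)
    moreover have "y \<in> torus (Suc n)" unfolding y_def using t_torus torus_norm[OF t(1)] by (rule torus_upd_Suc)
    moreover have "extend n g y = x"
    proof
      fix i
      consider "i < n" | "i = n" | "i > n" by linarith
      then show "extend n g y i = x i"
        by cases (use y t t_torus in \<open>auto simp: extend_def y_def torus_outside simp flip: t(3)\<close>)
    qed
    ultimately show "x \<in> extend n g ` cyl n S" using t(2) by (intro image_eqI[of _ _ y]) (auto simp: cyl_def)
  qed
qed

lemma torus_iff: "t \<in> torus n \<longleftrightarrow> (\<forall>i. cmod (t i) = 1) \<and> (\<forall>i\<ge>n. t i = 1)"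
  using torus_norm by (auto simp: torus_def)

lemma torsion_coset_cyl:
  assumes "torsion_coset n C"
  shows "torsion_coset (Suc n) (cyl n C)"
proof -
  obtain d g where g: "d \<le> n" "monomial_aut n g" "C = g ` torus d" using torsion_cosetE[OF assms] by blast
  define s where "s = Transposition.transpose d n"
  have s: "s permutes {..<Suc n}" unfolding s_def by (rule permutes_swap_id) (use g(1) in auto)
  have ss: "s (s i) = i" for i by (simp add: s_def)
  have swap: "x \<circ> s \<in> torus (Suc d) \<longleftrightarrow> x \<in> cyl n (torus d)" for x
  proof -
    have norm: "(\<forall>i. cmod (x (s i)) = 1) \<longleftrightarrow> (\<forall>i. cmod (x i) = 1)" by (metis ss)
    have "(\<forall>i\<ge>Suc d. x (s i) = 1) \<longleftrightarrow> (\<forall>i. Suc d \<le> s i \<longrightarrow> x i = 1)" by (metis ss)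
    also have "\<dots> \<longleftrightarrow> (\<forall>i\<ge>d. i \<noteq> n \<longrightarrow> x i = 1)"
      using g(1) by (intro all_cong1) (auto simp: s_def Transposition.transpose_def)
    also have "\<dots> \<longleftrightarrow> (\<forall>i<n. d \<le> i \<longrightarrow> x i = 1) \<and> (\<forall>i\<ge>Suc n. x i = 1)"
      using g(1) by (auto simp: Suc_le_eq) (metis linorder_neqE_nat)
    finally show ?thesis using norm by (auto simp: torus_iff cyl_def truncate_def)
  qed
  have swap_swap: "(x \<circ> s) \<circ> s = x" for x :: pt by (simp add: fun_eq_iff ss)
  have "cyl n (torus d) = (\<lambda>t. t \<circ> s) ` torus (Suc d)"
    using swap swap_swap by (metis (no_types, lifting) image_iff subsetI subset_antisym)
  then have "torsion_coset (Suc n) (cyl n (torus d))"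
    using torsion_coset_image[OF monomial_aut_permute[OF s] torsion_coset_torus[of "Suc d" "Suc n"]] g(1)
      by simp
  from torsion_coset_image[OF monomial_aut_extend[OF g(2), of "Suc n"] this]
  show ?thesis unfolding g(3) by (simp add: extend_image_cyl[OF g(2) torus_mono[OF g(1)]])
qed

interpretation cyl: arrangement_transport n "Suc n" 1 "torus (Suc n)" "truncate n"
  rewrites "arrangement_transport.transport (torus (Suc n)) (truncate n) = cyl n" for n
proof -
  have sub: "torus n \<subseteq> torus (Suc n)" by (rule torus_mono) simp
  show "arrangement_transport n (Suc n) 1 (torus (Suc n)) (truncate n)"
  proof
    show "truncate n ` torus (Suc n) = torus n"
      using truncate_in_torus sub by (auto intro!: image_eqI[OF truncate_torus[symmetric]])
  qed (use torsion_coset_cyl card_cyl_torsion_pts in \<open>auto simp: cyl_def\<close>)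
  then show "arrangement_transport.transport (torus (Suc n)) (truncate n) = cyl n"
    by (simp add: fun_eq_iff cyl_def arrangement_transport.transport_def)
qed

lemma transport_by_monomial_aut:
  assumes "monomial_aut l g" "n \<le> l" "toral_arrangement n X A"
  shows "toral_arrangement l (g ` X) ((`) g ` A)" "chi l (g ` X) ((`) g ` A) = chi n X A"
    "inductive_arr n X A \<Longrightarrow> inductive_arr l (g ` X) ((`) g ` A)"
proof -
  obtain \<pi> where "arrangement_transport n l 0 (g ` torus n) \<pi>"
    and image: "\<And>S. S \<subseteq> torus n \<Longrightarrow> arrangement_transport.transport (g ` torus n) \<pi> S = g ` S"
    using arrangement_transport_image[OF assms(1,2)] by blast
  then interpret arrangement_transport n l 0 "g ` torus n" \<pi> by simp
  have "X \<subseteq> torus n" "K \<in> A \<Longrightarrow> K \<subseteq> torus n" for K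
    using assms(3) torsion_coset_subset by (auto simp: toral_arrangement_def)
  then have "transport X = g ` X" "transport ` A = (`) g ` A" using image by (auto intro: image_cong)
  then show "toral_arrangement l (g ` X) ((`) g ` A)" "chi l (g ` X) ((`) g ` A) = chi n X A"
    "inductive_arr n X A \<Longrightarrow> inductive_arr l (g ` X) ((`) g ` A)"
    using toral_arrangement_transport[OF assms(3)] chi_transport[OF assms(3)]
      inductive_arr_transport[OF _ assms(3)]
    by simp_all
qed

section \<open>Inductive arrangements with exponents\<close>

definition exps_poly :: "nat multiset \<Rightarrow> int poly" where
  "exps_poly E = (\<Prod>e\<in>#E. [:- int e, 1:])"

lemma exps_poly_add [simp]: "exps_poly (add_mset e E) = [:- int e, 1:] * exps_poly E"
  by (simp add: exps_poly_def)

definition inductive_exps :: "nat \<Rightarrow> pt set set \<Rightarrow> nat multiset \<Rightarrow> bool" where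
  "inductive_exps n A E \<longleftrightarrow> toral_arrangement n (torus n) A \<and> torus n \<notin> A \<and>
    inductive_arr n (torus n) A \<and> chi n (torus n) A = exps_poly E"

lemma inductive_expsD:
  assumes "inductive_exps n A E"
  shows "inductive_arr n (torus n) A" "toral_arrangement n (torus n) A" "K \<in> A \<Longrightarrow> torsion_coset n K"
    "K \<in> A \<Longrightarrow> K \<subseteq> torus n" "K \<in> A \<Longrightarrow> K \<noteq> torus n"
  using assms by (auto simp: inductive_exps_def toral_arrangement_def)

lemma inductive_exps_empty: "inductive_exps n {} (replicate_mset n 0)"
proof -
  have toral: "toral_arrangement n (torus n) {}"
    by (simp add: toral_arrangement_def torsion_coset_torus)
  have "chi n (torus n) {} = exps_poly (replicate_mset n 0)"
    by (rule chi_eqI[OF toral]) (simp add: exps_poly_def card_torus_torsion_pts poly_power)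
  then show ?thesis using toral by (simp add: inductive_exps_def inductive_arr.empty)
qed

lemma inductive_exps_aut:
  assumes "inductive_exps n A E" "monomial_aut n g"
  shows "inductive_exps n ((`) g ` A) E"
proof -
  note A = inductive_expsD[OF assms(1)]
  note image = transport_by_monomial_aut[OF assms(2) order_refl A(2), unfolded monomial_aut_image[OF assms(2)]]
  have "torus n \<notin> (`) g ` A"
  proof
    assume "torus n \<in> (`) g ` A"
    then obtain K where K: "K \<in> A" "g ` K = g ` torus n" using monomial_aut_image[OF assms(2)] by auto
    then have "K = torus n" using inj_on_image_eq_iff[OF monomial_aut_inj[OF assms(2)] A(4) order_refl] by simp
    then show False using A(5) K(1) by simp
  qed
  then show ?thesis using image A(1) assms(1) by (simp add: inductive_exps_def)
qed

lemma inductive_exps_cyl: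
  assumes "inductive_exps n A E"
  shows "inductive_exps (Suc n) (cyl n ` A) (add_mset 0 E)"
proof -
  note A = inductive_expsD[OF assms]
  have "torus (Suc n) \<notin> cyl n ` A" using cyl.transport_mem_iff[OF A(2) order_refl] A(5)
    by (auto simp: cyl_torus)
  then show ?thesis
    using cyl.inductive_arr_transport[OF A(1,2)] cyl.toral_arrangement_transport[OF A(2)]
      cyl.chi_transport[OF A(2)] assms
    by (simp add: inductive_exps_def cyl_torus monom_Suc)
qed

text \<open>The restriction to the new hypertorus \<open>h ` torus n\<close> is pulled back along \<open>h\<close>.\<close>

lemma inductive_exps_insert:
  assumes h: "monomial_aut (Suc n) h"
    and deletion: "inductive_exps (Suc n) A (add_mset e E)"
    and restriction: "inductive_exps n (\<Union>K\<in>A. components {u \<in> torus n. h u \<in> K}) E" (is "inductive_exps n ?R E")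
  shows "inductive_exps (Suc n) (insert (h ` torus n) A) (add_mset (Suc e) E)"
proof -
  let ?H = "h ` torus n" and ?X = "torus (Suc n)"
  note A = inductive_expsD[OF deletion] and R = inductive_expsD[OF restriction]
  note image = transport_by_monomial_aut[OF h _ R(2)]
  have H: "torsion_coset (Suc n) ?H" "?H \<subseteq> ?X" "?H \<noteq> ?X"
    using torsion_coset_image[OF h torsion_coset_torus[of n n]] torsion_coset_subset[of "Suc n" ?H]
      tdim_image_torus[OF h, of n] tdim_image_torus[OF monomial_aut_id, of "Suc n" "Suc n"] by auto
  have toral: "toral_arrangement (Suc n) ?X (insert ?H A)" using A(2) H by (simp add: toral_arrangement_def)
  have proper: "?X \<notin> insert ?H A" using H(3) A(5) by auto
  have incomparable: "\<not> ?H \<subseteq> K" if "K \<in> A" for K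
  proof
    assume "?H \<subseteq> K"
    then have "{u \<in> torus n. h u \<in> K} = torus n" by auto
    then have "torus n \<in> ?R"
      using components_torsion_coset[OF torsion_coset_torus[of n n]] by (intro UN_I[OF that]) simp
    from R(5)[OF this] show False by simp
  qed
  then have delete: "insert ?H A - {?H} = A" by auto
  have restr: "restr (insert ?H A) ?H = (`) h ` ?R"
    unfolding restr_def delete using components_Int_image_torus[OF h _ A(3)] by (simp add: image_UN)
  have chi_A: "chi (Suc n) ?X A = [:- int e, 1:] * exps_poly E"
    using deletion by (simp add: inductive_exps_def)
  have chi_R: "chi (Suc n) ?H ((`) h ` ?R) = exps_poly E"
    using image(2) restriction by (simp add: inductive_exps_def)
  have "chi (Suc n) ?X (insert ?H A) = chi (Suc n) ?X A - chi (Suc n) ?H ((`) h ` ?R)"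
    using chi_deletion_restriction[OF toral insertI1 proper] incomparable unfolding restr delete by blast
  moreover have "[:- int (Suc e), 1:] = [:- int e, 1:] - 1" by (simp add: one_pCons)
  ultimately have "chi (Suc n) ?X (insert ?H A) = exps_poly (add_mset (Suc e) E)"
    by (simp only: exps_poly_add left_diff_distrib mult_1_left chi_A chi_R)
  moreover have "inductive_arr (Suc n) ?X (insert ?H A)"
    using inductive_arr.step[of ?H "insert ?H A" "Suc n" ?X "int e"] A(1) image(3)[OF _ R(1)] chi_A chi_R
    unfolding restr delete by simp
  ultimately show ?thesis using toral proper by (simp add: inductive_exps_def)
qed

section \<open>Splitting off the last coordinate\<close>

definition graph :: "nat \<Rightarrow> (pt \<Rightarrow> complex) \<Rightarrow> pt set" where
  "graph n f = {x \<in> torus (Suc n). x n = f (truncate n x)}"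

definition graph_aut :: "nat \<Rightarrow> (pt \<Rightarrow> complex) \<Rightarrow> pt \<Rightarrow> pt" where
  "graph_aut n f x = x(n := x n * f (truncate n x))"

lemma graph_aut_torus: "u \<in> torus n \<Longrightarrow> graph_aut n f u = u(n := f u)"
  by (simp add: graph_aut_def torus_outside)

lemma monomial_aut_graph_aut: "monomial n f \<Longrightarrow> monomial_aut (Suc n) (graph_aut n f)"
  unfolding graph_aut_def
  by (rule monomial_aut_shear) (auto intro: monomial_comp monomial_map_truncate)

lemma graph_aut_mem_graph:
  "monomial n f \<Longrightarrow> u \<in> torus n \<Longrightarrow> graph_aut n f u \<in> graph n g \<longleftrightarrow> f u = g u"
  using torus_upd_Suc[OF _ monomial_norm] by (auto simp: graph_def graph_aut_torus)

lemma graph_aut_mem_cyl: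
  "monomial n f \<Longrightarrow> u \<in> torus n \<Longrightarrow> graph_aut n f u \<in> cyl n K \<longleftrightarrow> u \<in> K"
  using torus_upd_Suc[OF _ monomial_norm] by (auto simp: cyl_def graph_aut_torus)

lemma graph_aut_image:
  assumes "monomial n f"
  shows "graph_aut n f ` torus n = graph n f"
proof
  show "graph_aut n f ` torus n \<subseteq> graph n f" using graph_aut_mem_graph[OF assms] by auto
  show "graph n f \<subseteq> graph_aut n f ` torus n"
  proof
    fix x assume x: "x \<in> graph n f"
    have "x = graph_aut n f (truncate n x)"
    proof
      fix i
      consider "i < n" | "i = n" | "i > n" by linarith
      then show "x i = graph_aut n f (truncate n x) i"
        by cases (use x in \<open>auto simp: graph_def graph_aut_def torus_outside\<close>)
    qed
    then show "x \<in> graph_aut n f ` torus n" using x truncate_in_torus by (auto simp: graph_def)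
  qed
qed

lemma inductive_exps_insert_graph:
  assumes f: "monomial n f" and D: "\<And>K. K \<in> D \<Longrightarrow> torsion_coset n K"
    and deletion: "inductive_exps (Suc n) (cyl n ` D \<union> graph n ` G) (add_mset e E)"
    and restriction: "inductive_exps n (D \<union> (\<Union>g\<in>G. components {u \<in> torus n. f u = g u})) E"
  shows "inductive_exps (Suc n) (insert (graph n f) (cyl n ` D \<union> graph n ` G)) (add_mset (Suc e) E)"
proof -
  let ?A = "cyl n ` D \<union> graph n ` G"
  have "(\<Union>K\<in>?A. components {u \<in> torus n. graph_aut n f u \<in> K})
      = D \<union> (\<Union>g\<in>G. components {u \<in> torus n. f u = g u})"
  proof -
    have "{u \<in> torus n. graph_aut n f u \<in> cyl n K} = K" if "K \<in> D" for K
      using torsion_coset_subset[OF D[OF that]] graph_aut_mem_cyl[OF f] by auto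
    then have "components {u \<in> torus n. graph_aut n f u \<in> cyl n K} = {K}" if "K \<in> D" for K
      using components_torsion_coset[OF D[OF that]] that by simp
    moreover have "{u \<in> torus n. graph_aut n f u \<in> graph n g} = {u \<in> torus n. f u = g u}" for g
      using graph_aut_mem_graph[OF f] by auto
    ultimately show ?thesis by simp
  qed
  then show ?thesis
    using inductive_exps_insert[OF monomial_aut_graph_aut[OF f], of ?A e E] deletion restriction
    by (simp add: graph_aut_image[OF f])
qed

definition meet_over :: "nat \<Rightarrow> pt set set \<Rightarrow> (pt \<Rightarrow> complex) \<Rightarrow> (pt \<Rightarrow> complex) \<Rightarrow> bool" where
  "meet_over n D f g \<longleftrightarrow> components {u \<in> torus n. f u = g u} \<subseteq> D"

theorem inductive_exps_graphs:
  assumes D: "inductive_exps n D E"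
  shows "\<forall>f\<in>set fs. monomial n f \<Longrightarrow> sorted_wrt (meet_over n D) fs \<Longrightarrow>
    inductive_exps (Suc n) (cyl n ` D \<union> graph n ` set fs) (add_mset (length fs) E)"
proof (induction fs)
  case Nil
  show ?case using inductive_exps_cyl[OF D] by simp
next
  case (Cons f fs)
  have "D \<union> (\<Union>g\<in>set fs. components {u \<in> torus n. f u = g u}) = D"
    using Cons.prems(2) by (auto simp: meet_over_def)
  then show ?case
    using inductive_exps_insert_graph[of n f D "set fs" "length fs" E] inductive_expsD(3)[OF D] Cons D
    by (simp add: meet_over_def)
qed

lemma meet_over_member:
  assumes "inductive_exps n D E" "{u \<in> torus n. f u = g u} \<in> D"
  shows "meet_over n D f g"
  using components_torsion_coset[OF inductive_expsD(3)[OF assms]] assms(2) by (simp add: meet_over_def)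

section \<open>Arrangements of type B\<close>

definition hyp_const :: "nat \<Rightarrow> complex \<Rightarrow> nat \<Rightarrow> pt set" where
  "hyp_const n c i = {x \<in> torus n. x i = c}"

definition hyp_eq :: "nat \<Rightarrow> nat \<Rightarrow> nat \<Rightarrow> pt set" where
  "hyp_eq n i j = {x \<in> torus n. x i = x j}"

definition hyp_inv :: "nat \<Rightarrow> nat \<Rightarrow> nat \<Rightarrow> pt set" where
  "hyp_inv n i j = {x \<in> torus n. x i * x j = 1}"

lemma hyp_eq_commute: "hyp_eq n i j = hyp_eq n j i"
  by (auto simp: hyp_eq_def)

lemma hyp_inv_commute: "hyp_inv n i j = hyp_inv n j i"
  by (auto simp: hyp_inv_def mult.commute)

lemma cyl_hyp:
  "i < n \<Longrightarrow> cyl n (hyp_const n c i) = hyp_const (Suc n) c i"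
  "i < n \<Longrightarrow> j < n \<Longrightarrow> cyl n (hyp_eq n i j) = hyp_eq (Suc n) i j"
  "i < n \<Longrightarrow> j < n \<Longrightarrow> cyl n (hyp_inv n i j) = hyp_inv (Suc n) i j"
  using truncate_in_torus[of _ "Suc n" n] by (auto simp: cyl_def hyp_const_def hyp_eq_def hyp_inv_def)

lemma eq_inverse_iff: "(b::'a::field) \<noteq> 0 \<Longrightarrow> a = inverse b \<longleftrightarrow> a * b = 1"
  by (auto simp: field_simps)

lemma graph_hyp:
  "graph n (\<lambda>_. c) = hyp_const (Suc n) c n"
  "j < n \<Longrightarrow> graph n (\<lambda>x. x j) = hyp_eq (Suc n) n j"
  "j < n \<Longrightarrow> graph n (\<lambda>x. inverse (x j)) = hyp_inv (Suc n) n j"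
  by (auto simp: graph_def hyp_const_def hyp_eq_def hyp_inv_def torus_nonzero eq_inverse_iff)

lemma minus_one_eq_inverse_iff: "-1 = inverse x \<longleftrightarrow> x = (-1 :: 'a :: field)"
  by (metis inverse_1 inverse_inverse_eq inverse_minus_eq)

lemma agreement_hyp:
  "{u \<in> torus n. u j = c} = hyp_const n c j"
  "{u \<in> torus n. c = u j} = hyp_const n c j"
  "{u \<in> torus n. u i = u j} = hyp_eq n i j"
  "{u \<in> torus n. u i = inverse (u j)} = hyp_inv n i j"
  "{u \<in> torus n. inverse (u i) = u j} = hyp_inv n i j"
  by (auto simp: hyp_const_def hyp_eq_def hyp_inv_def torus_nonzero field_simps)

lemma torsion_coset_hyp_const: "i < n \<Longrightarrow> torsion c \<Longrightarrow> torsion_coset n (hyp_const n c i)"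
  unfolding hyp_const_def by (rule torsion_coset_coord)

lemma components_self_inverse:
  assumes "j < n"
  shows "components (hyp_inv n j j) = {hyp_const n 1 j, hyp_const n (-1) j}"
proof -
  have "z * z = 1 \<longleftrightarrow> z = 1 \<or> z = -1" for z :: complex using power2_eq_1_iff[of z] by (simp add: power2_eq_square)
  then have "hyp_inv n j j = \<Union>{hyp_const n 1 j, hyp_const n (-1) j}" by (auto simp: hyp_inv_def hyp_const_def)
  moreover have "disjoint {hyp_const n 1 j, hyp_const n (-1) j}"
    by (auto simp: disjoint_def disjnt_def hyp_const_def)
  moreover have "torsion_coset n C" if "C \<in> {hyp_const n 1 j, hyp_const n (-1) j}" for C
    using that torsion_coset_hyp_const[OF assms] by auto
  ultimately show ?thesis
    using components_Union_torsion_cosets[of "{hyp_const n 1 j, hyp_const n (-1) j}" n] by simp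
qed

definition signed_arr ::
  "nat \<Rightarrow> (nat \<Rightarrow> bool) \<Rightarrow> (nat \<Rightarrow> bool) \<Rightarrow> (nat \<Rightarrow> nat \<Rightarrow> bool) \<Rightarrow> (nat \<Rightarrow> nat \<Rightarrow> bool) \<Rightarrow> pt set set" where
  "signed_arr n P N V W = {hyp_const n 1 i |i. i < n \<and> P i} \<union> {hyp_const n (-1) i |i. i < n \<and> N i}
     \<union> {hyp_eq n i j |i j. i < n \<and> j < i \<and> V i j} \<union> {hyp_inv n i j |i j. i < n \<and> j < i \<and> W i j}"

definition signed_sections ::
  "nat \<Rightarrow> (nat \<Rightarrow> bool) \<Rightarrow> (nat \<Rightarrow> bool) \<Rightarrow> (nat \<Rightarrow> nat \<Rightarrow> bool) \<Rightarrow> (nat \<Rightarrow> nat \<Rightarrow> bool) \<Rightarrow> (pt \<Rightarrow> complex) list" where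
  "signed_sections n P N V W = (if P n then [\<lambda>_. 1] else []) @ (if N n then [\<lambda>_. -1] else [])
     @ map (\<lambda>j x. x j) (filter (V n) [0..<n]) @ map (\<lambda>j x. inverse (x j)) (filter (W n) [0..<n])"

lemma signed_arr_const: "i < n \<Longrightarrow> P i \<Longrightarrow> hyp_const n 1 i \<in> signed_arr n P N V W"
  "i < n \<Longrightarrow> N i \<Longrightarrow> hyp_const n (-1) i \<in> signed_arr n P N V W"
  by (auto simp: signed_arr_def)

lemma signed_arr_eq: "i < n \<Longrightarrow> j < n \<Longrightarrow> i \<noteq> j \<Longrightarrow> V (max i j) (min i j) \<Longrightarrow> hyp_eq n i j \<in> signed_arr n P N V W"
  unfolding signed_arr_def by (cases "j < i") (auto simp: max_def min_def hyp_eq_commute[of n i j])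

lemma signed_arr_inv: "i < n \<Longrightarrow> j < n \<Longrightarrow> i \<noteq> j \<Longrightarrow> W (max i j) (min i j) \<Longrightarrow> hyp_inv n i j \<in> signed_arr n P N V W"
  unfolding signed_arr_def by (cases "j < i") (auto simp: max_def min_def hyp_inv_commute[of n i j])

lemma signed_arr_Suc:
  "signed_arr (Suc n) P N V W = cyl n ` signed_arr n P N V W \<union> graph n ` set (signed_sections n P N V W)"
proof -
  have "cyl n ` signed_arr n P N V W = {hyp_const (Suc n) 1 i |i. i < n \<and> P i}
      \<union> {hyp_const (Suc n) (-1) i |i. i < n \<and> N i}
     \<union> {hyp_eq (Suc n) i j |i j. i < n \<and> j < i \<and> V i j} \<union> {hyp_inv (Suc n) i j |i j. i < n \<and> j < i \<and> W i j}"
    unfolding signed_arr_def image_Un by (intro arg_cong2[where f = "(\<union>)"]) (force simp: image_iff cyl_hyp)+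
  moreover have "graph n ` set (signed_sections n P N V W) = {hyp_const (Suc n) 1 n |_::unit. P n}
      \<union> {hyp_const (Suc n) (-1) n |_::unit. N n}
     \<union> {hyp_eq (Suc n) n j |j. j < n \<and> V n j} \<union> {hyp_inv (Suc n) n j |j. j < n \<and> W n j}"
    unfolding signed_sections_def set_append image_Un Un_assoc
      by (intro arg_cong2[where f = "(\<union>)"]) (force simp: image_iff graph_hyp)+
  moreover have "{f i |i. i < Suc n \<and> Q i} = {f i |i. i < n \<and> Q i} \<union> {f n |_::unit. Q n}"
    for f :: "nat \<Rightarrow> pt set" and Q
    by (auto simp: less_Suc_eq)
  moreover have "{f i j |i j. i < Suc n \<and> j < i \<and> R i j} = {f i j |i j. i < n \<and> j < i \<and> R i j}
      \<union> {f n j |j. j < n \<and> R n j}"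
    for f :: "nat \<Rightarrow> nat \<Rightarrow> pt set" and R
    by (auto simp: less_Suc_eq)
  ultimately show ?thesis unfolding signed_arr_def by (simp only: Un_ac)
qed

lemma monomial_signed_sections: "\<forall>f\<in>set (signed_sections n P N V W). monomial n f"
  by (auto simp: signed_sections_def intro: monomial_intros split: if_splits)

lemma length_signed_sections:
  "length (signed_sections n P N V W)
      = of_bool (P n) + of_bool (N n) + card {j. j < n \<and> V n j} + card {j. j < n \<and> W n j}"
  by (simp add: signed_sections_def distinct_length_filter Int_def conj_commute)

lemma sorted_wrt_map_filter_upt:
  "(\<And>i j. i < j \<Longrightarrow> j < n \<Longrightarrow> Q i \<Longrightarrow> Q j \<Longrightarrow> R (f i) (f j)) \<Longrightarrow> sorted_wrt R (map f (filter Q [0..<n]))"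
  unfolding sorted_wrt_map by (rule sorted_wrt_mono_rel[OF _ sorted_wrt_filter[OF sorted_wrt_upt]]) auto

lemma coord_meets_inverse:
  assumes "inductive_exps n (signed_arr n P N V W) E" "i < n" "j < n"
    and "i \<noteq> j \<Longrightarrow> W (max i j) (min i j)" "i = j \<Longrightarrow> P j \<and> N j"
  shows "meet_over n (signed_arr n P N V W) (\<lambda>x. x i) (\<lambda>x. inverse (x j))"
proof (cases "i = j")
  case True
  then show ?thesis
    using assms components_self_inverse[of j n] by (simp add: meet_over_def agreement_hyp signed_arr_const)
next
  case False
  then show ?thesis
    using assms by (intro meet_over_member[OF assms(1)]) (simp add: agreement_hyp signed_arr_inv)
qed

lemma inductive_exps_signed_arr_Suc:
  assumes IH: "inductive_exps n (signed_arr n P N V W) E"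
    and P: "\<And>j. P n \<Longrightarrow> j < n \<Longrightarrow> V n j \<or> W n j \<Longrightarrow> P j"
    and N: "\<And>j. N n \<Longrightarrow> j < n \<Longrightarrow> V n j \<or> W n j \<Longrightarrow> N j"
    and V: "\<And>i j. i < j \<Longrightarrow> j < n \<Longrightarrow> V n i \<and> V n j \<or> W n i \<and> W n j \<Longrightarrow> V j i"
    and W: "\<And>i j. i < n \<Longrightarrow> j < n \<Longrightarrow> i \<noteq> j \<Longrightarrow> V n i \<Longrightarrow> W n j \<Longrightarrow> W (max i j) (min i j)"
    and PN: "\<And>j. j < n \<Longrightarrow> V n j \<Longrightarrow> W n j \<Longrightarrow> P j \<and> N j"
  shows "inductive_exps (Suc n) (signed_arr (Suc n) P N V W)
    (add_mset (of_bool (P n) + of_bool (N n) + card {j. j < n \<and> V n j} + card {j. j < n \<and> W n j}) E)"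
proof -
  let ?D = "signed_arr n P N V W"
  let ?coords = "map (\<lambda>j x. x j) (filter (V n) [0..<n]) :: (pt \<Rightarrow> complex) list"
  let ?inverses = "map (\<lambda>j x. inverse (x j)) (filter (W n) [0..<n]) :: (pt \<Rightarrow> complex) list"
  have "sorted_wrt (meet_over n ?D) (signed_sections n P N V W)"
    unfolding signed_sections_def sorted_wrt_append
  proof (intro conjI ballI)
    show "sorted_wrt (meet_over n ?D) ?coords"
      using V by (intro sorted_wrt_map_filter_upt meet_over_member[OF IH])
        (simp add: agreement_hyp signed_arr_eq)
    show "sorted_wrt (meet_over n ?D) ?inverses"
      using V by (intro sorted_wrt_map_filter_upt meet_over_member[OF IH])
        (simp add: agreement_hyp signed_arr_eq)
  next
    fix f g :: "pt \<Rightarrow> complex" assume "f \<in> set ?coords" "g \<in> set ?inverses"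
    then obtain i j where ij: "i < n" "j < n" "V n i" "W n j" "f = (\<lambda>x. x i)" "g = (\<lambda>x. inverse (x j))" by auto
    show "meet_over n ?D f g" unfolding ij(5,6)
      by (rule coord_meets_inverse[OF IH ij(1,2)]) (use ij W PN in auto)
  next
    fix f g :: "pt \<Rightarrow> complex" assume "f \<in> set (if N n then [\<lambda>_. -1] else [])"
      "g \<in> set (?coords @ ?inverses)"
    then show "meet_over n ?D f g"
      using N by (intro meet_over_member[OF IH])
        (auto simp: agreement_hyp minus_one_eq_inverse_iff signed_arr_const split: if_splits)
  next
    fix f g :: "pt \<Rightarrow> complex" assume f: "f \<in> set (if P n then [\<lambda>_. 1] else [])"
      and g: "g \<in> set ((if N n then [\<lambda>_. -1] else []) @ ?coords @ ?inverses)"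
    show "meet_over n ?D f g"
    proof (cases "g = (\<lambda>_. -1)")
      case True
      then show ?thesis using f by (auto simp: meet_over_def split: if_splits)
    next
      case False
      then show ?thesis
        using P f g by (intro meet_over_member[OF IH])
          (auto simp: agreement_hyp minus_one_eq_inverse_iff signed_arr_const split: if_splits)
    qed
  qed simp_all
  from inductive_exps_graphs[OF IH monomial_signed_sections this]
  show ?thesis by (simp add: signed_arr_Suc length_signed_sections)
qed

text \<open>The pairs \<open>j < i\<close> with \<open>W i j\<close> are the edges of a graph; they index the hypertori \<open>x\<^sub>i x\<^sub>j = 1\<close>.\<close>

definition shifted :: "(nat \<Rightarrow> nat \<Rightarrow> bool) \<Rightarrow> bool" where
  "shifted W \<longleftrightarrow> (\<forall>i j i' j'. W i j \<longrightarrow> i' \<le> i \<longrightarrow> j' \<le> j \<longrightarrow> j' < i' \<longrightarrow> W i' j')"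

lemma shiftedD: "shifted W \<Longrightarrow> W i j \<Longrightarrow> i' \<le> i \<Longrightarrow> j' \<le> j \<Longrightarrow> j' < i' \<Longrightarrow> W i' j'"
  unfolding shifted_def by blast

lemma shifted_adjacent: "shifted W \<Longrightarrow> W n k \<Longrightarrow> i < n \<Longrightarrow> j \<le> k \<Longrightarrow> i \<noteq> j \<Longrightarrow> j < n \<Longrightarrow> W (max i j) (min i j)"
  by (rule shiftedD[of W n k]) (auto simp: max_def min_def)

definition lower_degree :: "(nat \<Rightarrow> nat \<Rightarrow> bool) \<Rightarrow> nat \<Rightarrow> nat" where
  "lower_degree W n = card {j. j < n \<and> W n j}"

lemma lower_degree_le: "lower_degree W n \<le> n"
  unfolding lower_degree_def using card_mono[of "{..<n}" "{j. j < n \<and> W n j}"] by auto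

lemma lower_neighbours:
  assumes "shifted W"
  shows "{j. j < n \<and> W n j} = {..<lower_degree W n}"
proof -
  define m where "m = (LEAST j. \<not> (j < n \<and> W n j))"
  have "\<not> (m < n \<and> W n m)" unfolding m_def by (rule LeastI[of _ n]) simp
  then have "j < m" if "j < n" "W n j" for j
    using shiftedD[OF assms that(2) order_refl, of m] that(1) by (meson not_less le_less_trans)
  then have eq: "{j. j < n \<and> W n j} = {..<m}" unfolding m_def using not_less_Least by blast
  show ?thesis unfolding lower_degree_def eq by simp
qed

lemma less_lower_degree: "shifted W \<Longrightarrow> j < lower_degree W n \<longleftrightarrow> j < n \<and> W n j"
  using lower_neighbours[of W n] by auto

abbreviation shifted_arr :: "nat \<Rightarrow> nat \<Rightarrow> (nat \<Rightarrow> nat \<Rightarrow> bool) \<Rightarrow> pt set set" where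
  "shifted_arr n s W \<equiv> signed_arr n (\<lambda>_. True) (\<lambda>i. i < s) (\<lambda>_ _. True) W"

fun shifted_exps :: "(nat \<Rightarrow> nat \<Rightarrow> bool) \<Rightarrow> nat \<Rightarrow> nat \<Rightarrow> nat multiset" where
  "shifted_exps W 0 s = {#}"
| "shifted_exps W (Suc n) s =
    (if n < s then add_mset (n + 2 + lower_degree W n) (shifted_exps W n n)
     else if lower_degree W n \<le> s then add_mset (n + 1 + lower_degree W n) (shifted_exps W n s)
     else add_mset (n + lower_degree W n) (shifted_exps W n (Suc s)))"

text \<open>Adding the hypertorus \<open>x\<^sub>s = -1\<close> at a vertex \<open>s\<close> adjacent to all others raises one exponent by one.\<close>

lemma shifted_exps_Suc:
  assumes "shifted W" "s < n" "\<And>i j. i < n \<Longrightarrow> j < i \<Longrightarrow> j \<le> s \<Longrightarrow> W i j"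
  shows "add_mset (n + s + 1) (shifted_exps W n s) = add_mset (n + s) (shifted_exps W n (Suc s))"
  using assms(2,3)
proof (induction n arbitrary: s)
  case (Suc n)
  let ?m = "lower_degree W n"
  have m: "s < ?m" if "s < n" using less_lower_degree[OF assms(1)] Suc.prems(2)[of n s] that by simp
  consider "s = n" | "s < n" "?m = Suc s" | "s < n" "Suc s < ?m" using Suc.prems(1) m by linarith
  then show ?case
  proof cases
    case 1
    then have "{j. j < n \<and> W n j} = {..<n}" using Suc.prems(2)[of n] by auto
    then have "?m = n" by (simp add: lower_degree_def)
    then show ?thesis using 1 by (simp add: add_mset_commute)
  next
    case 2
    then show ?thesis by (simp add: add_mset_commute)
  next
    case 3
    then have "Suc s < n" "W n (Suc s)" using less_lower_degree[OF assms(1), of "Suc s" n] by auto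
    moreover have "W i j" if "i < n" "j < i" "j \<le> Suc s" for i j
      using shiftedD[OF assms(1) \<open>W n (Suc s)\<close>] that by simp
    ultimately have "add_mset (n + Suc s + 1) (shifted_exps W n (Suc s))
        = add_mset (n + Suc s) (shifted_exps W n (Suc (Suc s)))"
      by (intro Suc.IH) auto
    then show ?thesis using 3 by (simp add: add_mset_commute)
  qed
qed simp

lemma image_permute_hyp:
  assumes "s permutes {..<n}" "\<And>i. s (s i) = i"
  shows "(\<lambda>t. t \<circ> s) ` hyp_const n c i = hyp_const n c (s i)"
    "(\<lambda>t. t \<circ> s) ` hyp_eq n i j = hyp_eq n (s i) (s j)"
    "(\<lambda>t. t \<circ> s) ` hyp_inv n i j = hyp_inv n (s i) (s j)"
proof -
  have "(\<lambda>t. t \<circ> s) ` {x \<in> torus n. Q x} = {x \<in> torus n. Q (x \<circ> s)}" for Q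
  proof -
    have "(x \<circ> s) \<circ> s = x" for x :: pt using assms(2) by (simp add: fun_eq_iff)
    then show ?thesis using monomial_aut_in[OF monomial_aut_permute[OF assms(1)]]
      by (auto intro!: image_eqI[of _ _ "_ \<circ> s"])
  qed
  then show "(\<lambda>t. t \<circ> s) ` hyp_const n c i = hyp_const n c (s i)"
    "(\<lambda>t. t \<circ> s) ` hyp_eq n i j = hyp_eq n (s i) (s j)"
    "(\<lambda>t. t \<circ> s) ` hyp_inv n i j = hyp_inv n (s i) (s j)"
    by (simp_all add: hyp_const_def hyp_eq_def hyp_inv_def)
qed

text \<open>Exchanging two vertices that are adjacent to all others preserves the family of edges.\<close>

lemma image_transpose_signed_arr:
  assumes ab: "a < n" "b < n"
    and adjacent: "\<And>i. i < n \<Longrightarrow> i \<noteq> a \<Longrightarrow> W (max i a) (min i a)" "\<And>i. i < n \<Longrightarrow> i \<noteq> b \<Longrightarrow> W (max i b) (min i b)"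
  shows "(`) (\<lambda>t. t \<circ> Transposition.transpose a b) ` signed_arr n (\<lambda>_. True) N (\<lambda>_ _. True) W
    = signed_arr n (\<lambda>_. True) (N \<circ> Transposition.transpose a b) (\<lambda>_ _. True) W"
proof -
  define s where "s = Transposition.transpose a b"
  let ?g = "\<lambda>t :: pt. t \<circ> s" and ?A = "\<lambda>N. signed_arr n (\<lambda>_. True) N (\<lambda>_ _. True) W"
  have s: "s permutes {..<n}" unfolding s_def by (rule permutes_swap_id) (use ab in auto)
  have ss [simp]: "s (s i) = i" "s i = s j \<longleftrightarrow> i = j" for i j
    by (simp_all add: s_def inj_eq[OF inj_transpose])
  have less [simp]: "s i < n \<longleftrightarrow> i < n" for i using permutes_in_image[OF s] by simp
  have W: "W (max (s i) (s j)) (min (s i) (s j))" if "i < n" "j < i" "W i j" for i j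
  proof -
    have "s i \<in> {a, b} \<or> s j \<in> {a, b} \<or> s i = i \<and> s j = j" by (auto simp: s_def Transposition.transpose_def)
    then show ?thesis
      using that adjacent(1)[of "s i"] adjacent(1)[of "s j"] adjacent(2)[of "s i"] adjacent(2)[of "s j"]
      by (auto simp: max.commute min.commute)
  qed
  have image: "(`) ?g ` ?A N \<subseteq> ?A (N \<circ> s)" for N
  proof (rule image_subsetI)
    fix K assume "K \<in> ?A N"
    then consider i where "i < n" "K = hyp_const n 1 i" | i where "i < n" "N i" "K = hyp_const n (-1) i"
      | i j where "i < n" "j < i" "K = hyp_eq n i j" | i j where "i < n" "j < i" "W i j" "K = hyp_inv n i j"
      unfolding signed_arr_def by blast
    then show "?g ` K \<in> ?A (N \<circ> s)"
      by cases (use W in \<open>auto simp: image_permute_hyp[OF s ss(1)]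
        intro: signed_arr_const signed_arr_eq signed_arr_inv\<close>)
  qed
  have "?A (N \<circ> s) \<subseteq> (`) ?g ` ?A N"
  proof
    fix K assume "K \<in> ?A (N \<circ> s)"
    then have "?g ` K \<in> ?A N" using image[of "N \<circ> s"] by (auto simp: o_def)
    moreover have "?g ` ?g ` K = K" by (simp add: image_image o_def)
    ultimately show "K \<in> (`) ?g ` ?A N" by (metis image_eqI)
  qed
  then show ?thesis using image[of N] unfolding s_def by blast
qed

lemma inductive_exps_shifted_swap:
  assumes "shifted W" "W n k" "k < n" "s \<le> k" "inductive_exps n (shifted_arr n (Suc s) W) E"
  shows "inductive_exps n (insert (hyp_const n (-1) k) (shifted_arr n s W)) E"
proof -
  let ?s = "Transposition.transpose s k"
  have perm: "?s permutes {..<n}" by (rule permutes_swap_id) (use assms(3,4) in auto)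
  have "(`) (\<lambda>t. t \<circ> ?s) ` shifted_arr n (Suc s) W
      = signed_arr n (\<lambda>_. True) ((\<lambda>i. i < Suc s) \<circ> ?s) (\<lambda>_ _. True) W"
    using assms(3,4) shifted_adjacent[OF assms(1,2)] by (intro image_transpose_signed_arr) auto
  moreover have "(\<lambda>i. i < Suc s) \<circ> ?s = (\<lambda>i. i < s \<or> i = k)"
    using assms(4) by (auto simp: fun_eq_iff Transposition.transpose_def)
  moreover have "signed_arr n (\<lambda>_. True) (\<lambda>i. i < s \<or> i = k) (\<lambda>_ _. True) W
      = insert (hyp_const n (-1) k) (shifted_arr n s W)"
  proof -
    have "{hyp_const n (-1) i |i. i < n \<and> (i < s \<or> i = k)}
        = insert (hyp_const n (-1) k) {hyp_const n (-1) i |i. i < n \<and> i < s}"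
      using assms(3) by auto
    then show ?thesis unfolding signed_arr_def by simp
  qed
  ultimately show ?thesis
    using inductive_exps_aut[OF assms(5) monomial_aut_permute[OF perm]] by simp
qed

definition cut_row :: "nat \<Rightarrow> nat \<Rightarrow> (nat \<Rightarrow> nat \<Rightarrow> bool) \<Rightarrow> nat \<Rightarrow> nat \<Rightarrow> bool" where
  "cut_row n k W i j \<longleftrightarrow> (if i = n then j < k else W i j)"

lemma signed_arr_cong:
  assumes "\<And>i. i < n \<Longrightarrow> P i \<longleftrightarrow> P' i" "\<And>i. i < n \<Longrightarrow> N i \<longleftrightarrow> N' i"
    "\<And>i j. i < n \<Longrightarrow> j < i \<Longrightarrow> V i j \<longleftrightarrow> V' i j" "\<And>i j. i < n \<Longrightarrow> j < i \<Longrightarrow> W i j \<longleftrightarrow> W' i j"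
  shows "signed_arr n P N V W = signed_arr n P' N' V' W'"
proof -
  have "{hyp_const n 1 i |i. i < n \<and> P i} = {hyp_const n 1 i |i. i < n \<and> P' i}" using assms(1) by blast
  moreover have "{hyp_const n (-1) i |i. i < n \<and> N i} = {hyp_const n (-1) i |i. i < n \<and> N' i}"
    using assms(2) by blast
  moreover have "{hyp_eq n i j |i j. i < n \<and> j < i \<and> V i j} = {hyp_eq n i j |i j. i < n \<and> j < i \<and> V' i j}"
    using assms(3) by blast
  moreover have "{hyp_inv n i j |i j. i < n \<and> j < i \<and> W i j} = {hyp_inv n i j |i j. i < n \<and> j < i \<and> W' i j}"
    using assms(4) by blast
  ultimately show ?thesis by (simp only: signed_arr_def)
qed

lemma signed_arr_cut_row: "signed_arr n P N V (cut_row n k W) = signed_arr n P N V W"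
  by (rule signed_arr_cong) (simp_all add: cut_row_def)

definition row_sections :: "nat \<Rightarrow> nat \<Rightarrow> (pt \<Rightarrow> complex) set" where
  "row_sections n k = insert (\<lambda>_. 1) ({\<lambda>x. x j |j. j < n} \<union> {\<lambda>x. inverse (x j) |j. j < k})"

lemma row_sections_Suc: "row_sections n (Suc k) = insert (\<lambda>x. inverse (x k)) (row_sections n k)"
  unfolding row_sections_def by (auto simp: less_Suc_eq)

lemma shifted_arr_cut_row:
  assumes "s \<le> n" "k \<le> n"
  shows "shifted_arr (Suc n) s (cut_row n k W) = cyl n ` shifted_arr n s W \<union> graph n ` row_sections n k"
proof -
  have "set (signed_sections n (\<lambda>_. True) (\<lambda>i. i < s) (\<lambda>_ _. True) (cut_row n k W)) = row_sections n k"
    using assms by (auto simp: signed_sections_def row_sections_def cut_row_def)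
  then show ?thesis using signed_arr_Suc[of n _ _ _ "cut_row n k W"] by (simp only: signed_arr_cut_row)
qed

text \<open>The graphs of \<open>x\<^sub>k\<close> and \<open>1 / x\<^sub>k\<close> also meet over \<open>x\<^sub>k = -1\<close>.\<close>

lemma restriction_to_edge:
  assumes W: "shifted W" "W n k" "k < n" and D: "inductive_exps n (shifted_arr n s W) E"
  shows "shifted_arr n s W \<union> (\<Union>g\<in>row_sections n k. components {u \<in> torus n. inverse (u k) = g u})
    = insert (hyp_const n (-1) k) (shifted_arr n s W)" (is "?D \<union> (\<Union>g\<in>_. ?res g) = ?R")
proof -
  have coord: "?res (\<lambda>x. x k) = {hyp_const n 1 k, hyp_const n (-1) k}"
    unfolding agreement_hyp by (rule components_self_inverse[OF W(3)])
  have others: "meet_over n ?D (\<lambda>x. inverse (x k)) g" if g: "g \<in> row_sections n k" "g \<noteq> (\<lambda>x. x k)" for g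
  proof (rule meet_over_member[OF D])
    consider "g = (\<lambda>_. 1)" | j where "j < n" "j \<noteq> k" "g = (\<lambda>x. x j)" | j where "j < k" "g = (\<lambda>x. inverse (x j))"
      using g unfolding row_sections_def by auto
    then show "{u \<in> torus n. inverse (u k) = g u} \<in> ?D"
    proof cases
      case 1
      then show ?thesis using W(3) by (simp add: agreement_hyp signed_arr_const)
    next
      case (2 j)
      have "W (max k j) (min k j)"
        using shifted_adjacent[OF W(1,2), of j k] 2 W(3) by (simp add: max.commute min.commute)
      then show ?thesis unfolding 2(3) agreement_hyp using 2 W(3) by (intro signed_arr_inv) auto
    next
      case (3 j)
      then show ?thesis using W(3) by (simp add: agreement_hyp signed_arr_eq)
    qed
  qed
  show ?thesis
  proof
    have "?res g \<subseteq> ?R" if "g \<in> row_sections n k" for g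
      using others[OF that] coord W(3)
      by (cases "g = (\<lambda>x. x k)") (auto simp: meet_over_def signed_arr_const)
    then show "?D \<union> (\<Union>g\<in>row_sections n k. ?res g) \<subseteq> ?R" by blast
    have "(\<lambda>x. x k) \<in> row_sections n k" using W(3) by (auto simp: row_sections_def)
    then show "?R \<subseteq> ?D \<union> (\<Union>g\<in>row_sections n k. ?res g)" using coord by auto
  qed
qed

lemma inductive_exps_add_edge:
  assumes W: "shifted W" "W n k" "k < n" and s: "s \<le> k"
    and D: "inductive_exps n (shifted_arr n s W) E'"
    and D_Suc: "inductive_exps n (shifted_arr n (Suc s) W) E"
    and deletion: "inductive_exps (Suc n) (shifted_arr (Suc n) s (cut_row n k W)) (add_mset e E)"
  shows "inductive_exps (Suc n) (shifted_arr (Suc n) s (cut_row n (Suc k) W)) (add_mset (Suc e) E)"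
proof -
  have rows: "shifted_arr (Suc n) s (cut_row n j W) = cyl n ` shifted_arr n s W \<union> graph n ` row_sections n j"
    if "j \<le> Suc k" for j
    using that W(3) s by (intro shifted_arr_cut_row) auto
  have "inductive_exps n (shifted_arr n s W
      \<union> (\<Union>g\<in>row_sections n k. components {u \<in> torus n. inverse (u k) = g u})) E"
    unfolding restriction_to_edge[OF W D] by (rule inductive_exps_shifted_swap[OF W s D_Suc])
  then show ?thesis
    using deletion inductive_expsD(3)[OF D]
    unfolding rows[OF order_refl] rows[OF le_SucI[OF order_refl]] row_sections_Suc image_insert Un_insert_right
    by (intro inductive_exps_insert_graph monomial_intros)
qed

lemma inductive_exps_shifted_row:
  assumes "shifted W" "k \<le> lower_degree W n" "k \<le> s" "inductive_exps n (shifted_arr n s W) E"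
  shows "inductive_exps (Suc n) (shifted_arr (Suc n) s (cut_row n k W))
      (add_mset (of_bool (n < s) + n + 1 + k) E)"
proof -
  have row: "W n j" if "j < k" for j using less_lower_degree[OF assms(1), of j n] assms(2) that by simp
  have kn: "k \<le> n" using assms(2) lower_degree_le order_trans by blast
  have "inductive_exps (Suc n) (shifted_arr (Suc n) s (cut_row n k W))
    (add_mset (of_bool True + of_bool (n < s) + card {j. j < n \<and> True} + card {j. j < n \<and> cut_row n k W n j})
      E)"
  proof (rule inductive_exps_signed_arr_Suc)
    show "inductive_exps n (signed_arr n (\<lambda>_. True) (\<lambda>i. i < s) (\<lambda>_ _. True) (cut_row n k W)) E"
      using assms(4) by (simp only: signed_arr_cut_row)
    show "cut_row n k W (max i j) (min i j)" if "i < n" "j < n" "i \<noteq> j" "cut_row n k W n j" for i j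
      using shifted_adjacent[OF assms(1) row] that by (auto simp: cut_row_def)
  qed (use assms(3) in \<open>auto simp: cut_row_def\<close>)
  moreover have "{j. j < n \<and> cut_row n k W n j} = {..<k}" using kn by (auto simp: cut_row_def)
  ultimately show ?thesis by simp
qed

lemma inductive_exps_shifted_row_beyond:
  assumes W: "shifted W" and s: "s \<le> k" "k \<le> lower_degree W n" "s < lower_degree W n"
    and IH: "\<And>r. r \<le> n \<Longrightarrow> inductive_exps n (shifted_arr n r W) (shifted_exps W n r)"
  shows "inductive_exps (Suc n) (shifted_arr (Suc n) s (cut_row n k W))
      (add_mset (n + k) (shifted_exps W n (Suc s)))"
  using s(1,2)
proof (induction k rule: dec_induct)
  case base
  have n: "s < n" "W n s" using less_lower_degree[OF W] s(3) by auto
  then have "W i j" if "i < n" "j < i" "j \<le> s" for i j using shiftedD[OF W n(2)] that by simp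
  then have exps: "add_mset (n + s + 1) (shifted_exps W n s) = add_mset (n + s) (shifted_exps W n (Suc s))"
    by (rule shifted_exps_Suc[OF W n(1)])
  have "inductive_exps (Suc n) (shifted_arr (Suc n) s (cut_row n s W))
      (add_mset (n + s + 1) (shifted_exps W n s))"
    using inductive_exps_shifted_row[OF W _ order_refl IH] n(1) s(3) by fastforce
  then show ?case unfolding exps .
next
  case (step k)
  then have "W n k" "k < n" using less_lower_degree[OF W, of k n] by auto
  then show ?case
    using inductive_exps_add_edge[OF W _ _ step.hyps(1) IH IH] step by simp
qed

theorem inductive_exps_shifted_arr:
  assumes "shifted W"
  shows "s \<le> n \<Longrightarrow> inductive_exps n (shifted_arr n s W) (shifted_exps W n s)"
proof (induction n arbitrary: s)
  case 0
  then show ?case using inductive_exps_empty[of 0] by (simp add: signed_arr_def)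
next
  case (Suc n)
  let ?m = "lower_degree W n"
  note row = inductive_exps_shifted_row[OF assms, of ?m n s]
  have full_row: "shifted_arr (Suc n) s (cut_row n ?m W) = shifted_arr (Suc n) s W"
    by (rule signed_arr_cong) (auto simp: cut_row_def less_lower_degree[OF assms])
  consider "s = Suc n" | "s \<le> n" "?m \<le> s" | "s \<le> n" "s < ?m" using Suc.prems by linarith
  then show ?case
  proof cases
    case 1
    have "shifted_arr n s W = shifted_arr n n W" by (rule signed_arr_cong) (use 1 in auto)
    then show ?thesis using row Suc.IH[of n] 1 lower_degree_le[of W n] unfolding full_row
      by (simp add: ac_simps)
  next
    case 2
    then show ?thesis using row Suc.IH[of s] unfolding full_row by (simp add: ac_simps)
  next
    case 3
    then show ?thesis
      using inductive_exps_shifted_row_beyond[OF assms, of s ?m n] Suc.IH unfolding full_row by simp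
  qed
qed

theorem inductive_exps_signed_arr:
  assumes P: "\<And>i i'. P i \<Longrightarrow> i' \<le> i \<Longrightarrow> P i'" "\<And>i j. P i \<Longrightarrow> j < i \<Longrightarrow> V i j"
    and V: "\<And>i j i' j'. V i j \<Longrightarrow> j \<le> j' \<Longrightarrow> j' < i' \<Longrightarrow> i' \<le> i \<Longrightarrow> V i' j'"
    and W: "shifted W" "\<And>i j. W i j \<Longrightarrow> j < i \<Longrightarrow> P i"
  shows "\<exists>E. inductive_exps n (signed_arr n P (\<lambda>_. False) V W) E"
proof (induction n)
  case 0
  have "signed_arr 0 P (\<lambda>_. False) V W = {}" by (simp add: signed_arr_def)
  then show ?case using inductive_exps_empty by metis
next
  case (Suc n)
  show ?case
  proof (cases "P n")
    case True
    then have "P i" if "i < Suc n" for i using P(1)[of n i] that by simp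
    then have "signed_arr (Suc n) P (\<lambda>_. False) V W = shifted_arr (Suc n) 0 W"
      using P(2) by (intro signed_arr_cong) simp_all
    then show ?thesis using inductive_exps_shifted_arr[OF W(1), of 0] by auto
  next
    case False
    obtain E where "inductive_exps n (signed_arr n P (\<lambda>_. False) V W) E" using Suc by blast
    then have "inductive_exps (Suc n) (signed_arr (Suc n) P (\<lambda>_. False) V W)
        (add_mset (of_bool (P n) + of_bool False + card {j. j < n \<and> V n j} + card {j. j < n \<and> W n j}) E)"
      by (rule inductive_exps_signed_arr_Suc) (use False W(2)[of n] V[of n] in \<open>auto dest: less_trans\<close>)
    then show ?thesis by blast
  qed
qed

section \<open>Arrangements of type C\<close>

text \<open>The root lattice of type C does not contain the \<open>\<epsilon>\<^sub>i\<close>. Numbering these from the end of the Dynkin diagram, the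
coordinates of its torus are \<open>2 \<epsilon>\<^sub>0\<close> (index 0) and \<open>\<epsilon>\<^sub>j - \<epsilon>\<^sub>0\<close>, so that \<open>ratio j\<close> is the character
\<open>\<epsilon>\<^sub>j - \<epsilon>\<^sub>0\<close> for every \<open>j\<close>, and \<open>reflected_ratio j\<close> is \<open>- \<epsilon>\<^sub>j - \<epsilon>\<^sub>0\<close>.\<close>

definition ratio :: "nat \<Rightarrow> pt \<Rightarrow> complex" where
  "ratio j x = (if j = 0 then 1 else x j)"

definition reflected_ratio :: "nat \<Rightarrow> pt \<Rightarrow> complex" where
  "reflected_ratio j x = inverse (x 0 * ratio j x)"

definition ratio_eq :: "nat \<Rightarrow> nat \<Rightarrow> nat \<Rightarrow> pt set" where
  "ratio_eq n i j = {x \<in> torus n. ratio i x = ratio j x}"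

definition ratio_inv :: "nat \<Rightarrow> nat \<Rightarrow> nat \<Rightarrow> pt set" where
  "ratio_inv n i j = {x \<in> torus n. x 0 * ratio i x * ratio j x = 1}"

lemma ratio_eq_commute: "ratio_eq n i j = ratio_eq n j i"
  by (auto simp: ratio_eq_def)

lemma ratio_inv_commute: "ratio_inv n i j = ratio_inv n j i"
  by (auto simp: ratio_inv_def mult_ac)

lemma ratio_truncate: "j < n \<Longrightarrow> ratio j (truncate n x) = ratio j x"
  by (simp add: ratio_def)

lemma ratio_nonzero: "x \<in> torus n \<Longrightarrow> ratio j x \<noteq> 0"
  by (simp add: ratio_def torus_nonzero)

lemma monomial_ratio: "monomial n (ratio j)"
  unfolding ratio_def by (cases "j = 0") (auto intro: monomial_intros)

lemma monomial_reflected_ratio: "monomial n (reflected_ratio j)"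
  unfolding reflected_ratio_def by (intro monomial_intros monomial_ratio)

lemma cyl_ratio:
  "i < n \<Longrightarrow> j < n \<Longrightarrow> cyl n (ratio_eq n i j) = ratio_eq (Suc n) i j"
  "i < n \<Longrightarrow> j < n \<Longrightarrow> cyl n (ratio_inv n i j) = ratio_inv (Suc n) i j"
  using truncate_in_torus[of _ "Suc n" n] by (auto simp: cyl_def ratio_eq_def ratio_inv_def ratio_truncate)

lemma eq_reflected_ratio_iff:
  assumes "x \<in> torus n"
  shows "z = reflected_ratio j x \<longleftrightarrow> x 0 * z * ratio j x = 1"
proof -
  have "x 0 * ratio j x \<noteq> 0" using torus_nonzero[OF assms] ratio_nonzero[OF assms] by simp
  then have "z = reflected_ratio j x \<longleftrightarrow> z * (x 0 * ratio j x) = 1"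
    unfolding reflected_ratio_def by (rule eq_inverse_iff)
  then show ?thesis by (simp only: mult_ac)
qed

lemma graph_ratio:
  assumes "j < n"
  shows "graph n (ratio j) = ratio_eq (Suc n) n j" "graph n (reflected_ratio j) = ratio_inv (Suc n) n j"
proof -
  have "ratio n x = x n" "reflected_ratio j (truncate n x) = reflected_ratio j x" for x
    using assms by (simp_all add: reflected_ratio_def ratio_def)
  then show "graph n (ratio j) = ratio_eq (Suc n) n j" "graph n (reflected_ratio j) = ratio_inv (Suc n) n j"
    using assms by (auto simp: graph_def ratio_eq_def ratio_inv_def ratio_truncate eq_reflected_ratio_iff)
qed

lemma agreement_ratio:
  "{u \<in> torus n. ratio i u = ratio j u} = ratio_eq n i j"
  "{u \<in> torus n. reflected_ratio i u = reflected_ratio j u} = ratio_eq n i j"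
  "{u \<in> torus n. ratio i u = reflected_ratio j u} = ratio_inv n i j"
proof -
  have "reflected_ratio i u = reflected_ratio j u \<longleftrightarrow> ratio i u = ratio j u" if "u \<in> torus n" for u
    using torus_nonzero[OF that] by (simp add: reflected_ratio_def)
  then show "{u \<in> torus n. reflected_ratio i u = reflected_ratio j u} = ratio_eq n i j"
    by (auto simp: ratio_eq_def)
qed (auto simp: ratio_eq_def ratio_inv_def eq_reflected_ratio_iff)

definition ratio_arr :: "nat \<Rightarrow> (nat \<Rightarrow> nat \<Rightarrow> bool) \<Rightarrow> (nat \<Rightarrow> nat \<Rightarrow> bool) \<Rightarrow> pt set set" where
  "ratio_arr n V W = {ratio_eq n i j |i j. i < n \<and> j < i \<and> V i j}
      \<union> {ratio_inv n i j |i j. i < n \<and> j \<le> i \<and> W i j}"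

lemma ratio_arr_eq: "i < n \<Longrightarrow> j < n \<Longrightarrow> i \<noteq> j \<Longrightarrow> V (max i j) (min i j) \<Longrightarrow> ratio_eq n i j \<in> ratio_arr n V W"
  unfolding ratio_arr_def by (cases "j < i") (auto simp: max_def min_def ratio_eq_commute[of n i j])

lemma ratio_arr_inv: "i < n \<Longrightarrow> j < n \<Longrightarrow> W (max i j) (min i j) \<Longrightarrow> ratio_inv n i j \<in> ratio_arr n V W"
  unfolding ratio_arr_def by (cases "j \<le> i") (auto simp: max_def min_def ratio_inv_commute[of n i j])

lemma ratio_arr_cong:
  assumes "\<And>i j. i < n \<Longrightarrow> j < i \<Longrightarrow> V i j \<longleftrightarrow> V' i j" "\<And>i j. i < n \<Longrightarrow> j \<le> i \<Longrightarrow> W i j \<longleftrightarrow> W' i j"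
  shows "ratio_arr n V W = ratio_arr n V' W'"
proof -
  have "{ratio_eq n i j |i j. i < n \<and> j < i \<and> V i j} = {ratio_eq n i j |i j. i < n \<and> j < i \<and> V' i j}"
    using assms(1) by blast
  moreover have "{ratio_inv n i j |i j. i < n \<and> j \<le> i \<and> W i j} = {ratio_inv n i j |i j. i < n \<and> j \<le> i \<and> W' i j}"
    using assms(2) by blast
  ultimately show ?thesis by (simp only: ratio_arr_def)
qed

lemma ratio_arr_Suc:
  assumes "\<not> W n n"
  shows "ratio_arr (Suc n) V W = cyl n ` ratio_arr n V W \<union>
    graph n ` set (map ratio (filter (V n) [0..<n]) @ map reflected_ratio (filter (W n) [0..<n]))"
proof -
  have "cyl n ` ratio_arr n V W = {ratio_eq (Suc n) i j |i j. i < n \<and> j < i \<and> V i j}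
      \<union> {ratio_inv (Suc n) i j |i j. i < n \<and> j \<le> i \<and> W i j}"
    unfolding ratio_arr_def image_Un by (intro arg_cong2[where f = "(\<union>)"]) (force simp: image_iff cyl_ratio)+
  moreover have "graph n ` set (map ratio (filter (V n) [0..<n]) @ map reflected_ratio (filter (W n) [0..<n]))
      = {ratio_eq (Suc n) n j |j. j < n \<and> V n j} \<union> {ratio_inv (Suc n) n j |j. j < n \<and> W n j}"
    unfolding set_append image_Un by (intro arg_cong2[where f = "(\<union>)"]) (force simp: image_iff graph_ratio)+
  moreover have "{ratio_eq (Suc n) i j |i j. i < Suc n \<and> j < i \<and> V i j}
      = {ratio_eq (Suc n) i j |i j. i < n \<and> j < i \<and> V i j} \<union> {ratio_eq (Suc n) n j |j. j < n \<and> V n j}"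
    by (auto simp: less_Suc_eq)
  moreover have "{ratio_inv (Suc n) i j |i j. i < Suc n \<and> j \<le> i \<and> W i j}
      = {ratio_inv (Suc n) i j |i j. i < n \<and> j \<le> i \<and> W i j} \<union> {ratio_inv (Suc n) n j |j. j < n \<and> W n j}"
    using assms by (auto simp: less_Suc_eq le_less)
  ultimately show ?thesis unfolding ratio_arr_def by (simp only: Un_ac)
qed

lemma inductive_exps_ratio_arr_Suc:
  assumes IH: "inductive_exps n (ratio_arr n V W) E" and no_loop: "\<not> W n n"
    and V: "\<And>i j. i < j \<Longrightarrow> j < n \<Longrightarrow> V n i \<and> V n j \<or> W n i \<and> W n j \<Longrightarrow> V j i"
    and W: "\<And>i j. i < n \<Longrightarrow> j < n \<Longrightarrow> V n i \<Longrightarrow> W n j \<Longrightarrow> W (max i j) (min i j)"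
  shows "inductive_exps (Suc n) (ratio_arr (Suc n) V W)
    (add_mset (card {j. j < n \<and> V n j} + card {j. j < n \<and> W n j}) E)"
proof -
  let ?D = "ratio_arr n V W"
    and ?fs = "map ratio (filter (V n) [0..<n]) @ map reflected_ratio (filter (W n) [0..<n])"
  have "sorted_wrt (meet_over n ?D) ?fs"
    unfolding sorted_wrt_append
  proof (intro conjI ballI)
    show "sorted_wrt (meet_over n ?D) (map ratio (filter (V n) [0..<n]))"
      using V by (intro sorted_wrt_map_filter_upt meet_over_member[OF IH])
        (simp add: agreement_ratio ratio_arr_eq)
    show "sorted_wrt (meet_over n ?D) (map reflected_ratio (filter (W n) [0..<n]))"
      using V by (intro sorted_wrt_map_filter_upt meet_over_member[OF IH])
        (simp add: agreement_ratio ratio_arr_eq)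
    fix f g assume "f \<in> set (map ratio (filter (V n) [0..<n]))"
      "g \<in> set (map reflected_ratio (filter (W n) [0..<n]))"
    then show "meet_over n ?D f g"
      using W by (intro meet_over_member[OF IH]) (auto simp: agreement_ratio ratio_arr_inv)
  qed
  moreover have "\<forall>f\<in>set ?fs. monomial n f" using monomial_ratio monomial_reflected_ratio by auto
  moreover have "length ?fs = card {j. j < n \<and> V n j} + card {j. j < n \<and> W n j}"
    by (simp add: distinct_length_filter Int_def conj_commute)
  ultimately show ?thesis
    using inductive_exps_graphs[OF IH, of ?fs] by (simp only: ratio_arr_Suc[of W n V, OF no_loop])
qed

text \<open>On the hypertorus \<open>2 \<epsilon>\<^sub>n = 1\<close> one may normalise \<open>\<epsilon>\<^sub>n = 1\<close>, after which all \<open>\<epsilon>\<^sub>j\<close> are coordinates.\<close>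

definition loop_aut :: "nat \<Rightarrow> pt \<Rightarrow> pt" where
  "loop_aut n x = (\<lambda>i. if i = 0 then x 0 ^ 2 * x n else if i < n then x i / x 0
    else if i = n then inverse (x 0) else 1)"

definition loop_aut_inverse :: "nat \<Rightarrow> pt \<Rightarrow> pt" where
  "loop_aut_inverse n y = (\<lambda>i. if i = 0 then inverse (y n) else if i < n then y i / y n
    else if i = n then y 0 * y n ^ 2 else 1)"

lemma monomial_power2: "monomial n f \<Longrightarrow> monomial n (\<lambda>t. (f t)\<^sup>2)"
  unfolding power2_eq_square by (rule monomial_mult)

lemma loop_aut_cancel:
  assumes "0 < n" "t \<in> torus (Suc n)"
  shows "loop_aut_inverse n (loop_aut n t) = t" "loop_aut n (loop_aut_inverse n t) = t"
  using assms(1) torus_nonzero[OF assms(2)] torus_outside[OF assms(2)]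
  by (auto simp: loop_aut_def loop_aut_inverse_def fun_eq_iff power2_eq_square field_simps)

lemma monomial_aut_loop_aut:
  assumes n: "0 < n"
  shows "monomial_aut (Suc n) (loop_aut n)"
proof (rule monomial_autI)
  show "monomial_map (Suc n) (Suc n) (loop_aut n)"
  proof (rule monomial_mapI)
    fix i assume "i < Suc n"
    then consider "i = 0" | "i \<noteq> 0" "i < n" | "i \<noteq> 0" "i = n" by linarith
    then show "monomial (Suc n) (\<lambda>t. loop_aut n t i)"
      by cases (simp_all add: loop_aut_def monomial_power2 monomial_intros)
  qed (simp add: loop_aut_def)
  show "monomial_map (Suc n) (Suc n) (loop_aut_inverse n)"
  proof (rule monomial_mapI)
    fix i assume "i < Suc n"
    then consider "i = 0" | "i \<noteq> 0" "i < n" | "i \<noteq> 0" "i = n" by linarith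
    then show "monomial (Suc n) (\<lambda>t. loop_aut_inverse n t i)"
      by cases (simp_all add: loop_aut_inverse_def monomial_power2 monomial_intros)
  qed (simp add: loop_aut_inverse_def)
qed (use loop_aut_cancel[OF n] in auto)

lemma ratio_loop_aut:
  assumes "x \<in> torus (Suc n)" "0 < n"
  shows "i < n \<Longrightarrow> ratio i (loop_aut n x) = x i / x 0" "ratio n (loop_aut n x) = inverse (x 0)"
    "loop_aut n x 0 = (x 0)\<^sup>2 * x n" "loop_aut n x \<in> torus (Suc n)"
  using torus_nonzero[OF assms(1)] assms(2) monomial_aut_in[OF monomial_aut_loop_aut assms(1)]
  by (auto simp: ratio_def loop_aut_def)

lemma loop_aut_preimage:
  assumes n: "0 < n"
  shows "i < n \<Longrightarrow> j < n \<Longrightarrow> {u \<in> torus n. loop_aut n u \<in> ratio_eq (Suc n) i j} = hyp_eq n i j"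
    "j < n \<Longrightarrow> {u \<in> torus n. loop_aut n u \<in> ratio_eq (Suc n) n j} = hyp_const n 1 j"
    "i < n \<Longrightarrow> j < n \<Longrightarrow> {u \<in> torus n. loop_aut n u \<in> ratio_inv (Suc n) i j} = hyp_inv n i j"
    "j < n \<Longrightarrow> {u \<in> torus n. loop_aut n u \<in> ratio_inv (Suc n) n j} = hyp_const n 1 j"
proof -
  have u: "u \<in> torus (Suc n)" "u n = 1" "u 0 \<noteq> 0" if "u \<in> torus n" for u
    using torus_iff_Suc[of u n] torus_nonzero[OF that] that by auto
  show "i < n \<Longrightarrow> j < n \<Longrightarrow> {u \<in> torus n. loop_aut n u \<in> ratio_eq (Suc n) i j} = hyp_eq n i j"
    "j < n \<Longrightarrow> {u \<in> torus n. loop_aut n u \<in> ratio_eq (Suc n) n j} = hyp_const n 1 j"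
    "i < n \<Longrightarrow> j < n \<Longrightarrow> {u \<in> torus n. loop_aut n u \<in> ratio_inv (Suc n) i j} = hyp_inv n i j"
    "j < n \<Longrightarrow> {u \<in> torus n. loop_aut n u \<in> ratio_inv (Suc n) n j} = hyp_const n 1 j"
    by (auto simp: u ratio_loop_aut[OF u(1) n] ratio_eq_def ratio_inv_def hyp_eq_def hyp_const_def hyp_inv_def
        power2_eq_square field_simps)
qed

lemma loop_aut_image:
  assumes n: "0 < n"
  shows "loop_aut n ` torus n = ratio_inv (Suc n) n n"
proof -
  have "loop_aut n x \<in> ratio_inv (Suc n) n n \<longleftrightarrow> x n = 1" if "x \<in> torus (Suc n)" for x
    using torus_nonzero[OF that, of 0]
    by (simp add: ratio_inv_def ratio_loop_aut[OF that n] power2_eq_square field_simps)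
  moreover have "ratio_inv (Suc n) n n \<subseteq> loop_aut n ` torus (Suc n)"
    unfolding monomial_aut_image[OF monomial_aut_loop_aut[OF n]] by (auto simp: ratio_inv_def)
  ultimately show ?thesis using torus_iff_Suc by blast
qed

abbreviation full :: "nat \<Rightarrow> nat \<Rightarrow> bool" where
  "full \<equiv> \<lambda>_ _. True"

lemma ratio_arr_restriction:
  assumes n: "0 < n" and no_loop: "\<And>i j. W i j \<longleftrightarrow> \<not> (i = n \<and> j = n)"
  shows "(\<Union>K\<in>ratio_arr (Suc n) full W. components {u \<in> torus n. loop_aut n u \<in> K}) = shifted_arr n n full"
proof -
  let ?res = "\<lambda>K. components {u \<in> torus n. loop_aut n u \<in> K}"
  have "shifted full" by (simp add: shifted_def)
  from inductive_expsD(3)[OF inductive_exps_shifted_arr[OF this order_refl]]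
  have single: "components K = {K}" if "K \<in> shifted_arr n n full" for K
    using components_torsion_coset that by blast
  have "components (hyp_eq n i j) = {hyp_eq n i j}" if "i < n" "j < i" for i j
    using that by (intro single signed_arr_eq) auto
  moreover have "components (hyp_const n 1 i) = {hyp_const n 1 i}" if "i < n" for i
    using that by (intro single signed_arr_const) auto
  moreover have "components (hyp_inv n i j) = {hyp_inv n i j}" if "i < n" "j < i" for i j
    using that by (intro single signed_arr_inv) auto
  ultimately have res: "i < n \<Longrightarrow> j < i \<Longrightarrow> ?res (ratio_eq (Suc n) i j) = {hyp_eq n i j}"
    "i < n \<Longrightarrow> j < i \<Longrightarrow> ?res (ratio_inv (Suc n) i j) = {hyp_inv n i j}"
    "i < n \<Longrightarrow> ?res (ratio_inv (Suc n) i i) = {hyp_const n 1 i, hyp_const n (-1) i}"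
    "i < n \<Longrightarrow> ?res (ratio_eq (Suc n) n i) = {hyp_const n 1 i}"
    "i < n \<Longrightarrow> ?res (ratio_inv (Suc n) n i) = {hyp_const n 1 i}" for i j
    by (simp_all add: loop_aut_preimage[OF n] components_self_inverse)
  have "ratio_arr (Suc n) full W = (\<Union>i<n. ratio_eq (Suc n) i ` {..<i} \<union> ratio_inv (Suc n) i ` {..<i}
      \<union> {ratio_inv (Suc n) i i, ratio_eq (Suc n) n i, ratio_inv (Suc n) n i})"
    unfolding ratio_arr_def no_loop by (auto simp: less_Suc_eq le_less)
  then have "(\<Union>K\<in>ratio_arr (Suc n) full W. ?res K)
      = (\<Union>i<n. (\<Union>j<i. ?res (ratio_eq (Suc n) i j)) \<union> (\<Union>j<i. ?res (ratio_inv (Suc n) i j))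
      \<union> (?res (ratio_inv (Suc n) i i) \<union> (?res (ratio_eq (Suc n) n i) \<union> ?res (ratio_inv (Suc n) n i))))"
    by (simp only: UN_UN_flatten UN_Un UN_insert UN_empty Un_empty_right image_image)
  also have "\<dots> = (\<Union>i<n. (\<Union>j<i. {hyp_eq n i j}) \<union> (\<Union>j<i. {hyp_inv n i j})
      \<union> {hyp_const n 1 i, hyp_const n (-1) i})"
    by (intro SUP_cong refl) (auto simp: res)
  finally show ?thesis by (auto simp: signed_arr_def)
qed

lemma inductive_exps_ratio_arr_full:
  "inductive_exps (Suc n) (ratio_arr (Suc n) full full) (add_mset (Suc n) (shifted_exps full n n))"
proof (induction n)
  case 0
  have "ratio_inv (Suc 0) 0 0 = hyp_const (Suc 0) 1 0" by (auto simp: ratio_inv_def hyp_const_def ratio_def)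
  then have "ratio_arr (Suc 0) full full = shifted_arr (Suc 0) 0 full"
    by (auto simp: ratio_arr_def signed_arr_def)
  moreover have "shifted full" by (simp add: shifted_def)
  ultimately show ?case using inductive_exps_shifted_arr[of full 0 "Suc 0"] by (simp add: lower_degree_def)
next
  case (Suc k)
  define n where "n = Suc k"
  have n: "0 < n" by (simp add: n_def)
  define W where "W i j \<longleftrightarrow> \<not> (i = n \<and> j = n)" for i j
  have lower: "ratio_arr n full W = ratio_arr n full full" by (rule ratio_arr_cong) (simp_all add: W_def)
  have "inductive_exps (Suc n) (ratio_arr (Suc n) full W)
      (add_mset (card {j. j < n \<and> True} + card {j. j < n \<and> W n j}) (add_mset n (shifted_exps full k k)))"
    by (rule inductive_exps_ratio_arr_Suc) (use Suc in \<open>auto simp: lower n_def[symmetric] W_def\<close>)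
  moreover have "{j. j < n \<and> W n j} = {..<n}" by (auto simp: W_def)
  moreover have "shifted_exps full n n = add_mset (n + n) (shifted_exps full k k)"
    by (simp add: n_def lower_degree_def)
  ultimately have deletion:
    "inductive_exps (Suc n) (ratio_arr (Suc n) full W) (add_mset n (shifted_exps full n n))"
    by (simp add: add_mset_commute)
  have "shifted full" by (simp add: shifted_def)
  then have restriction:
    "inductive_exps n (\<Union>K\<in>ratio_arr (Suc n) full W. components {u \<in> torus n. loop_aut n u \<in> K})
    (shifted_exps full n n)"
    unfolding ratio_arr_restriction[OF n W_def] by (rule inductive_exps_shifted_arr) simp
  have "insert (ratio_inv (Suc n) n n) (ratio_arr (Suc n) full W) = ratio_arr (Suc n) full full"
    unfolding ratio_arr_def W_def by auto
  then show ?case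
    using inductive_exps_insert[OF monomial_aut_loop_aut[OF n] deletion restriction]
    unfolding n_def[symmetric] by (simp only: loop_aut_image[OF n])
qed

theorem inductive_exps_ratio_arr:
  assumes V: "\<And>i j i' j'. V i j \<Longrightarrow> j \<le> j' \<Longrightarrow> j' < i' \<Longrightarrow> i' \<le> i \<Longrightarrow> V i' j'"
    and W: "\<And>i j i' j'. W i j \<Longrightarrow> i' \<le> i \<Longrightarrow> j' \<le> j \<Longrightarrow> W i' j'" "\<And>i j j'. W i j \<Longrightarrow> j' < i \<Longrightarrow> V i j'"
  shows "\<exists>E. inductive_exps n (ratio_arr n V W) E"
proof (induction n)
  case 0
  have "ratio_arr 0 V W = {}" by (simp add: ratio_arr_def)
  then show ?case using inductive_exps_empty by metis
next
  case (Suc n)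
  show ?case
  proof (cases "W n n")
    case True
    have "ratio_arr (Suc n) V W = ratio_arr (Suc n) full full"
    proof (rule ratio_arr_cong)
      show "W i j \<longleftrightarrow> True" if "i < Suc n" "j \<le> i" for i j using W(1)[OF True] that by simp
      then show "V i j \<longleftrightarrow> True" if "i < Suc n" "j < i" for i j using W(2)[of i j j] that by simp
    qed
    then show ?thesis using inductive_exps_ratio_arr_full by metis
  next
    case False
    obtain E where "inductive_exps n (ratio_arr n V W) E" using Suc by blast
    then have "inductive_exps (Suc n) (ratio_arr (Suc n) V W)
        (add_mset (card {j. j < n \<and> V n j} + card {j. j < n \<and> W n j}) E)"
    proof (rule inductive_exps_ratio_arr_Suc)
      show "\<not> W n n" by (rule False)
      show "V j i" if "i < j" "j < n" "V n i \<and> V n j \<or> W n i \<and> W n j" for i j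
        using V[of n i] W(2)[of n] that by auto
      show "W (max i j) (min i j)" if "i < n" "j < n" "W n j" for i j
        using W(1)[OF that(3)] that by simp
    qed
    then show ?thesis by blast
  qed
qed

section \<open>Ideals of positive roots\<close>

definition hyp_pullback :: "nat \<Rightarrow> (pt \<Rightarrow> pt) \<Rightarrow> lat \<Rightarrow> pt set" where
  "hyp_pullback l \<phi> b = {x \<in> torus l. chr l b (\<phi> x) = 1}"

lemma inductive_toric_arr:
  assumes \<phi>: "monomial_aut l \<phi>" and exps: "inductive_exps l (hyp_pullback l \<phi> ` I) E"
  shows "inductive_arr l (torus l) (toric_arr l I)"
proof -
  have hyp: "hyp l b 1 = \<phi> ` hyp_pullback l \<phi> b" for b
    using monomial_aut_image[OF \<phi>] by (auto simp: hyp_def hyp_pullback_def)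
  have "components (hyp l b 1) = {hyp l b 1}" if "b \<in> I" for b
    unfolding hyp
    by (rule components_torsion_coset[OF torsion_coset_image[OF \<phi> inductive_expsD(3)[OF exps] order_refl]])
      (use that in simp)
  then have "toric_arr l I = (\<lambda>b. hyp l b 1) ` I" by (auto simp: toric_arr_def)
  then have "toric_arr l I = (`) \<phi> ` hyp_pullback l \<phi> ` I" by (simp only: hyp image_image)
  then show ?thesis using inductive_expsD(1)[OF inductive_exps_aut[OF exps \<phi>]] by simp
qed

lemma chr_diff: "t \<in> torus n \<Longrightarrow> chr n (\<lambda>i. a i - b i) t = chr n a t / chr n b t"
  by (simp add: chr_def power_int_diff torus_nonzero prod_dividef)

lemma chr_seg: "j \<le> l \<Longrightarrow> chr l (seg i j) t = (\<Prod>k=i..<j. t k)"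
proof -
  assume "j \<le> l"
  then have "(\<Prod>k=i..<j. t k) = (\<Prod>k\<in>{..<l}. if k \<in> {i..<j} then t k else 1)"
    by (subst prod.inter_restrict[symmetric]) (auto intro: prod.cong)
  then show ?thesis by (auto simp: chr_def seg_def intro: prod.cong)
qed

definition quotients :: "pt \<Rightarrow> pt" where
  "quotients x = (\<lambda>i. x i / x (Suc i))"

lemma prod_quotients:
  assumes "x \<in> torus n" "i \<le> j"
  shows "(\<Prod>k=i..<j. quotients x k) = x i / x j"
  using assms(2) by (induction j rule: dec_induct) (simp_all add: quotients_def torus_nonzero[OF assms(1)])

lemma monomial_aut_quotients: "monomial_aut n quotients"
proof (rule monomial_autI)
  show "monomial_map n n quotients"
    by (rule monomial_mapI) (auto simp: quotients_def torus_outside intro: monomial_intros)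
  show "monomial_map n n (\<lambda>t i. \<Prod>k=i..<n. t k)"
    by (rule monomial_mapI) (auto intro: monomial_intros)
  fix t assume t: "t \<in> torus n"
  show "(\<lambda>i. \<Prod>k=i..<n. quotients t k) = t"
  proof
    fix i show "(\<Prod>k=i..<n. quotients t k) = t i"
      using prod_quotients[OF t, of i n] torus_outside[OF t] by (cases "i \<le> n") auto
  qed
  show "quotients (\<lambda>i. \<Prod>k=i..<n. t k) = t"
  proof
    fix i show "quotients (\<lambda>i. \<Prod>k=i..<n. t k) i = t i"
    proof (cases "i < n")
      case True
      then show ?thesis
        using torus_nonzero[OF t] by (simp add: quotients_def prod.atLeast_Suc_lessThan)
    qed (simp add: quotients_def torus_outside[OF t])
  qed
qed

text \<open>In type B (\<open>m = l\<close>) the coordinates of \<open>x\<close> are the values of the \<open>\<epsilon>\<^sub>r\<close>, numbered from the end of the Dynkin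
diagram. In type C (\<open>m = l - 1\<close>) they are those of \<open>2 \<epsilon>\<^sub>0\<close> and \<open>\<epsilon>\<^sub>r - \<epsilon>\<^sub>0\<close>.\<close>

definition root_coords :: "nat \<Rightarrow> nat \<Rightarrow> pt \<Rightarrow> pt" where
  "root_coords l m x = extend m quotients (x \<circ> (\<lambda>i. if i < l then l - 1 - i else i))"

lemma reversal_permutes: "(\<lambda>i. if i < l then l - 1 - i else i) permutes {..<l :: nat}"
proof (rule bij_imp_permutes)
  show "bij_betw (\<lambda>i. if i < l then l - 1 - i else i) {..<l} {..<l}"
    by (rule bij_betw_byWitness[where f' = "\<lambda>i. l - 1 - i"]) (auto simp: less_imp_diff_less)
qed simp

lemma monomial_aut_root_coords: "m \<le> l \<Longrightarrow> monomial_aut l (root_coords l m)"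
  using monomial_aut_comp[OF monomial_aut_extend[OF monomial_aut_quotients]
    monomial_aut_permute[OF reversal_permutes], of m l]
  by (simp add: o_def root_coords_def [abs_def])

definition eps :: "nat \<Rightarrow> nat \<Rightarrow> nat \<Rightarrow> lat" where
  "eps l m r = seg (l - 1 - r) m"

lemma chr_eps:
  assumes "x \<in> torus l" "m \<le> l" "r < l" "l - 1 - r \<le> m"
  shows "chr l (eps l m r) (root_coords l m x) = (if l - 1 - r < m then x r else 1)"
proof -
  let ?y = "x \<circ> (\<lambda>i. if i < l then l - 1 - i else i)"
  have "?y \<in> torus l" using monomial_aut_in[OF monomial_aut_permute[OF reversal_permutes] assms(1)] .
  then have "(\<Prod>k=l-1-r..<m. quotients (truncate m ?y) k) = truncate m ?y (l - 1 - r)"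
    using prod_quotients[OF truncate_in_torus assms(4), of ?y l m] by simp
  then show ?thesis using assms(2,3) by (simp add: eps_def chr_seg root_coords_def extend_def)
qed

lemma chr_eps_last:
  assumes "1 \<le> l"
  shows "chr l (eps l l 0) (root_coords l (l - 1) x) = x 0"
proof -
  have "{l - 1..<l} = {l - 1}" using assms by auto
  then show ?thesis using assms by (simp add: eps_def chr_seg root_coords_def extend_def)
qed

lemma eps_mono: "r \<le> r' \<Longrightarrow> eps l m r k \<le> eps l m r' k"
  by (auto simp: eps_def seg_def)

lemma eps_nonneg: "0 \<le> eps l m r k"
  by (simp add: eps_def seg_def)

lemma seg_split: "i \<le> j \<Longrightarrow> j \<le> m \<Longrightarrow> seg i m k = seg i j k + seg j m k"
  by (auto simp: seg_def)

abbreviation diff_root :: "nat \<Rightarrow> nat \<Rightarrow> nat \<Rightarrow> nat \<Rightarrow> lat" where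
  "diff_root l m r j \<equiv> \<lambda>k. eps l m r k - eps l m j k"

abbreviation sum_root_B :: "nat \<Rightarrow> nat \<Rightarrow> nat \<Rightarrow> lat" where
  "sum_root_B l r j \<equiv> \<lambda>k. eps l l r k + eps l l j k"

abbreviation sum_root_C :: "nat \<Rightarrow> nat \<Rightarrow> nat \<Rightarrow> lat" where
  "sum_root_C l r j \<equiv> \<lambda>k. eps l (l - 1) r k + eps l (l - 1) j k + eps l l 0 k"

lemma Collect_reverse:
  fixes l :: nat
  assumes "\<And>r. r < l \<Longrightarrow> f (l - 1 - r) = g r"
  shows "{f i |i. i < l} = {g r |r. r < l}"
proof -
  have "f i = g (l - 1 - i) \<and> l - 1 - i < l" if "i < l" for i using assms[of "l - 1 - i"] that by simp
  moreover have "g r = f (l - 1 - r) \<and> l - 1 - r < l" if "r < l" for r using assms that by simp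
  ultimately show ?thesis by blast
qed

lemma Collect_reverse_pairs:
  fixes l :: nat
  assumes "\<And>r j. r < l \<Longrightarrow> j < r \<Longrightarrow> f (l - 1 - r) (l - 1 - j) = g r j"
  shows "{f i j |i j. i < j \<and> j < l} = {g r j |r j. r < l \<and> j < r}"
proof -
  have "f i j = g (l - 1 - i) (l - 1 - j) \<and> l - 1 - i < l \<and> l - 1 - j < l - 1 - i" if "i < j" "j < l" for i j
    using assms[of "l - 1 - i" "l - 1 - j"] that by simp
  moreover have "g r j = f (l - 1 - r) (l - 1 - j) \<and> l - 1 - r < l - 1 - j \<and> l - 1 - j < l"
    if "r < l" "j < r" for r j
    using assms[OF that] that by auto
  ultimately show ?thesis by blast
qed

lemma seg_eq_diff_root:
  assumes "r < l" "j < r" "l - 1 - j \<le> m"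
  shows "seg (l - 1 - r) (l - 1 - j) = diff_root l m r j"
  using seg_split[OF _ assms(3), of "l - 1 - r"] assms by (simp add: eps_def fun_eq_iff)

lemma pos_roots_B:
  "pos_roots TB l = {eps l l r |r. r < l} \<union> {diff_root l l r j |r j. r < l \<and> j < r}
      \<union> {sum_root_B l r j |r j. r < l \<and> j < r}"
proof -
  have "{seg i j |i j. i < j \<and> j \<le> l} = {seg i l |i. i < l} \<union> {seg i j |i j. i < j \<and> j < l}"
    by (auto simp: le_less)
  also have "{seg i l |i. i < l} = {eps l l r |r. r < l}"
    by (rule Collect_reverse) (simp add: eps_def)
  also have "{seg i j |i j. i < j \<and> j < l} = {diff_root l l r j |r j. r < l \<and> j < r}"
    by (intro Collect_reverse_pairs seg_eq_diff_root) simp_all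
  finally have short: "{seg i j |i j. i < j \<and> j \<le> l} = {eps l l r |r. r < l}
      \<union> {diff_root l l r j |r j. r < l \<and> j < r}" .
  have "{\<lambda>k. seg i j k + 2 * seg j l k |i j. i < j \<and> j < l} = {sum_root_B l r j |r j. r < l \<and> j < r}"
  proof (rule Collect_reverse_pairs)
    show "(\<lambda>k. seg (l - 1 - r) (l - 1 - j) k + 2 * seg (l - 1 - j) l k) = sum_root_B l r j"
      if "r < l" "j < r" for r j
      using seg_split[of "l - 1 - r" "l - 1 - j" l] that by (simp add: eps_def fun_eq_iff)
  qed
  then show ?thesis by (simp only: pos_roots.simps short)
qed

lemma hyp_pullback_B:
  assumes "r < l"
  shows "hyp_pullback l (root_coords l l) (eps l l r) = hyp_const l 1 r"
    "j < r \<Longrightarrow> hyp_pullback l (root_coords l l) (diff_root l l r j) = hyp_eq l r j"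
    "j < r \<Longrightarrow> hyp_pullback l (root_coords l l) (sum_root_B l r j) = hyp_inv l r j"
proof -
  have coords: "root_coords l l x \<in> torus l" "i < l \<Longrightarrow> chr l (eps l l i) (root_coords l l x) = x i"
    if "x \<in> torus l" for x i
    using monomial_aut_in[OF monomial_aut_root_coords[OF order_refl] that] chr_eps[OF that order_refl, of i]
      by auto
  show "hyp_pullback l (root_coords l l) (eps l l r) = hyp_const l 1 r"
    "j < r \<Longrightarrow> hyp_pullback l (root_coords l l) (diff_root l l r j) = hyp_eq l r j"
    "j < r \<Longrightarrow> hyp_pullback l (root_coords l l) (sum_root_B l r j) = hyp_inv l r j"
    using assms by (auto simp: hyp_pullback_def hyp_const_def hyp_eq_def hyp_inv_def chr_add chr_diff coords
      torus_nonzero)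
qed

lemma hyp_pullback_image_B:
  assumes J: "J \<subseteq> pos_roots TB l"
    and "\<And>r. r < l \<Longrightarrow> P r \<longleftrightarrow> eps l l r \<in> J"
    and "\<And>r j. r < l \<Longrightarrow> j < r \<Longrightarrow> V r j \<longleftrightarrow> diff_root l l r j \<in> J"
    and "\<And>r j. r < l \<Longrightarrow> j < r \<Longrightarrow> W r j \<longleftrightarrow> sum_root_B l r j \<in> J"
  shows "hyp_pullback l (root_coords l l) ` J = signed_arr l P (\<lambda>_. False) V W"
proof -
  have "J = pos_roots TB l \<inter> J" using J by blast
  also have "\<dots> = {eps l l r |r. r < l \<and> P r} \<union> {diff_root l l r j |r j. r < l \<and> j < r \<and> V r j}
      \<union> {sum_root_B l r j |r j. r < l \<and> j < r \<and> W r j}"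
    unfolding pos_roots_B Int_Un_distrib2 by (intro arg_cong2[where f = "(\<union>)"]; use assms(2-4) in blast)
  finally have J: "J = {eps l l r |r. r < l \<and> P r} \<union> {diff_root l l r j |r j. r < l \<and> j < r \<and> V r j}
      \<union> {sum_root_B l r j |r j. r < l \<and> j < r \<and> W r j}" .
  have "hyp_pullback l (root_coords l l) ` {eps l l r |r. r < l \<and> P r} = {hyp_const l 1 r |r. r < l \<and> P r}"
    "hyp_pullback l (root_coords l l) ` {diff_root l l r j |r j. r < l \<and> j < r \<and> V r j}
      = {hyp_eq l r j |r j. r < l \<and> j < r \<and> V r j}"
    "hyp_pullback l (root_coords l l) ` {sum_root_B l r j |r j. r < l \<and> j < r \<and> W r j}
      = {hyp_inv l r j |r j. r < l \<and> j < r \<and> W r j}"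
    by (force simp: image_iff hyp_pullback_B)+
  then show ?thesis unfolding J by (simp add: signed_arr_def image_Un)
qed

lemma is_idealD: "is_ideal R J \<Longrightarrow> b1 \<in> J \<Longrightarrow> b2 \<in> R \<Longrightarrow> (\<And>k. b2 k \<le> b1 k) \<Longrightarrow> b2 \<in> J"
  unfolding is_ideal_def root_le_def by blast

lemma is_ideal_subset: "is_ideal R J \<Longrightarrow> J \<subseteq> R"
  by (simp add: is_ideal_def)

lemma inductive_exps_ideal_B:
  assumes J: "is_ideal (pos_roots TB l) J"
  shows "\<exists>E. inductive_exps l (hyp_pullback l (root_coords l l) ` J) E"
proof -
  define P where "P r \<longleftrightarrow> r < l \<and> eps l l r \<in> J" for r
  define V where "V r j \<longleftrightarrow> r < l \<and> j < r \<and> diff_root l l r j \<in> J" for r j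
  define W where "W r j \<longleftrightarrow> r < l \<and> j < r \<and> sum_root_B l r j \<in> J" for r j
  have roots: "r < l \<Longrightarrow> eps l l r \<in> pos_roots TB l" "r < l \<Longrightarrow> j < r \<Longrightarrow> diff_root l l r j \<in> pos_roots TB l"
    "r < l \<Longrightarrow> j < r \<Longrightarrow> sum_root_B l r j \<in> pos_roots TB l" for r j
    unfolding pos_roots_B by blast+
  note smaller = is_idealD[OF J] and order = eps_mono eps_nonneg
  have "\<exists>E. inductive_exps l (signed_arr l P (\<lambda>_. False) V W) E"
  proof (rule inductive_exps_signed_arr)
    show "P r'" if "P r" "r' \<le> r" for r r'
      using that smaller[OF _ roots(1), of "eps l l r" r'] by (auto simp: P_def order)
    show "V r j" if "P r" "j < r" for r j
      using that smaller[OF _ roots(2), of "eps l l r" r j] by (auto simp: P_def V_def order)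
    show "V r' j'" if "V r j" "j \<le> j'" "j' < r'" "r' \<le> r" for r j r' j'
      using that smaller[OF _ roots(2), of "diff_root l l r j" r' j'] by (auto simp: V_def order diff_mono)
    show "shifted W"
      unfolding shifted_def
    proof (intro allI impI)
      fix r j r' j' assume "W r j" "r' \<le> r" "j' \<le> j" "j' < r'"
      then show "W r' j'"
        using smaller[OF _ roots(3), of "sum_root_B l r j" r' j'] by (auto simp: W_def order add_mono)
    qed
    show "P r" if "W r j" for r j
      using that smaller[OF _ roots(1), of "sum_root_B l r j" r] by (auto simp: P_def W_def order)
  qed
  moreover have "hyp_pullback l (root_coords l l) ` J = signed_arr l P (\<lambda>_. False) V W"
    using is_ideal_subset[OF J] by (rule hyp_pullback_image_B) (simp_all add: P_def V_def W_def)
  ultimately show ?thesis by simp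
qed

lemma pos_roots_C:
  assumes "1 \<le> l"
  shows "pos_roots TC l = {diff_root l (l - 1) r j |r j. r < l \<and> j < r}
      \<union> {sum_root_C l r j |r j. r < l \<and> j \<le> r}"
proof -
  have last: "seg (l - 1) l = eps l l 0" by (simp add: eps_def)
  have short: "{seg i j |i j. i < j \<and> j < l} = {diff_root l (l - 1) r j |r j. r < l \<and> j < r}"
    by (intro Collect_reverse_pairs seg_eq_diff_root) simp_all
  have long: "{\<lambda>k. 2 * seg i (l - 1) k + seg (l - 1) l k |i. i < l} = {sum_root_C l r r |r. r < l}"
    unfolding last by (rule Collect_reverse) (simp add: eps_def fun_eq_iff)
  have "{\<lambda>k. seg i j k + 2 * seg j (l - 1) k + seg (l - 1) l k |i j. i < j \<and> j < l}
      = {sum_root_C l r j |r j. r < l \<and> j < r}"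
    unfolding last
  proof (rule Collect_reverse_pairs)
    show "(\<lambda>k. seg (l - 1 - r) (l - 1 - j) k + 2 * seg (l - 1 - j) (l - 1) k + eps l l 0 k) = sum_root_C l r j"
      if "r < l" "j < r" for r j
      using seg_split[of "l - 1 - r" "l - 1 - j" "l - 1"] that by (simp add: eps_def fun_eq_iff)
  qed
  then have "pos_roots TC l = {diff_root l (l - 1) r j |r j. r < l \<and> j < r} \<union> {sum_root_C l r r |r. r < l}
      \<union> {sum_root_C l r j |r j. r < l \<and> j < r}"
    by (simp only: pos_roots.simps short long)
  moreover have "{sum_root_C l r j |r j. r < l \<and> j \<le> r} = {sum_root_C l r r |r. r < l}
      \<union> {sum_root_C l r j |r j. r < l \<and> j < r}"
    unfolding le_less by blast
  ultimately show ?thesis by (simp only: Un_assoc)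
qed

lemma hyp_pullback_C:
  assumes "r < l"
  shows "j < r \<Longrightarrow> hyp_pullback l (root_coords l (l - 1)) (diff_root l (l - 1) r j) = ratio_eq l r j"
    "j \<le> r \<Longrightarrow> hyp_pullback l (root_coords l (l - 1)) (sum_root_C l r j) = ratio_inv l r j"
proof -
  let ?\<phi> = "root_coords l (l - 1)"
  have coords: "?\<phi> x \<in> torus l" "i < l \<Longrightarrow> chr l (eps l (l - 1) i) (?\<phi> x) = ratio i x"
    if "x \<in> torus l" for x i
    using monomial_aut_in[OF monomial_aut_root_coords that, of "l - 1"] chr_eps[OF that, of "l - 1" i]
      by (auto simp: ratio_def)
  have "chr l (eps l l 0) (?\<phi> x) = x 0" for x using chr_eps_last assms by simp
  then show "j < r \<Longrightarrow> hyp_pullback l ?\<phi> (diff_root l (l - 1) r j) = ratio_eq l r j"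
    "j \<le> r \<Longrightarrow> hyp_pullback l ?\<phi> (sum_root_C l r j) = ratio_inv l r j"
    using assms by (auto simp: hyp_pullback_def ratio_eq_def ratio_inv_def chr_add chr_diff coords
        ratio_nonzero ac_simps simp del: One_nat_def)
qed

lemma hyp_pullback_image_C:
  assumes J: "J \<subseteq> pos_roots TC l" and l: "1 \<le> l"
    and "\<And>r j. r < l \<Longrightarrow> j < r \<Longrightarrow> V r j \<longleftrightarrow> diff_root l (l - 1) r j \<in> J"
    and "\<And>r j. r < l \<Longrightarrow> j \<le> r \<Longrightarrow> W r j \<longleftrightarrow> sum_root_C l r j \<in> J"
  shows "hyp_pullback l (root_coords l (l - 1)) ` J = ratio_arr l V W"
proof -
  have "J = pos_roots TC l \<inter> J" using J by blast
  also have "\<dots> = {diff_root l (l - 1) r j |r j. r < l \<and> j < r \<and> V r j}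
      \<union> {sum_root_C l r j |r j. r < l \<and> j \<le> r \<and> W r j}"
    unfolding pos_roots_C[OF l] Int_Un_distrib2 by (intro arg_cong2[where f = "(\<union>)"]; use assms(3,4) in blast)
  finally have J: "J = {diff_root l (l - 1) r j |r j. r < l \<and> j < r \<and> V r j}
      \<union> {sum_root_C l r j |r j. r < l \<and> j \<le> r \<and> W r j}" .
  have "hyp_pullback l (root_coords l (l - 1)) ` {diff_root l (l - 1) r j |r j. r < l \<and> j < r \<and> V r j}
      = {ratio_eq l r j |r j. r < l \<and> j < r \<and> V r j}"
    "hyp_pullback l (root_coords l (l - 1)) ` {sum_root_C l r j |r j. r < l \<and> j \<le> r \<and> W r j}
      = {ratio_inv l r j |r j. r < l \<and> j \<le> r \<and> W r j}"
    by (force simp: image_iff hyp_pullback_C simp del: One_nat_def)+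
  then show ?thesis unfolding J by (simp add: ratio_arr_def image_Un)
qed

lemma inductive_exps_ideal_C:
  assumes J: "is_ideal (pos_roots TC l) J" and l: "1 \<le> l"
  shows "\<exists>E. inductive_exps l (hyp_pullback l (root_coords l (l - 1)) ` J) E"
proof -
  define V where "V r j \<longleftrightarrow> r < l \<and> j < r \<and> diff_root l (l - 1) r j \<in> J" for r j
  define W where "W r j \<longleftrightarrow> r < l \<and> j < l \<and> sum_root_C l r j \<in> J" for r j
  have roots: "r < l \<Longrightarrow> j < r \<Longrightarrow> diff_root l (l - 1) r j \<in> pos_roots TC l"
    "r < l \<Longrightarrow> j \<le> r \<Longrightarrow> sum_root_C l r j \<in> pos_roots TC l" for r j
    unfolding pos_roots_C[OF l] by blast+
  have sum_root: "sum_root_C l r j \<in> pos_roots TC l" if "r < l" "j < l" for r j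
    using roots(2)[of r j] roots(2)[of j r] that by (cases "j \<le> r") (simp_all add: add.commute)
  note smaller = is_idealD[OF J] and order = eps_mono eps_nonneg
  have "\<exists>E. inductive_exps l (ratio_arr l V W) E"
  proof (rule inductive_exps_ratio_arr)
    show "V r' j'" if "V r j" "j \<le> j'" "j' < r'" "r' \<le> r" for r j r' j'
      using that smaller[OF _ roots(1), of "diff_root l (l - 1) r j" r' j']
        by (auto simp: V_def order diff_mono)
    show "W r' j'" if "W r j" "r' \<le> r" "j' \<le> j" for r j r' j'
      using that smaller[OF _ sum_root, of "sum_root_C l r j" r' j'] by (auto simp: W_def order add_mono)
    show "V r j'" if "W r j" "j' < r" for r j j'
    proof -
      have "diff_root l (l - 1) r j' k \<le> sum_root_C l r j k" for k
        using eps_nonneg[of l "l - 1" j' k] eps_nonneg[of l "l - 1" j k] eps_nonneg[of l l 0 k] by linarith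
      then show ?thesis
        using that smaller[OF _ roots(1), of "sum_root_C l r j" r j'] by (auto simp: W_def V_def)
    qed
  qed
  moreover have "hyp_pullback l (root_coords l (l - 1)) ` J = ratio_arr l V W"
    using is_ideal_subset[OF J] l by (rule hyp_pullback_image_C) (simp_all add: V_def W_def)
  ultimately show ?thesis by simp
qed

lemma is_ideal_A_imp_B:
  assumes "is_ideal (pos_roots TA l) J"
  shows "is_ideal (pos_roots TB l) J"
  unfolding is_ideal_def
proof (intro conjI ballI impI)
  show "J \<subseteq> pos_roots TB l" using assms by (auto simp: is_ideal_def)
  fix b1 b2 assume b: "b1 \<in> J" "b2 \<in> pos_roots TB l" "root_le b2 b1"
  have "b1 \<in> pos_roots TA l" using assms b(1) unfolding is_ideal_def by blast
  then obtain i j where b1: "b1 = seg i j" by auto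
  have "b2 \<in> pos_roots TA l"
  proof (rule ccontr)
    assume "b2 \<notin> pos_roots TA l"
    then obtain i' j' where "j' < l" "b2 = (\<lambda>k. seg i' j' k + 2 * seg j' l k)"
      using b(2) unfolding pos_roots.simps by blast
    then have "b2 j' = 2" by (simp add: seg_def)
    moreover have "b2 j' \<le> 1" using b(3) unfolding root_le_def b1
      by (auto simp: seg_def split: if_splits dest: spec[of _ j'])
    ultimately show False by simp
  qed
  then show "b2 \<in> J" using assms b unfolding is_ideal_def by blast
qed

lemma inductive_exps_ideal:
  assumes "is_ideal (pos_roots T l) J" "1 \<le> l"
  obtains \<phi> E where "monomial_aut l \<phi>" "inductive_exps l (hyp_pullback l \<phi> ` J) E"
proof (cases T)
  case TA
  then show thesis
    using inductive_exps_ideal_B is_ideal_A_imp_B assms(1) monomial_aut_root_coords[OF order_refl] that by metis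
next
  case TB
  then show thesis using inductive_exps_ideal_B assms(1) monomial_aut_root_coords[OF order_refl] that by metis
next
  case TC
  then show thesis using inductive_exps_ideal_C assms monomial_aut_root_coords[OF diff_le_self] that by metis
qed

lemma is_ideal_relabel:
  assumes "is_ideal (pos_roots_lab T l s) I"
  obtains J where "is_ideal (pos_roots T l) J" "I = (\<lambda>b. b \<circ> s) ` J"
proof
  show "I = (\<lambda>b. b \<circ> s) ` {b \<in> pos_roots T l. b \<circ> s \<in> I}"
    using assms unfolding is_ideal_def pos_roots_lab_def by blast
  show "is_ideal (pos_roots T l) {b \<in> pos_roots T l. b \<circ> s \<in> I}"
    using assms unfolding is_ideal_def pos_roots_lab_def root_le_def by (auto simp del: pos_roots.simps)
qed

lemma hyp_pullback_permute:
  assumes "s permutes {..<l}"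
  shows "hyp_pullback l ((\<lambda>t. t \<circ> s) \<circ> \<phi>) (b \<circ> s) = hyp_pullback l \<phi> b"
proof -
  have "chr l (b \<circ> s) (t \<circ> s) = chr l b t" for t
    unfolding chr_def using prod.permute[OF assms, of "\<lambda>i. t i powi b i"] by (simp add: o_def)
  then show ?thesis by (simp add: hyp_pullback_def)
qed

theorem theorem1p4:
  fixes T :: rtype and l :: nat and s :: "nat \<Rightarrow> nat" and I :: "lat set"
  assumes "l \<ge> 1"
    and "s permutes {..<l}"
    and "is_ideal (pos_roots_lab T l s) I"
  shows "inductive_arr l (torus l) (toric_arr l I)"
proof -
  obtain J where J: "is_ideal (pos_roots T l) J" "I = (\<lambda>b. b \<circ> s) ` J"
    using is_ideal_relabel[OF assms(3)] .
  obtain \<phi> E where \<phi>: "monomial_aut l \<phi>" and exps: "inductive_exps l (hyp_pullback l \<phi> ` J) E"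
    using inductive_exps_ideal[OF J(1) assms(1)] .
  have "monomial_aut l ((\<lambda>t. t \<circ> s) \<circ> \<phi>)"
    using monomial_aut_comp[OF monomial_aut_permute[OF assms(2)] \<phi>] .
  moreover have "hyp_pullback l ((\<lambda>t. t \<circ> s) \<circ> \<phi>) ` I = hyp_pullback l \<phi> ` J"
    unfolding J(2) image_image hyp_pullback_permute[OF assms(2)] ..
  ultimately show ?thesis using exps inductive_toric_arr by metis
qed

end
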